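(* Let $\tau, \omega > 0$ and let $T = \chi_{(-\tau,\tau)} + S_\omega$, a bounded operator on $L^2(\mathbb{R})$. If $\lambda \in \sigma(T)$ and $\lambda \neq 0, 1$, then $$(\lambda - 1)^2 = \lambda_n(\omega\tau)$$ for some $n \in \{0, 1, 2, \dots\}$.
   Context: $L^2(\mathbb{R})$ is the complex Hilbert space of square-integrable functions, and $\sigma(T)$ denotes the spectrum of a bounded operator $T$. For $\tau > 0$, $\chi_{(-\tau,\tau)}$ denotes both the characteristic function of the interval $(-\tau,\tau)$ and the orthogonal projection $f \mapsto \chi_{(-\tau,\tau)} f$ on $L^2(\mathbb{R})$. The Fourier transform $\mathcal{F}$ is the unitary operator on $L^2(\mathbb{R})$ given by $\mathcal{F} f(\xi) = \frac{1}{\sqrt{2\pi}} \lim_{N\to\infty} \int_{-N}^{N} e^{-i x\xi} f(x)\,dx$ (limit in $L^2(\mathbb{R})$). For $\omega > 0$, $S_\omega := \mathcal{F} \chi_{(-\omega,\omega)} \mathcal{F}^*$; it is an orthogonal projection on $L^2(\mathbb{R})$, and $$S_\omega f(x) = \int_{\mathbb{R}} \frac{\sin \omega(x-y)}{\pi(x-y)} f(y)\,dy.$$ For $c > 0$, $\lambda_0(c) > \lambda_1(c) > \dots > 0$ denote the eigenvalues of the integral operator on $L^2(-1,1)$ with kernel $\frac{\sin c(x-y)}{\pi(x-y)}$, listed in decreasing order. *)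

theory Defs
  imports "HOL-Analysis.Analysis"
begin

text \<open>
  Elements of the Hilbert space \<open>L\<^sup>2(M)\<close> are represented by square-integrable functions; two
  functions are the same element if they agree almost everywhere. Operators are maps on
  representatives, and all identities between elements are stated almost everywhere.
\<close>

definition L2 :: "'a measure \<Rightarrow> ('a \<Rightarrow> complex) set" where
  "L2 M = {f \<in> borel_measurable M. integrable M (\<lambda>x. (cmod (f x))\<^sup>2)}"

definition L2_nrm :: "'a measure \<Rightarrow> ('a \<Rightarrow> complex) \<Rightarrow> real" where
  "L2_nrm M f = sqrt (\<integral>x. (cmod (f x))\<^sup>2 \<partial>M)"

definition L2_inner :: "'a measure \<Rightarrow> ('a \<Rightarrow> complex) \<Rightarrow> ('a \<Rightarrow> complex) \<Rightarrow> complex" where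
  "L2_inner M f g = (\<integral>x. f x * cnj (g x) \<partial>M)"

text \<open>
  Compatibility with almost-everywhere equality is not listed below: it follows from linearity
  and boundedness applied to the difference of two representatives.
\<close>

definition L2_bounded_operator ::
    "'a measure \<Rightarrow> (('a \<Rightarrow> complex) \<Rightarrow> 'a \<Rightarrow> complex) \<Rightarrow> bool" where
  "L2_bounded_operator M A \<longleftrightarrow>
     (\<forall>f \<in> L2 M. A f \<in> L2 M) \<and>
     (\<forall>f \<in> L2 M. \<forall>g \<in> L2 M. \<forall>a b.
        AE x in M. A (\<lambda>y. a * f y + b * g y) x = a * A f x + b * A g x) \<and>
     (\<exists>C. \<forall>f \<in> L2 M. L2_nrm M (A f) \<le> C * L2_nrm M f)"

definition L2_spectrum ::
    "'a measure \<Rightarrow> (('a \<Rightarrow> complex) \<Rightarrow> 'a \<Rightarrow> complex) \<Rightarrow> complex set" where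
  "L2_spectrum M A =
     {z. \<not> (\<exists>R. L2_bounded_operator M R \<and>
               (\<forall>f \<in> L2 M. AE x in M. R (\<lambda>y. A f y - z * f y) x = f x) \<and>
               (\<forall>f \<in> L2 M. AE x in M. A (R f) x - z * R f x = f x))}"

definition L2_eigenvalues ::
    "'a measure \<Rightarrow> (('a \<Rightarrow> complex) \<Rightarrow> 'a \<Rightarrow> complex) \<Rightarrow> complex set" where
  "L2_eigenvalues M A =
     {z. \<exists>f \<in> L2 M. \<not> (AE x in M. f x = 0) \<and> (AE x in M. A f x = z * f x)}"

text \<open>The adjoint, determined up to almost-everywhere equality.\<close>

definition L2_adjoint ::
    "'a measure \<Rightarrow> (('a \<Rightarrow> complex) \<Rightarrow> 'a \<Rightarrow> complex) \<Rightarrow> ('a \<Rightarrow> complex) \<Rightarrow> 'a \<Rightarrow> complex" where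
  "L2_adjoint M A g =
     (SOME h. h \<in> L2 M \<and> (\<forall>f \<in> L2 M. L2_inner M (A f) g = L2_inner M f h))"

definition cutoff :: "real \<Rightarrow> (real \<Rightarrow> complex) \<Rightarrow> real \<Rightarrow> complex" where
  "cutoff t f = (\<lambda>x. indicator {-t<..<t} x * f x)"

definition fourier_trunc :: "real \<Rightarrow> (real \<Rightarrow> complex) \<Rightarrow> real \<Rightarrow> complex" where
  "fourier_trunc N f \<xi> =
     complex_of_real (1 / sqrt (2 * pi)) *
     (LINT x:{-N..N}|lborel. exp (- \<i> * complex_of_real (x * \<xi>)) * f x)"

text \<open>
  The limit is taken in \<open>L\<^sup>2\<close>. The distance is a nonnegative integral, because the Bochner integral
  would be \<open>0\<close> on differences that are not square integrable.
\<close>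

definition fourier :: "(real \<Rightarrow> complex) \<Rightarrow> real \<Rightarrow> complex" where
  "fourier f =
     (SOME g. g \<in> L2 lborel \<and>
        ((\<lambda>N. \<integral>\<^sup>+\<xi>. ennreal ((cmod (g \<xi> - fourier_trunc N f \<xi>))\<^sup>2) \<partial>lborel) \<longlongrightarrow> 0) at_top)"

definition band_limit :: "real \<Rightarrow> (real \<Rightarrow> complex) \<Rightarrow> real \<Rightarrow> complex" where
  "band_limit w f = fourier (cutoff w (L2_adjoint lborel fourier f))"

definition unit_interval_measure :: "real measure" where
  "unit_interval_measure = restrict_space lborel {-1<..<1}"

text \<open>The kernel takes the value \<open>0\<close> for \<open>y = x\<close>, which does not affect the integral.\<close>

definition sinc_operator :: "real \<Rightarrow> (real \<Rightarrow> complex) \<Rightarrow> real \<Rightarrow> complex" where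
  "sinc_operator c f x =
     (\<integral>y. complex_of_real (sin (c * (x - y)) / (pi * (x - y))) * f y \<partial>unit_interval_measure)"

definition sinc_eigenvalues :: "real \<Rightarrow> real set" where
  "sinc_eigenvalues c =
     {\<mu>. complex_of_real \<mu> \<in> L2_eigenvalues unit_interval_measure (sinc_operator c)}"

text \<open>
  The operator is self-adjoint, so that all its eigenvalues are real. Listed in strictly decreasing
  order from index \<open>0\<close>, the \<open>n\<close>-th eigenvalue is the one with exactly \<open>n\<close> larger eigenvalues.
\<close>

definition sinc_eigenvalue :: "real \<Rightarrow> nat \<Rightarrow> real" where
  "sinc_eigenvalue c n =
     (THE \<mu>. \<mu> \<in> sinc_eigenvalues c \<and>
        finite {\<nu> \<in> sinc_eigenvalues c. \<nu> > \<mu>} \<and> card {\<nu> \<in> sinc_eigenvalues c. \<nu> > \<mu>} = n)"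

end

theory Submission
  imports Defs "HOL-Probability.Characteristic_Functions" "HOL-Complex_Analysis.Great_Picard"
begin

text \<open>
  Let \<open>P\<close> be the cutoff to \<open>(-\<tau>,\<tau>)\<close>, let \<open>Q\<close> be the band limiting to \<open>(-\<omega>,\<omega>)\<close>, and put
  \<open>\<mu> = z - 1\<close>. Both operators
  are bounded and idempotent. Suppose \<open>P f + Q f - z f = g\<close> and write \<open>u = P f\<close>, \<open>v = Q f\<close>. Applying
  \<open>P\<close> and \<open>Q\<close> to the equation gives \<open>P v = \<mu> u + P g\<close> and \<open>Q u = \<mu> v + Q g\<close>, and eliminating \<open>v\<close>
  leaves \<open>(P Q P - \<mu>\<^sup>2) u = P Q g + \<mu> P g\<close>. From \<open>u\<close> one recovers \<open>v\<close> by dividing by \<open>\<mu>\<close> and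
  \<open>f = (u + v - g) / z\<close>. Hence for \<open>z \<noteq> 0, 1\<close> the number \<open>z\<close> is in the resolvent set as soon as
  \<open>P Q P - \<mu>\<^sup>2\<close> is invertible on the range of \<open>P\<close>; this is
  \<open>not_in_spectrum_cutoff_plus_band_limit\<close>.

  The operator \<open>P Q P\<close> is the integral operator on \<open>(-\<tau>,\<tau>)\<close> with the sinc kernel
  (\<open>band_limit_cutoff\<close>). The kernel is bounded and Lipschitz continuous, so the operator maps \<open>L\<^sup>2\<close>
  into continuous functions and is compact on them by the Arzela--Ascoli theorem. Solving the
  resolvent equation for the continuous function \<open>P Q P u\<close> instead of \<open>u\<close> therefore reduces
  everything to the Riesz--Schauder theorem: if \<open>\<mu>\<^sup>2\<close> is not an eigenvalue, then \<open>P Q P - \<mu>\<^sup>2\<close>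
  is invertible (\<open>Fredholm_alternative\<close>). Dilating by \<open>\<tau>\<close> turns an eigenfunction on
  \<open>(-\<tau>,\<tau>)\<close> into one of the sinc operator on \<open>(-1,1)\<close> with parameter \<open>\<omega> \<tau>\<close>.

  It remains to see that a nonzero eigenvalue of the sinc operator has an index in the decreasing
  enumeration. The quadratic form of the operator is the energy of the Fourier transform inside the
  band, so eigenvalues are real and nonnegative; Bessel's inequality, applied to the functions
  \<open>y \<mapsto> k(x - y)\<close>, bounds the number of eigenvalues above any \<open>\<nu> > 0\<close>. The index is then the
  number of larger eigenvalues (\<open>sinc_eigenvalue_card\<close>).

  Idempotence of \<open>Q\<close> rests on \<open>F\<^sup>* F = 1\<close> for the Fourier transform \<open>F\<close>. The proof inserts the
  weight \<open>exp (- (\<delta> \<xi>)\<^sup>2 / 2)\<close> on the frequency side, which on the space side is convolution with a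
  Gaussian of width \<open>\<delta>\<close>. The estimate that is uniform in \<open>\<delta>\<close> shows that \<open>F\<close> is a contraction,
  hence that the limit of the truncated transforms exists. The limit \<open>\<delta> \<rightarrow> 0\<close> in the product with
  the transform of an interval shows that \<open>F\<^sup>* F f - f\<close> has integral \<open>0\<close> over every interval.
\<close>

section \<open>The space \<open>L\<^sup>2\<close>\<close>

lemma cmod_add_sq_le: "(cmod (a + b))\<^sup>2 \<le> 2 * (cmod a)\<^sup>2 + 2 * (cmod b)\<^sup>2"
proof -
  have "(cmod (a + b))\<^sup>2 \<le> (cmod a + cmod b)\<^sup>2"
    by (intro power_mono norm_triangle_ineq) simp
  also have "\<dots> \<le> 2 * (cmod a)\<^sup>2 + 2 * (cmod b)\<^sup>2"
    using sum_squares_bound[of "cmod a" "cmod b"] by (simp add: power2_sum)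
  finally show ?thesis .
qed

lemma borel_measurable_cnj [measurable (raw)]:
  "f \<in> borel_measurable M \<Longrightarrow> (\<lambda>x. cnj (f x)) \<in> borel_measurable M"
  by (rule borel_measurable_continuous_on[OF continuous_on_cnj[OF continuous_on_id]])

lemma L2_measurable: "f \<in> L2 M \<Longrightarrow> f \<in> borel_measurable M"
  by (simp add: L2_def)

lemma L2_integrable_sq [simp]: "f \<in> L2 M \<Longrightarrow> integrable M (\<lambda>x. (cmod (f x))\<^sup>2)"
  by (simp add: L2_def)

lemma L2_iff_nn_integral:
  "f \<in> L2 M \<longleftrightarrow> f \<in> borel_measurable M \<and> (\<integral>\<^sup>+x. ennreal ((cmod (f x))\<^sup>2) \<partial>M) < \<infinity>"
  by (auto simp: L2_def integrable_iff_bounded simp del: L2_integrable_sq)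

lemma L2_bounded_by:
  assumes "f \<in> L2 M" and "g \<in> borel_measurable M" and "AE x in M. cmod (g x) \<le> cmod (f x)"
  shows "g \<in> L2 M"
proof -
  have [measurable]: "g \<in> borel_measurable M" by fact
  have "integrable M (\<lambda>x. (cmod (g x))\<^sup>2)"
    using assms(3) by (intro Bochner_Integration.integrable_bound[OF L2_integrable_sq[OF assms(1)]])
      (auto elim: eventually_mono intro!: power_mono)
  then show ?thesis by (simp add: L2_def assms del: L2_integrable_sq)
qed

lemma L2_scale [intro]: "f \<in> L2 M \<Longrightarrow> (\<lambda>x. a * f x) \<in> L2 M"
  by (auto simp: L2_def norm_mult power_mult_distrib simp del: L2_integrable_sq)

lemma L2_add [intro]:
  assumes f: "f \<in> L2 M" and g: "g \<in> L2 M" shows "(\<lambda>x. f x + g x) \<in> L2 M"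
proof -
  have [measurable]: "f \<in> borel_measurable M" "g \<in> borel_measurable M" using f g by (simp_all add: L2_measurable)
  have "integrable M (\<lambda>x. (cmod (f x + g x))\<^sup>2)"
  proof (rule Bochner_Integration.integrable_bound)
    show "integrable M (\<lambda>x. 2 * (cmod (f x))\<^sup>2 + 2 * (cmod (g x))\<^sup>2)" using f g by simp
  qed (auto intro!: AE_I2 cmod_add_sq_le)
  then show ?thesis by (simp add: L2_def del: L2_integrable_sq)
qed

lemma L2_lincomb [intro]: "f \<in> L2 M \<Longrightarrow> g \<in> L2 M \<Longrightarrow> (\<lambda>x. a * f x + b * g x) \<in> L2 M"
  by (intro L2_add L2_scale)

lemma L2_diff [intro]: "f \<in> L2 M \<Longrightarrow> g \<in> L2 M \<Longrightarrow> (\<lambda>x. f x - g x) \<in> L2 M"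
  using L2_lincomb[of f M g 1 "-1"] by simp

lemma L2_integrable_mult:
  assumes f: "f \<in> L2 M" and g: "g \<in> L2 M" shows "integrable M (\<lambda>x. f x * g x)"
proof -
  have [measurable]: "f \<in> borel_measurable M" "g \<in> borel_measurable M" using f g by (simp_all add: L2_measurable)
  show ?thesis
  proof (rule Bochner_Integration.integrable_bound)
    show "integrable M (\<lambda>x. (cmod (f x))\<^sup>2 + (cmod (g x))\<^sup>2)" using f g by simp
    show "AE x in M. norm (f x * g x) \<le> norm ((cmod (f x))\<^sup>2 + (cmod (g x))\<^sup>2)"
    proof (intro AE_I2)
      fix x
      have "2 * (cmod (f x) * cmod (g x)) \<le> (cmod (f x))\<^sup>2 + (cmod (g x))\<^sup>2"
        using sum_squares_bound[of "cmod (f x)" "cmod (g x)"] by simp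
      moreover have "0 \<le> cmod (f x) * cmod (g x)" by simp
      ultimately show "norm (f x * g x) \<le> norm ((cmod (f x))\<^sup>2 + (cmod (g x))\<^sup>2)"
        unfolding norm_mult real_norm_def by linarith
    qed
  qed simp
qed

lemma L2_cnj: "f \<in> L2 M \<Longrightarrow> (\<lambda>x. cnj (f x)) \<in> L2 M"
  by (auto simp: L2_def simp del: L2_integrable_sq)

lemma L2_integrable_inner: "f \<in> L2 M \<Longrightarrow> g \<in> L2 M \<Longrightarrow> integrable M (\<lambda>x. f x * cnj (g x))"
  by (intro L2_integrable_mult L2_cnj)

lemma L2_nrm_nonneg [simp]: "0 \<le> L2_nrm M f"
  by (simp add: L2_nrm_def)

lemma L2_nrm_sq: "(L2_nrm M f)\<^sup>2 = (\<integral>x. (cmod (f x))\<^sup>2 \<partial>M)"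
  by (simp add: L2_nrm_def)

lemma L2_nrm_eq_0_iff: "f \<in> L2 M \<Longrightarrow> L2_nrm M f = 0 \<longleftrightarrow> (AE x in M. f x = 0)"
  by (simp add: L2_nrm_def integral_nonneg_eq_0_iff_AE)

lemma L2_nrm_cong_AE:
  assumes "f \<in> borel_measurable M" "g \<in> borel_measurable M" "AE x in M. f x = g x"
  shows "L2_nrm M f = L2_nrm M g"
  unfolding L2_nrm_def using assms
  by (intro arg_cong[of _ _ sqrt] integral_cong_AE) auto

lemma L2_nrm_scale: "L2_nrm M (\<lambda>x. a * f x) = cmod a * L2_nrm M f"
  by (simp add: L2_nrm_def norm_mult power_mult_distrib real_sqrt_mult)

lemma L2_nrm_mono:
  assumes "g \<in> L2 M" "f \<in> borel_measurable M" "AE x in M. cmod (f x) \<le> cmod (g x)"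
  shows "L2_nrm M f \<le> L2_nrm M g"
  unfolding L2_nrm_def real_sqrt_le_iff
  using assms L2_bounded_by[OF assms] by (intro integral_mono_AE) (auto intro: power_mono)

text \<open>
  The inequality between arithmetic and geometric means, with the weights that make both terms
  equal after integration.
\<close>

lemma L2_Cauchy_Schwarz_integral:
  assumes f: "f \<in> L2 M" and g: "g \<in> L2 M"
  shows "(\<integral>x. cmod (f x) * cmod (g x) \<partial>M) \<le> L2_nrm M f * L2_nrm M g"
proof (cases "L2_nrm M f = 0 \<or> L2_nrm M g = 0")
  case True
  then have "AE x in M. f x = 0 \<or> g x = 0"
    using f g by (auto simp: L2_nrm_eq_0_iff)
  then have "(\<integral>x. cmod (f x) * cmod (g x) \<partial>M) = (\<integral>x. 0 \<partial>M)"
    using L2_measurable[OF f] L2_measurable[OF g] by (intro integral_cong_AE) auto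
  with True show ?thesis by auto
next
  case False
  define F G where "F = L2_nrm M f" and "G = L2_nrm M g"
  have pos: "F > 0" "G > 0"
    using False by (simp_all add: F_def G_def order_less_le)
  have int: "integrable M (\<lambda>x. cmod (f x) * cmod (g x))"
    using integrable_norm[OF L2_integrable_mult[OF f g]] by (simp add: norm_mult)
  have "(\<integral>x. cmod (f x) * cmod (g x) \<partial>M) \<le> (\<integral>x. (G / (2 * F)) * (cmod (f x))\<^sup>2 + (F / (2 * G)) * (cmod (g x))\<^sup>2 \<partial>M)"
  proof (rule integral_mono[OF int])
    show "integrable M (\<lambda>x. (G / (2 * F)) * (cmod (f x))\<^sup>2 + (F / (2 * G)) * (cmod (g x))\<^sup>2)"
      using f g by simp
    fix x
    have "0 \<le> (G * cmod (f x) - F * cmod (g x))\<^sup>2 / (2 * F * G)"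
      using pos by simp
    also have "\<dots> = (G / (2 * F)) * (cmod (f x))\<^sup>2 + (F / (2 * G)) * (cmod (g x))\<^sup>2 - cmod (f x) * cmod (g x)"
      using pos by (simp add: field_simps power2_eq_square)
    finally show "cmod (f x) * cmod (g x) \<le> (G / (2 * F)) * (cmod (f x))\<^sup>2 + (F / (2 * G)) * (cmod (g x))\<^sup>2"
      by simp
  qed
  also have "\<dots> = (G / (2 * F)) * F\<^sup>2 + (F / (2 * G)) * G\<^sup>2"
    using f g by (simp add: F_def G_def L2_nrm_sq)
  also have "\<dots> = F * G"
    using pos by (simp add: field_simps power2_eq_square)
  finally show ?thesis by (simp add: F_def G_def)
qed

lemma L2_Cauchy_Schwarz:
  assumes f: "f \<in> L2 M" and g: "g \<in> L2 M"
  shows "cmod (L2_inner M f g) \<le> L2_nrm M f * L2_nrm M g"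
proof -
  have "cmod (L2_inner M f g) \<le> (\<integral>x. cmod (f x * cnj (g x)) \<partial>M)"
    unfolding L2_inner_def by (rule integral_norm_bound)
  also have "\<dots> \<le> L2_nrm M f * L2_nrm M g"
    using L2_Cauchy_Schwarz_integral[OF f g] by (simp add: norm_mult)
  finally show ?thesis .
qed

lemma L2_nrm_triangle:
  assumes f: "f \<in> L2 M" and g: "g \<in> L2 M"
  shows "L2_nrm M (\<lambda>x. f x + g x) \<le> L2_nrm M f + L2_nrm M g"
proof (rule power2_le_imp_le)
  have int: "integrable M (\<lambda>x. cmod (f x) * cmod (g x))"
    using integrable_norm[OF L2_integrable_mult[OF f g]] by (simp add: norm_mult)
  have "(L2_nrm M (\<lambda>x. f x + g x))\<^sup>2 \<le> (\<integral>x. (cmod (f x))\<^sup>2 + (cmod (g x))\<^sup>2 + 2 * (cmod (f x) * cmod (g x)) \<partial>M)"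
    unfolding L2_nrm_sq
  proof (rule integral_mono)
    show "(cmod (f x + g x))\<^sup>2 \<le> (cmod (f x))\<^sup>2 + (cmod (g x))\<^sup>2 + 2 * (cmod (f x) * cmod (g x))" for x
      using power_mono[OF norm_triangle_ineq[of "f x" "g x"] norm_ge_zero, of 2] by (simp add: power2_sum)
  qed (use f g int L2_add[OF f g] in simp_all)
  also have "\<dots> = (L2_nrm M f)\<^sup>2 + (L2_nrm M g)\<^sup>2 + 2 * (\<integral>x. cmod (f x) * cmod (g x) \<partial>M)"
    using f g int by (simp add: L2_nrm_sq)
  also have "\<dots> \<le> (L2_nrm M f + L2_nrm M g)\<^sup>2"
    using L2_Cauchy_Schwarz_integral[OF f g] by (simp add: power2_sum)
  finally show "(L2_nrm M (\<lambda>x. f x + g x))\<^sup>2 \<le> (L2_nrm M f + L2_nrm M g)\<^sup>2" .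
qed simp

lemma L2_nrm_triangle_diff:
  assumes f: "f \<in> L2 M" and g: "g \<in> L2 M"
  shows "L2_nrm M (\<lambda>x. f x - g x) \<le> L2_nrm M f + L2_nrm M g"
  using L2_nrm_triangle[OF f L2_scale[OF g, of "-1"]] L2_nrm_scale[of M "-1" g] by simp

lemma L2_nn_integral_sq:
  assumes "f \<in> L2 M" shows "(\<integral>\<^sup>+x. ennreal ((cmod (f x))\<^sup>2) \<partial>M) = ennreal ((L2_nrm M f)\<^sup>2)"
  using assms by (simp add: L2_nrm_sq nn_integral_eq_integral)

lemma L2_inner_lincomb_left:
  assumes "f \<in> L2 M" "g \<in> L2 M" "h \<in> L2 M"
  shows "L2_inner M (\<lambda>x. a * f x + b * g x) h = a * L2_inner M f h + b * L2_inner M g h"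
proof -
  have "L2_inner M (\<lambda>x. a * f x + b * g x) h = (\<integral>x. a * (f x * cnj (h x)) + b * (g x * cnj (h x)) \<partial>M)"
    by (simp add: L2_inner_def algebra_simps)
  also have "\<dots> = a * L2_inner M f h + b * L2_inner M g h"
    using assms by (simp add: L2_inner_def L2_integrable_inner)
  finally show ?thesis .
qed

lemma L2_inner_diff_left:
  assumes "f \<in> L2 M" "g \<in> L2 M" "h \<in> L2 M"
  shows "L2_inner M (\<lambda>x. f x - g x) h = L2_inner M f h - L2_inner M g h"
  using L2_inner_lincomb_left[OF assms, of 1 "-1"] by simp

lemma L2_inner_commute: "L2_inner M g f = cnj (L2_inner M f g)"
proof -
  have "cnj (L2_inner M f g) = (\<integral>x. cnj (f x * cnj (g x)) \<partial>M)"
    unfolding L2_inner_def by (rule Bochner_Integration.integral_cnj[symmetric])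
  then show ?thesis by (simp add: L2_inner_def mult.commute)
qed

lemma L2_inner_diff_right:
  assumes "f \<in> L2 M" "g \<in> L2 M" "h \<in> L2 M"
  shows "L2_inner M h (\<lambda>x. f x - g x) = L2_inner M h f - L2_inner M h g"
  by (simp add: L2_inner_commute[of M h] L2_inner_diff_left[OF assms])

lemma L2_inner_self: "L2_inner M f f = complex_of_real ((L2_nrm M f)\<^sup>2)"
  unfolding L2_inner_def L2_nrm_sq
  by (subst integral_complex_of_real[symmetric]) (simp add: complex_norm_square[symmetric])

lemma L2_inner_eq_imp_AE_eq:
  assumes g: "g \<in> L2 M" and h: "h \<in> L2 M"
    and eq: "\<And>f. f \<in> L2 M \<Longrightarrow> L2_inner M f g = L2_inner M f h"
  shows "AE x in M. g x = h x"
proof -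
  let ?d = "\<lambda>x. g x - h x"
  have d: "?d \<in> L2 M" using g h by auto
  have "L2_inner M ?d ?d = 0"
    using eq[OF d] by (simp add: L2_inner_diff_right[OF g h d])
  then have "L2_nrm M ?d = 0"
    by (simp add: L2_inner_self)
  then show ?thesis using d by (auto simp: L2_nrm_eq_0_iff)
qed

lemma L2_inner_cong_AE:
  assumes "f \<in> borel_measurable M" "f' \<in> borel_measurable M" "AE x in M. f x = f' x"
      "g \<in> borel_measurable M" "g' \<in> borel_measurable M" "AE x in M. g x = g' x"
  shows "L2_inner M f g = L2_inner M f' g'"
  unfolding L2_inner_def using assms by (intro integral_cong_AE) auto

text \<open>
  Limits of truncated transforms are limits in norm, so identities between inner products pass to
  the limit by the Cauchy--Schwarz inequality. This is how every statement about the Fourier transform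
  on \<open>L\<^sup>2\<close> is obtained from the corresponding one about Fourier integrals.
\<close>

lemma L2_inner_tendsto:
  assumes f: "\<And>n. f n \<in> L2 M" and l: "l \<in> L2 M" and h: "h \<in> L2 M"
    and lim: "((\<lambda>n. L2_nrm M (\<lambda>x. l x - f n x)) \<longlongrightarrow> 0) F"
  shows "((\<lambda>n. L2_inner M (f n) h) \<longlongrightarrow> L2_inner M l h) F"
proof -
  have "((\<lambda>n. L2_inner M l h - L2_inner M (f n) h) \<longlongrightarrow> 0) F"
  proof (rule Lim_null_comparison)
    show "\<forall>\<^sub>F n in F. norm (L2_inner M l h - L2_inner M (f n) h) \<le> L2_nrm M (\<lambda>x. l x - f n x) * L2_nrm M h"
      using L2_Cauchy_Schwarz[OF L2_diff[OF l f] h]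
      by (simp add: L2_inner_diff_left[OF l f h])
    show "((\<lambda>n. L2_nrm M (\<lambda>x. l x - f n x) * L2_nrm M h) \<longlongrightarrow> 0) F"
      using tendsto_mult_left_zero[OF lim] .
  qed
  then have "((\<lambda>n. L2_inner M l h - (L2_inner M l h - L2_inner M (f n) h)) \<longlongrightarrow> L2_inner M l h - 0) F"
    by (intro tendsto_diff tendsto_const)
  then show ?thesis by simp
qed

lemma L2_nrm_tendsto:
  assumes f: "\<And>n. f n \<in> L2 M" and l: "l \<in> L2 M"
    and lim: "((\<lambda>n. L2_nrm M (\<lambda>x. l x - f n x)) \<longlongrightarrow> 0) F"
  shows "((\<lambda>n. L2_nrm M (f n)) \<longlongrightarrow> L2_nrm M l) F"
proof -
  have "((\<lambda>n. L2_nrm M (f n) - L2_nrm M l) \<longlongrightarrow> 0) F"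
  proof (rule Lim_null_comparison[OF _ lim], intro always_eventually allI)
    fix n
    have d: "(\<lambda>x. l x - f n x) \<in> L2 M" using l f by auto
    have "L2_nrm M l \<le> L2_nrm M (f n) + L2_nrm M (\<lambda>x. l x - f n x)"
      using L2_nrm_triangle[OF f d, of n] by simp
    moreover have "L2_nrm M (f n) \<le> L2_nrm M l + L2_nrm M (\<lambda>x. l x - f n x)"
      using L2_nrm_triangle_diff[OF l d] by simp
    ultimately show "norm (L2_nrm M (f n) - L2_nrm M l) \<le> L2_nrm M (\<lambda>x. l x - f n x)"
      by (simp add: abs_le_iff)
  qed
  then show ?thesis by (simp add: LIM_zero_iff)
qed

lemma L2_limit_unique:
  assumes f: "\<And>n. f n \<in> L2 M" and l: "l \<in> L2 M" and m: "m \<in> L2 M" and F: "F \<noteq> bot"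
    and lim: "((\<lambda>n. L2_nrm M (\<lambda>x. l x - f n x)) \<longlongrightarrow> 0) F" "((\<lambda>n. L2_nrm M (\<lambda>x. m x - f n x)) \<longlongrightarrow> 0) F"
  shows "AE x in M. l x = m x"
proof -
  have "L2_inner M l h = L2_inner M m h" if "h \<in> L2 M" for h
    using tendsto_unique[OF F L2_inner_tendsto[OF f l that lim(1)] L2_inner_tendsto[OF f m that lim(2)]] .
  then show ?thesis
    by (intro L2_inner_eq_imp_AE_eq[OF l m]) (simp add: L2_inner_commute[of M _ l] L2_inner_commute[of M _ m])
qed

text \<open>
  The bound on the differences leaves room for the weights \<open>4^n\<close>: the weighted sum of their squares
  still has finite integral, so it is finite almost everywhere, and at such a point the differences
  decay geometrically.
\<close>

lemma L2_AE_convergent_of_fast: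
  assumes f: "\<And>n. f n \<in> L2 M"
    and fast: "\<And>n. L2_nrm M (\<lambda>x. f (Suc n) x - f n x) \<le> (1/4)^n"
  shows "AE x in M. convergent (\<lambda>n. f n x)"
proof -
  let ?d = "\<lambda>n x. f (Suc n) x - f n x"
  let ?S = "\<lambda>x. \<Sum>n. ennreal (4^n * (cmod (?d n x))\<^sup>2)"
  have d: "?d n \<in> L2 M" for n using f by auto
  have dm [measurable]: "f n \<in> borel_measurable M" for n using f by (simp add: L2_measurable)
  have "(\<integral>\<^sup>+x. (?S x) \<partial>M) = (\<Sum>n. \<integral>\<^sup>+x. ennreal (4^n * (cmod (?d n x))\<^sup>2) \<partial>M)"
    by (rule nn_integral_suminf) measurable
  also have "\<dots> = (\<Sum>n. ennreal (4^n * (L2_nrm M (?d n))\<^sup>2))"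
    using L2_nn_integral_sq[OF d] by (simp add: ennreal_mult nn_integral_cmult)
  also have "\<dots> \<le> (\<Sum>n. ennreal ((1/4)^n))"
  proof (intro suminf_le summableI ennreal_leI)
    fix n
    have "4^n * (L2_nrm M (?d n))\<^sup>2 \<le> 4^n * ((1/4)^n)\<^sup>2"
      by (intro mult_left_mono power_mono fast) auto
    also have "\<dots> = (1/4)^n"
      by (simp add: power2_eq_square field_simps)
    finally show "4^n * (L2_nrm M (?d n))\<^sup>2 \<le> (1/4)^n" .
  qed
  also have "\<dots> < \<infinity>"
    by (subst suminf_ennreal2) (auto intro: summable_geometric)
  finally have fin: "(\<integral>\<^sup>+x. (?S x) \<partial>M) \<noteq> \<infinity>" by simp
  have "AE x in M. (?S x) \<noteq> \<infinity>"
    by (rule nn_integral_PInf_AE[OF _ fin]) measurable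
  then show ?thesis
  proof eventually_elim
    fix x assume x: "(?S x) \<noteq> \<infinity>"
    define S where "S = (?S x)"
    have "S \<noteq> top" using x by (simp add: S_def)
    then obtain C where C: "C \<ge> 0" "S = ennreal C"
      by (cases S) auto
    have four: "(4::real)^n = 2^n * 2^n" for n
      by (simp flip: power_mult_distrib)
    have b: "cmod (?d n x) \<le> sqrt C * (1/2)^n" for n
    proof -
      have "(\<Sum>k\<in>{n}. ennreal (4^k * (cmod (?d k x))\<^sup>2)) \<le> S"
        unfolding S_def by (rule sum_le_suminf) auto
      then have "ennreal (4^n * (cmod (?d n x))\<^sup>2) \<le> ennreal C"
        unfolding C(2) by (simp only: sum.insert sum.empty finite.emptyI empty_iff not_False_eq_True add_0_right)
      then have "4^n * (cmod (?d n x))\<^sup>2 \<le> C" using C by simp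
      then have "(2^n * cmod (?d n x))\<^sup>2 \<le> C"
        by (simp add: power_mult_distrib power2_eq_square mult_ac four)
      then have "2^n * cmod (?d n x) \<le> sqrt C" by (rule real_le_rsqrt)
      then show ?thesis by (simp add: field_simps)
    qed
    have "summable (\<lambda>n. ?d n x)"
      by (rule summable_comparison_test'[where g="\<lambda>n. sqrt C * (1/2)^n" and N=0])
         (use b in \<open>auto intro!: summable_mult summable_geometric\<close>)
    then have "convergent (\<lambda>n. (\<Sum>k<n. ?d k x) + f 0 x)"
      by (intro convergent_add convergent_const) (simp add: summable_iff_convergent)
    then show "convergent (\<lambda>n. f n x)"
      by (simp add: sum_lessThan_telescope[of "\<lambda>n. f n x"])
  qed
qed


text \<open>
  A subsequence with geometrically decaying differences converges pointwise almost everywhere.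
  Fatou's lemma then transfers the Cauchy estimate to the limit.
\<close>

lemma L2_complete:
  assumes f: "\<And>n::nat. f n \<in> L2 M"
    and cauchy: "\<And>e. e > 0 \<Longrightarrow> \<exists>N. \<forall>m\<ge>N. \<forall>n\<ge>N. L2_nrm M (\<lambda>x. f m x - f n x) \<le> e"
  obtains g where "g \<in> L2 M" and "(\<lambda>n. L2_nrm M (\<lambda>x. g x - f n x)) \<longlonglongrightarrow> 0"
proof -
  have fm [measurable]: "f n \<in> borel_measurable M" for n using f by (simp add: L2_measurable)
  have "\<forall>k::nat. \<exists>N. \<forall>m\<ge>N. \<forall>n\<ge>N. L2_nrm M (\<lambda>x. f m x - f n x) \<le> (1/4)^k"
    by (intro allI cauchy) simp
  then obtain N where N: "\<And>k m n. m \<ge> N k \<Longrightarrow> n \<ge> N k \<Longrightarrow> L2_nrm M (\<lambda>x. f m x - f n x) \<le> (1/4)^k"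
    by metis
  \<comment> \<open>A monotone choice of indices beyond \<open>N k\<close>; the summand \<open>k\<close> makes it tend to infinity.\<close>
  define r where "r k = k + (\<Sum>i\<le>k. N i)" for k
  have rN: "N k \<le> r k" and rS: "r k \<le> r (Suc k)" and rk: "k \<le> r k" for k
    using member_le_sum[of k "{..k}" N] by (auto simp: r_def)
  have conv: "AE x in M. convergent (\<lambda>k. f (r k) x)"
    by (rule L2_AE_convergent_of_fast) (use f N rN rS order_trans in blast)+
  define g where "g x = lim (\<lambda>k. f (r k) x)" for x
  let ?I = "\<lambda>n. \<integral>\<^sup>+x. ennreal ((cmod (g x - f n x))\<^sup>2) \<partial>M"
  have [measurable]: "g \<in> borel_measurable M"
    unfolding g_def by measurable
  have lim: "AE x in M. (\<lambda>k. f (r k) x) \<longlonglongrightarrow> g x"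
    using conv by eventually_elim (simp add: g_def convergent_LIMSEQ_iff)
  have est: "\<exists>N0. \<forall>n\<ge>N0. ?I n \<le> ennreal (e\<^sup>2)" if "e > 0" for e
  proof -
    obtain N0 where N0: "\<And>m n. m \<ge> N0 \<Longrightarrow> n \<ge> N0 \<Longrightarrow> L2_nrm M (\<lambda>x. f m x - f n x) \<le> e"
      using cauchy[OF \<open>e > 0\<close>] by blast
    have "?I n \<le> ennreal (e\<^sup>2)" if n: "n \<ge> N0" for n
    proof -
      have "?I n = (\<integral>\<^sup>+x. liminf (\<lambda>k. ennreal ((cmod (f (r k) x - f n x))\<^sup>2)) \<partial>M)"
      proof (rule nn_integral_cong_AE, use lim in eventually_elim)
        fix x assume "(\<lambda>k. f (r k) x) \<longlonglongrightarrow> g x"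
        then have "(\<lambda>k. ennreal ((cmod (f (r k) x - f n x))\<^sup>2)) \<longlonglongrightarrow> ennreal ((cmod (g x - f n x))\<^sup>2)"
          by (intro tendsto_ennrealI tendsto_intros)
        then show "ennreal ((cmod (g x - f n x))\<^sup>2) = liminf (\<lambda>k. ennreal ((cmod (f (r k) x - f n x))\<^sup>2))"
          by (metis lim_imp_Liminf trivial_limit_sequentially)
      qed
      also have "\<dots> \<le> liminf (\<lambda>k. \<integral>\<^sup>+x. ennreal ((cmod (f (r k) x - f n x))\<^sup>2) \<partial>M)"
        by (rule nn_integral_liminf) measurable
      also have "\<dots> \<le> liminf (\<lambda>k::nat. ennreal (e\<^sup>2))"
      proof (rule Liminf_mono, rule eventually_sequentiallyI)
        fix k assume "N0 \<le> k"
        then have "L2_nrm M (\<lambda>x. f (r k) x - f n x) \<le> e"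
          using rk[of k] by (intro N0 n) simp
        then show "(\<integral>\<^sup>+x. ennreal ((cmod (f (r k) x - f n x))\<^sup>2) \<partial>M) \<le> ennreal (e\<^sup>2)"
          by (subst L2_nn_integral_sq) (auto intro!: L2_diff f ennreal_leI power_mono)
      qed
      also have "\<dots> = ennreal (e\<^sup>2)" by (simp add: Liminf_const)
      finally show ?thesis .
    qed
    then show ?thesis by blast
  qed
  have dL2: "(\<lambda>x. g x - f n x) \<in> L2 M"
    if "?I n \<le> ennreal (e\<^sup>2)" for e n
    unfolding L2_iff_nn_integral using that by (auto intro: le_less_trans)
  obtain n where "?I n \<le> ennreal (1\<^sup>2)"
    using est[of 1] by force
  from L2_add[OF dL2[OF this] f[of n]] have g: "g \<in> L2 M" by simp
  moreover have "(\<lambda>n. L2_nrm M (\<lambda>x. g x - f n x)) \<longlonglongrightarrow> 0"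
  proof (rule LIMSEQ_I)
    fix e :: real assume "e > 0"
    then obtain N0 where N0: "\<And>n. n \<ge> N0 \<Longrightarrow> ?I n \<le> ennreal ((e/2)\<^sup>2)"
      using est[of "e/2"] by auto
    have "L2_nrm M (\<lambda>x. g x - f n x) \<le> e/2" if "n \<ge> N0" for n
    proof (rule power2_le_imp_le)
      show "(L2_nrm M (\<lambda>x. g x - f n x))\<^sup>2 \<le> (e/2)\<^sup>2"
        using N0[OF that] \<open>e > 0\<close> by (simp add: L2_nn_integral_sq[OF L2_diff[OF g f]] del: power_divide)
    qed (use \<open>e > 0\<close> in simp)
    then show "\<exists>no. \<forall>n\<ge>no. norm (L2_nrm M (\<lambda>x. g x - f n x) - 0) < e"
      using \<open>e > 0\<close> by (intro exI[of _ N0]) force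
  qed
  ultimately show ?thesis by (rule that)
qed

text \<open>
  The sets over which \<open>h\<close> has integral \<open>0\<close> form a Dynkin system that contains the intervals, and
  intervals are stable under intersection. Hence the positivity and negativity sets of the real and
  imaginary parts are among them.
\<close>

lemma AE_zero_if_interval_integrals_zero:
  fixes h :: "real \<Rightarrow> complex"
  assumes h: "integrable lborel h"
    and zero: "\<And>a b. (\<integral>x. indicator {a..b} x * h x \<partial>lborel) = 0"
  shows "AE x in lborel. h x = 0"
proof -
  have [measurable]: "h \<in> borel_measurable borel" using h by auto
  have ind: "integrable lborel (\<lambda>x. indicator A x * h x)" if [measurable]: "A \<in> sets borel" for A
    using h by (rule Bochner_Integration.integrable_bound) (auto split: split_indicator)
  have "(\<lambda>n. \<integral>x. indicator {- real n..real n} x * h x \<partial>lborel) \<longlonglongrightarrow> (\<integral>x. h x \<partial>lborel)"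
  proof (rule integral_dominated_convergence)
    show "integrable lborel (\<lambda>x. cmod (h x))" using h by simp
    show "AE x in lborel. (\<lambda>n. indicator {- real n..real n} x * h x) \<longlonglongrightarrow> h x"
    proof (intro AE_I2 tendsto_eventually)
      fix x :: real
      obtain n0 where "\<bar>x\<bar> \<le> real n0" using real_arch_simple by blast
      then show "\<forall>\<^sub>F n in sequentially. indicator {- real n..real n} x * h x = h x"
        by (intro eventually_sequentiallyI[of n0]) (auto simp: indicator_def)
    qed
  qed (auto split: split_indicator)
  then have total: "(\<integral>x. h x \<partial>lborel) = 0"
    using zero by (simp add: LIMSEQ_const_iff)
  have all: "(\<integral>x. indicator A x * h x \<partial>lborel) = 0" if "A \<in> sets borel" for A
    using that
  proof (induction A rule: borel_set_induct)
    case (compl A)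
    have "(\<integral>x. indicator (- A) x * h x \<partial>lborel) = (\<integral>x. h x - indicator A x * h x \<partial>lborel)"
      by (intro Bochner_Integration.integral_cong) (auto split: split_indicator)
    also have "\<dots> = 0"
      using h ind[OF compl.hyps] total compl.IH by simp
    finally show ?case .
  next
    case (union B)
    have sc: "indicator A x *\<^sub>R h x = indicator A x * h x" for A x
      by (auto split: split_indicator)
    have "(\<integral>x. indicator (\<Union>i. B i) x *\<^sub>R h x \<partial>lborel) = (\<Sum>i. \<integral>x. indicator (B i) x *\<^sub>R h x \<partial>lborel)"
      using union(1,2) ind[of "\<Union>i. B i"]
      by (intro lebesgue_integral_countable_add[unfolded set_lebesgue_integral_def])
        (auto simp: set_integrable_def disjoint_family_on_def sc)
    also have "\<dots> = 0" using union(3) by (simp add: sc)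
    finally show ?case by (simp add: sc)
  qed (auto simp: zero)
  have real: "AE x in lborel. g x = 0"
    if g: "integrable lborel g" and g0: "\<And>A. A \<in> sets borel \<Longrightarrow> (\<integral>x. indicator A x * g x \<partial>lborel) = 0"
    for g :: "real \<Rightarrow> real"
  proof -
    have [measurable]: "g \<in> borel_measurable borel" using g by auto
    have half: "AE x in lborel. g' x \<le> 0"
      if [measurable]: "g' \<in> borel_measurable borel" and g': "integrable lborel g'"
        "(\<integral>x. indicator {x. g' x > 0} x * g' x \<partial>lborel) = 0"
      for g' :: "real \<Rightarrow> real"
    proof -
      have "integrable lborel (\<lambda>x. indicator {x. g' x > 0} x * g' x)"
        using g'(1) by (rule Bochner_Integration.integrable_bound) (auto split: split_indicator)
      then have "AE x in lborel. indicator {x. g' x > 0} x * g' x = 0"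
        using g'(2) by (subst (asm) integral_nonneg_eq_0_iff_AE) (auto split: split_indicator)
      then show ?thesis by eventually_elim (auto split: split_indicator_asm)
    qed
    have "AE x in lborel. g x \<le> 0"
      by (intro half g g0) measurable
    moreover have "AE x in lborel. - g x \<le> 0"
      using g0[of "{x. - g x > 0}"] g by (intro half) (simp_all add: pred_def)
    ultimately show ?thesis by eventually_elim simp
  qed
  have "(\<integral>x. indicator A x * Re (h x) \<partial>lborel) = 0 \<and> (\<integral>x. indicator A x * Im (h x) \<partial>lborel) = 0"
    if A: "A \<in> sets borel" for A
  proof -
    have "(\<integral>x. Re (indicator A x * h x) \<partial>lborel) = 0" "(\<integral>x. Im (indicator A x * h x) \<partial>lborel) = 0"
      unfolding integral_Re[OF ind[OF A]] integral_Im[OF ind[OF A]] all[OF A] by simp_all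
    moreover have "Re (indicator A x * h x) = indicator A x * Re (h x)"
       "Im (indicator A x * h x) = indicator A x * Im (h x)" for x
      by (auto split: split_indicator)
    ultimately show ?thesis by simp
  qed
  then have "AE x in lborel. Re (h x) = 0" "AE x in lborel. Im (h x) = 0"
    using h by (auto intro!: real)
  then show ?thesis by eventually_elim (simp add: complex_eq_iff)
qed

section \<open>The Fourier integral\<close>

definition fourier_integral :: "(real \<Rightarrow> complex) \<Rightarrow> real \<Rightarrow> complex" where
  "fourier_integral f \<xi> =
     complex_of_real (1 / sqrt (2 * pi)) * (\<integral>x. cis (- (x * \<xi>)) * f x \<partial>lborel)"

lemma borel_measurable_cis [measurable (raw)]:
  "f \<in> borel_measurable M \<Longrightarrow> (\<lambda>x. cis (f x)) \<in> borel_measurable M"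
  by (rule borel_measurable_continuous_on[where f = cis]) (intro continuous_intros)

lemma integrable_exp_mult:
  assumes "integrable lborel f"
  shows "integrable lborel (\<lambda>x. cis (- (x * \<xi>)) * f x)"
proof (rule Bochner_Integration.integrable_bound[OF assms])
  have [measurable]: "f \<in> borel_measurable borel" using assms by auto
  show "(\<lambda>x. cis (- (x * \<xi>)) * f x) \<in> borel_measurable lborel" by measurable
qed (simp add: norm_mult)

lemma fourier_integral_measurable [measurable (raw)]:
  assumes [measurable]: "f \<in> borel_measurable borel"
  shows "fourier_integral f \<in> borel_measurable borel"
  unfolding fourier_integral_def[abs_def] by measurable

lemma fourier_integral_bound:
  assumes "integrable lborel f"
  shows "cmod (fourier_integral f \<xi>) \<le> (\<integral>x. cmod (f x) \<partial>lborel)"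
proof -
  have "cmod (\<integral>x. cis (- (x * \<xi>)) * f x \<partial>lborel) \<le> (\<integral>x. cmod (f x) \<partial>lborel)"
    by (rule order_trans[OF integral_norm_bound]) (simp add: norm_mult)
  moreover have "1 / sqrt (2 * pi) \<le> 1"
    using pi_gt3 by simp
  ultimately have "1 / sqrt (2 * pi) * cmod (\<integral>x. cis (- (x * \<xi>)) * f x \<partial>lborel) \<le> 1 * (\<integral>x. cmod (f x) \<partial>lborel)"
    by (intro mult_mono) auto
  then show ?thesis
    by (simp add: fourier_integral_def norm_mult norm_divide)
qed

lemma fourier_integral_lincomb:
  assumes "integrable lborel f" "integrable lborel g"
  shows "fourier_integral (\<lambda>x. a * f x + b * g x) \<xi> = a * fourier_integral f \<xi> + b * fourier_integral g \<xi>"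
proof -
  have "(\<integral>x. cis (- (x * \<xi>)) * (a * f x + b * g x) \<partial>lborel) =
     (\<integral>x. a * (cis (- (x * \<xi>)) * f x) + b * (cis (- (x * \<xi>)) * g x) \<partial>lborel)"
    by (simp add: algebra_simps)
  also have "\<dots> = a * (\<integral>x. cis (- (x * \<xi>)) * f x \<partial>lborel) + b * (\<integral>x. cis (- (x * \<xi>)) * g x \<partial>lborel)"
    using integrable_exp_mult[OF assms(1)] integrable_exp_mult[OF assms(2)] by simp
  finally show ?thesis by (simp add: fourier_integral_def algebra_simps)
qed

lemma fourier_integral_cong_AE:
  assumes "f \<in> borel_measurable borel" "g \<in> borel_measurable borel" "AE x in lborel. f x = g x"
  shows "fourier_integral f = fourier_integral g"
proof
  fix \<xi>
  have [measurable]: "f \<in> borel_measurable borel" "g \<in> borel_measurable borel" by fact+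
  have "(\<integral>x. cis (- (x * \<xi>)) * f x \<partial>lborel) = (\<integral>x. cis (- (x * \<xi>)) * g x \<partial>lborel)"
    using assms(3) by (intro integral_cong_AE) auto
  then show "fourier_integral f \<xi> = fourier_integral g \<xi>" by (simp only: fourier_integral_def)
qed

lemma fourier_integral_cnj:
  "fourier_integral (\<lambda>x. cnj (f x)) \<xi> = cnj (fourier_integral f (- \<xi>))"
proof -
  have "(\<integral>x. cis (- (x * \<xi>)) * cnj (f x) \<partial>lborel) =
      (\<integral>x. cnj (cis (- (x * - \<xi>)) * f x) \<partial>lborel)"
    by (intro Bochner_Integration.integral_cong) (simp_all add: cis_cnj)
  also have "\<dots> = cnj (\<integral>x. cis (- (x * - \<xi>)) * f x \<partial>lborel)"
    by (rule Bochner_Integration.integral_cnj)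
  finally show ?thesis
    by (simp only: fourier_integral_def complex_cnj_mult complex_cnj_complex_of_real)
qed

lemma integrable_pair_times_bounded:
  fixes f g :: "real \<Rightarrow> complex"
  assumes f: "integrable lborel f" and g: "integrable lborel g"
    and k [measurable]: "case_prod k \<in> borel_measurable (lborel \<Otimes>\<^sub>M lborel)"
    and b: "\<And>x y. cmod (k x y) \<le> 1"
  shows "integrable (lborel \<Otimes>\<^sub>M lborel) (\<lambda>(x, y). k x y * (f x * g y))"
proof -
  have [measurable]: "f \<in> borel_measurable borel" "g \<in> borel_measurable borel" using f g by auto
  have "integrable (lborel \<Otimes>\<^sub>M lborel) (\<lambda>(x, y). f x * g y)"
  proof (rule lborel_pair.Fubini_integrable)
    show "integrable lborel (\<lambda>x. \<integral>y. norm (case (x, y) of (x, y) \<Rightarrow> f x * g y) \<partial>lborel)"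
      using f by (simp add: norm_mult)
  qed (use g in auto)
  then show ?thesis
  proof (rule Bochner_Integration.integrable_bound)
    show "AE z in lborel \<Otimes>\<^sub>M lborel. norm (case z of (x, y) \<Rightarrow> k x y * (f x * g y)) \<le> norm (case z of (x, y) \<Rightarrow> f x * g y)"
      using mult_right_mono[OF b, of "cmod (f _ * g _)"] by (auto simp: norm_mult)
  qed measurable
qed

text \<open>
  Fubini's theorem for \<open>f x * h \<xi> * cis (- (x * \<xi>))\<close>. This one formula gives the adjoint, the
  weighted Parseval identity and the convolution form of band limiting.
\<close>

lemma fourier_integral_multiplication:
  assumes f: "integrable lborel f" and h: "integrable lborel h"
  shows "(\<integral>\<xi>. fourier_integral f \<xi> * h \<xi> \<partial>lborel) = (\<integral>x. f x * fourier_integral h x \<partial>lborel)"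
proof -
  have [measurable]: "f \<in> borel_measurable borel" "h \<in> borel_measurable borel" using f h by auto
  let ?c = "complex_of_real (1 / sqrt (2 * pi))"
  let ?e = "\<lambda>x \<xi>. cis (- (x * \<xi>))"
  have int: "integrable (lborel \<Otimes>\<^sub>M lborel) (\<lambda>(x, \<xi>). ?e x \<xi> * (f x * h \<xi>))"
    by (rule integrable_pair_times_bounded[OF f h]) simp_all
  have "(\<integral>\<xi>. fourier_integral f \<xi> * h \<xi> \<partial>lborel) = (\<integral>\<xi>. ?c * (\<integral>x. ?e x \<xi> * (f x * h \<xi>) \<partial>lborel) \<partial>lborel)"
    by (intro Bochner_Integration.integral_cong)
       (simp_all add: fourier_integral_def mult.assoc[symmetric])
  also have "\<dots> = ?c * (\<integral>\<xi>. (\<integral>x. ?e x \<xi> * (f x * h \<xi>) \<partial>lborel) \<partial>lborel)" by (rule integral_mult_right_zero)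
  also have "\<dots> = ?c * (\<integral>x. (\<integral>\<xi>. ?e x \<xi> * (f x * h \<xi>) \<partial>lborel) \<partial>lborel)"
    by (simp only: lborel_pair.Fubini_integral[OF int])
  also have "\<dots> = (\<integral>x. ?c * (\<integral>\<xi>. ?e x \<xi> * (f x * h \<xi>) \<partial>lborel) \<partial>lborel)"
    by (rule integral_mult_right_zero[symmetric])
  also have "\<dots> = (\<integral>x. f x * fourier_integral h x \<partial>lborel)"
  proof (intro Bochner_Integration.integral_cong refl)
    fix x
    have "(\<integral>\<xi>. ?e x \<xi> * (f x * h \<xi>) \<partial>lborel) = (\<integral>\<xi>. f x * (?e \<xi> x * h \<xi>) \<partial>lborel)"
      by (simp only: mult.commute[of x] mult.left_commute[of _ "f x"])
    also have "\<dots> = f x * (\<integral>\<xi>. ?e \<xi> x * h \<xi> \<partial>lborel)" by (rule integral_mult_right_zero)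
    finally show "?c * (\<integral>\<xi>. ?e x \<xi> * (f x * h \<xi>) \<partial>lborel) = f x * fourier_integral h x"
      unfolding fourier_integral_def by (simp only: mult.left_commute)
  qed
  finally show ?thesis .
qed

definition gauss_weight :: "real \<Rightarrow> real \<Rightarrow> real" where
  "gauss_weight \<delta> \<xi> = exp (- (\<delta> * \<xi>)\<^sup>2 / 2)"

lemma gauss_weight_measurable [measurable]: "gauss_weight \<delta> \<in> borel_measurable borel"
  unfolding gauss_weight_def[abs_def] by measurable

lemma gauss_weight_eq: "gauss_weight \<delta> \<xi> = sqrt (2 * pi) * std_normal_density (\<delta> * \<xi>)"
  by (simp add: gauss_weight_def std_normal_density_def)

lemma integrable_gauss_weight: "\<delta> > 0 \<Longrightarrow> integrable lborel (gauss_weight \<delta>)"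
  unfolding gauss_weight_eq[abs_def]
  using lborel_integrable_real_affine[of std_normal_density \<delta> 0] by simp

lemma fourier_gauss_weight:
  assumes \<delta>: "\<delta> > 0"
  shows "fourier_integral (\<lambda>\<xi>. cis (x * \<xi>) * complex_of_real (gauss_weight \<delta> \<xi>)) y
     = complex_of_real (sqrt (2 * pi) * normal_density 0 \<delta> (x - y))"
proof -
  let ?G = "\<lambda>\<xi>. cis (x * \<xi>) * complex_of_real (gauss_weight \<delta> \<xi>)"
  define s where "s = x - y"
  have "complex_of_real (exp (- ((s / \<delta>)^2) / 2)) = char std_normal_distribution (s / \<delta>)"
    by (simp add: char_std_normal_distribution)
  also have "\<dots> = (\<integral>u. std_normal_density u *\<^sub>R iexp (s / \<delta> * u) \<partial>lborel)"
    unfolding char_def by (subst integral_density) (auto simp: normal_density_nonneg)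
  also have "\<dots> = \<bar>\<delta>\<bar> *\<^sub>R (\<integral>\<xi>. std_normal_density (0 + \<delta> * \<xi>) *\<^sub>R iexp (s / \<delta> * (0 + \<delta> * \<xi>)) \<partial>lborel)"
    using \<delta> by (intro lborel_integral_real_affine) simp
  also have "(\<integral>\<xi>. std_normal_density (0 + \<delta> * \<xi>) *\<^sub>R iexp (s / \<delta> * (0 + \<delta> * \<xi>)) \<partial>lborel) =
      (\<integral>\<xi>. complex_of_real (1 / sqrt (2 * pi)) * (cis (- (\<xi> * y)) * ?G \<xi>) \<partial>lborel)"
  proof (intro Bochner_Integration.integral_cong refl)
    fix \<xi>
    have "s / \<delta> * (0 + \<delta> * \<xi>) = - (\<xi> * y) + x * \<xi>"
      using \<delta> by (simp add: s_def field_simps)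
    then have "iexp (s / \<delta> * (0 + \<delta> * \<xi>)) = cis (- (\<xi> * y)) * cis (x * \<xi>)"
      by (simp only: cis_conv_exp[symmetric] cis_mult)
    then show "std_normal_density (0 + \<delta> * \<xi>) *\<^sub>R iexp (s / \<delta> * (0 + \<delta> * \<xi>)) =
       complex_of_real (1 / sqrt (2 * pi)) * (cis (- (\<xi> * y)) * ?G \<xi>)"
      by (simp add: gauss_weight_eq scaleR_conv_of_real)
  qed
  also have "\<dots> = fourier_integral ?G y"
    unfolding fourier_integral_def by (rule integral_mult_right_zero)
  finally have "complex_of_real (exp (- ((s / \<delta>)^2) / 2)) = complex_of_real \<delta> * fourier_integral ?G y"
    using \<delta> by (simp add: scaleR_conv_of_real)
  then have "fourier_integral ?G y = complex_of_real (exp (- ((s / \<delta>)^2) / 2) / \<delta>)"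
    using \<delta> by (simp add: field_simps)
  also have "exp (- ((s / \<delta>)^2) / 2) / \<delta> = sqrt (2 * pi) * normal_density 0 \<delta> (x - y)"
    using \<delta> by (simp add: normal_density_def s_def real_sqrt_mult field_simps)
  finally show ?thesis .
qed

text \<open>
  The multiplication formula is used twice: first it moves the transform from \<open>f\<close> to the other factor
  \<open>h\<close>, then, inside the transform of \<open>h\<close>, from \<open>g\<close> to the weight, whose transform is a Gaussian.
\<close>

lemma fourier_integral_weighted_Parseval:
  assumes \<delta>: "\<delta> > 0" and f: "integrable lborel f" and g: "integrable lborel g"
  shows "(\<integral>\<xi>. fourier_integral f \<xi> * (cnj (fourier_integral g \<xi>) * complex_of_real (gauss_weight \<delta> \<xi>)) \<partial>lborel)
     = (\<integral>x. f x * cnj (\<integral>y. g y * complex_of_real (normal_density 0 \<delta> (x - y)) \<partial>lborel) \<partial>lborel)"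
proof -
  let ?s = "\<lambda>x. \<integral>y. g y * complex_of_real (normal_density 0 \<delta> (x - y)) \<partial>lborel"
  let ?I = "\<integral>x. cmod (g x) \<partial>lborel"
  have [measurable]: "f \<in> borel_measurable borel" "g \<in> borel_measurable borel" using f g by auto
  let ?h = "\<lambda>\<xi>. cnj (fourier_integral g \<xi>) * complex_of_real (gauss_weight \<delta> \<xi>)"
  let ?w = "\<lambda>x \<xi>. cis (x * \<xi>) * complex_of_real (gauss_weight \<delta> \<xi>)"
  have h: "integrable lborel ?h"
  proof (rule Bochner_Integration.integrable_bound)
    show "integrable lborel (\<lambda>\<xi>. ?I * gauss_weight \<delta> \<xi>)"
      using integrable_gauss_weight[OF \<delta>] by simp
    show "AE \<xi> in lborel. norm (?h \<xi>) \<le> norm (?I * gauss_weight \<delta> \<xi>)"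
      by (intro AE_I2) (auto simp: norm_mult abs_mult intro!: mult_right_mono order_trans[OF fourier_integral_bound[OF g]])
  qed measurable
  have w: "integrable lborel (?w x)" for x
  proof (rule Bochner_Integration.integrable_bound[OF integrable_gauss_weight[OF \<delta>]])
    show "?w x \<in> borel_measurable lborel" by measurable
    show "AE \<xi> in lborel. norm (?w x \<xi>) \<le> norm (gauss_weight \<delta> \<xi>)"
      by (simp add: norm_mult)
  qed
  have inner: "fourier_integral ?h x = cnj (?s x)" for x
  proof -
    let ?c = "complex_of_real (1 / sqrt (2 * pi))"
    have "fourier_integral ?h x = ?c * (\<integral>\<xi>. cnj (fourier_integral g \<xi> * ?w x \<xi>) \<partial>lborel)"
      unfolding fourier_integral_def[of ?h]
      by (intro arg_cong2[where f="(*)"] Bochner_Integration.integral_cong refl)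
         (simp add: cis_cnj mult_ac)
    also have "\<dots> = ?c * cnj (\<integral>\<xi>. fourier_integral g \<xi> * ?w x \<xi> \<partial>lborel)"
      by (simp only: Bochner_Integration.integral_cnj)
    also have "\<dots> = ?c * cnj (\<integral>y. g y * fourier_integral (?w x) y \<partial>lborel)"
      by (simp only: fourier_integral_multiplication[OF g w])
    also have "\<dots> = ?c * cnj (\<integral>y. complex_of_real (sqrt (2 * pi)) * (g y * complex_of_real (normal_density 0 \<delta> (x - y))) \<partial>lborel)"
      by (simp only: fourier_gauss_weight[OF \<delta>] of_real_mult mult.left_commute)
    also have "\<dots> = cnj (?s x)"
      by (simp del: of_real_mult real_sqrt_mult)
    finally show ?thesis .
  qed
  show ?thesis
    unfolding inner[symmetric] by (rule fourier_integral_multiplication[OF f h])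
qed


lemma nn_integral_normal_density_shift:
  assumes "\<delta> > 0"
  shows "(\<integral>\<^sup>+y. ennreal (normal_density 0 \<delta> (x - y)) \<partial>lborel) = 1"
proof -
  have "(\<integral>\<^sup>+y. ennreal (normal_density 0 \<delta> (x - y)) \<partial>lborel) = (\<integral>\<^sup>+y. ennreal (normal_density x \<delta> y) \<partial>lborel)"
    by (simp add: normal_density_def power2_commute)
  also have "\<dots> = 1"
    using assms by (simp add: nn_integral_eq_integral normal_density_nonneg)
  finally show ?thesis .
qed

text \<open>
  If the function is not integrable, the left-hand side is \<open>0\<close>.
\<close>

lemma norm_integral_le_nn_integral:
  fixes f :: "'a \<Rightarrow> 'b::{banach, second_countable_topology}"
  shows "ennreal (norm (\<integral>x. f x \<partial>M)) \<le> (\<integral>\<^sup>+x. ennreal (norm (f x)) \<partial>M)"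
  by (cases "integrable M f") (auto intro: integral_norm_bound_ennreal simp: not_integrable_integral_eq)

text \<open>
  In the weighted Parseval identity with \<open>g = f\<close> the right-hand side is at most the double integral
  of \<open>\<bar>f x\<bar> * \<bar>f y\<bar>\<close> against a Gaussian in \<open>x - y\<close>. Estimating the product by half the sum of the
  squares, each of the two terms is half of the squared norm because the Gaussian has mass \<open>1\<close>.
  The bound does not depend on \<open>\<delta>\<close>.
\<close>

lemma fourier_integral_weighted_bound:
  assumes \<delta>: "\<delta> > 0" and f: "integrable lborel f" and f2: "f \<in> L2 lborel"
  shows "(\<integral>\<^sup>+\<xi>. ennreal ((cmod (fourier_integral f \<xi>))\<^sup>2 * gauss_weight \<delta> \<xi>) \<partial>lborel) \<le> ennreal ((L2_nrm lborel f)\<^sup>2)"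
proof -
  have [measurable]: "f \<in> borel_measurable borel" using f by auto
  let ?n = "normal_density 0 \<delta>"
  let ?w = "\<lambda>\<xi>. (cmod (fourier_integral f \<xi>))\<^sup>2 * gauss_weight \<delta> \<xi>"
  let ?g = "\<lambda>x. \<integral>y. f y * complex_of_real (?n (x - y)) \<partial>lborel"
  let ?h = "\<lambda>x y. ennreal ((cmod (f x))\<^sup>2 / 2) * ennreal (?n (x - y))"
  let ?h' = "\<lambda>x y. ennreal ((cmod (f y))\<^sup>2 / 2) * ennreal (?n (x - y))"
  define W where "W = (\<integral>\<xi>. ?w \<xi> \<partial>lborel)"
  have int: "integrable lborel (\<lambda>\<xi>. ?w \<xi>)"
  proof (rule Bochner_Integration.integrable_bound)
    show "integrable lborel (\<lambda>\<xi>. (\<integral>x. cmod (f x) \<partial>lborel)\<^sup>2 * gauss_weight \<delta> \<xi>)"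
      using integrable_gauss_weight[OF \<delta>] by simp
    show "AE \<xi> in lborel. norm (?w \<xi>) \<le> norm ((\<integral>x. cmod (f x) \<partial>lborel)\<^sup>2 * gauss_weight \<delta> \<xi>)"
      by (intro AE_I2) (auto simp: abs_mult intro!: mult_right_mono power_mono fourier_integral_bound[OF f])
  qed measurable
  have "complex_of_real W = (\<integral>\<xi>. fourier_integral f \<xi> * (cnj (fourier_integral f \<xi>) * complex_of_real (gauss_weight \<delta> \<xi>)) \<partial>lborel)"
    unfolding W_def integral_complex_of_real[symmetric]
    by (intro Bochner_Integration.integral_cong refl) (simp add: complex_norm_square mult.assoc del: of_real_power)
  also have "\<dots> = (\<integral>x. f x * cnj (?g x) \<partial>lborel)"
    by (rule fourier_integral_weighted_Parseval[OF \<delta> f f])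
  finally have "ennreal W \<le> ennreal (cmod (\<integral>x. f x * cnj (?g x) \<partial>lborel))"
    by (intro ennreal_leI) (metis norm_of_real abs_ge_self)
  also have "\<dots> \<le> (\<integral>\<^sup>+x. ennreal (cmod (f x * cnj (?g x))) \<partial>lborel)"
    by (rule norm_integral_le_nn_integral)
  also have "\<dots> \<le> (\<integral>\<^sup>+x. \<integral>\<^sup>+y. ennreal (cmod (f x) * (cmod (f y) * ?n (x - y))) \<partial>lborel \<partial>lborel)"
  proof (rule nn_integral_mono)
    fix x
    have "ennreal (cmod (f x * cnj (?g x)))
        = ennreal (cmod (f x)) * ennreal (cmod (?g x))"
      by (simp add: norm_mult ennreal_mult)
    also have "\<dots> \<le> ennreal (cmod (f x)) * (\<integral>\<^sup>+y. ennreal (cmod (f y * complex_of_real (?n (x - y)))) \<partial>lborel)"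
      by (intro mult_left_mono norm_integral_le_nn_integral) simp
    also have "\<dots> = (\<integral>\<^sup>+y. ennreal (cmod (f x) * (cmod (f y) * ?n (x - y))) \<partial>lborel)"
      by (subst nn_integral_cmult[symmetric]) (auto simp: norm_mult ennreal_mult normal_density_nonneg)
    finally show "ennreal (cmod (f x * cnj (?g x))) \<le> \<dots>" .
  qed
  also have "\<dots> \<le> (\<integral>\<^sup>+x. \<integral>\<^sup>+y. ?h x y + ?h' x y \<partial>lborel \<partial>lborel)"
  proof (intro nn_integral_mono)
    fix x y
    have "cmod (f x) * cmod (f y) \<le> (cmod (f x))\<^sup>2 / 2 + (cmod (f y))\<^sup>2 / 2"
      using sum_squares_bound[of "cmod (f x)" "cmod (f y)"] by simp
    from mult_right_mono[OF this normal_density_nonneg[of 0 \<delta> "x - y"]]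
    have "cmod (f x) * (cmod (f y) * ?n (x - y)) \<le> (cmod (f x))\<^sup>2 / 2 * ?n (x - y) + (cmod (f y))\<^sup>2 / 2 * ?n (x - y)"
      by (simp add: algebra_simps)
    from ennreal_leI[OF this]
    show "ennreal (cmod (f x) * (cmod (f y) * ?n (x - y))) \<le> ?h x y + ?h' x y"
      by (simp add: normal_density_nonneg flip: ennreal_plus ennreal_mult)
  qed
  also have "\<dots> = (\<integral>\<^sup>+x. \<integral>\<^sup>+y. ?h x y \<partial>lborel \<partial>lborel)
       + (\<integral>\<^sup>+x. \<integral>\<^sup>+y. ?h' x y \<partial>lborel \<partial>lborel)"
    by (simp add: nn_integral_add)
  also have "(\<integral>\<^sup>+x. \<integral>\<^sup>+y. ?h' x y \<partial>lborel \<partial>lborel)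
       = (\<integral>\<^sup>+y. \<integral>\<^sup>+x. ?h' x y \<partial>lborel \<partial>lborel)"
    by (rule lborel_pair.Fubini') measurable
  also have "\<dots> = (\<integral>\<^sup>+y. \<integral>\<^sup>+x. ennreal ((cmod (f y))\<^sup>2 / 2) * ennreal (?n (y - x)) \<partial>lborel \<partial>lborel)"
    by (simp add: normal_density_def power2_commute)
  finally have "ennreal W \<le> (\<integral>\<^sup>+x. ennreal ((cmod (f x))\<^sup>2 / 2) \<partial>lborel) + (\<integral>\<^sup>+x. ennreal ((cmod (f x))\<^sup>2 / 2) \<partial>lborel)"
    by (simp add: nn_integral_cmult nn_integral_normal_density_shift[OF \<delta>])
  also have "\<dots> = (\<integral>\<^sup>+x. ennreal ((cmod (f x))\<^sup>2) \<partial>lborel)"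
    by (subst nn_integral_add[symmetric]) (auto simp flip: ennreal_plus)
  also have "\<dots> = ennreal ((L2_nrm lborel f)\<^sup>2)" by (rule L2_nn_integral_sq[OF f2])
  also have "ennreal W = (\<integral>\<^sup>+\<xi>. ennreal (?w \<xi>) \<partial>lborel)"
    unfolding W_def by (rule nn_integral_eq_integral[OF int, symmetric]) (simp add: gauss_weight_def)
  finally show ?thesis .
qed

lemma gauss_weight_tendsto: "(\<lambda>n. gauss_weight (1 / Suc n) \<xi>) \<longlonglongrightarrow> 1"
proof -
  have "(\<lambda>n. exp (- (1 / real (Suc n) * \<xi>)\<^sup>2 / 2)) \<longlonglongrightarrow> exp (- (0 * \<xi>)\<^sup>2 / 2)"
    by (intro tendsto_intros LIMSEQ_Suc[OF lim_1_over_n]) simp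
  then show ?thesis by (simp add: gauss_weight_def)
qed

text \<open>
  Fatou's lemma as the width of the weight tends to infinity.
\<close>

lemma fourier_integral_L2:
  assumes f: "integrable lborel f" and f2: "f \<in> L2 lborel"
  shows "fourier_integral f \<in> L2 lborel" "L2_nrm lborel (fourier_integral f) \<le> L2_nrm lborel f"
proof -
  have [measurable]: "f \<in> borel_measurable borel" using f by auto
  let ?w = "\<lambda>n \<xi>. ennreal ((cmod (fourier_integral f \<xi>))\<^sup>2 * gauss_weight (1 / Suc n) \<xi>)"
  have "(\<integral>\<^sup>+\<xi>. ennreal ((cmod (fourier_integral f \<xi>))\<^sup>2) \<partial>lborel) = (\<integral>\<^sup>+\<xi>. liminf (\<lambda>n. ?w n \<xi>) \<partial>lborel)"
  proof (rule nn_integral_cong)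
    fix \<xi>
    have "(\<lambda>n. ?w n \<xi>) \<longlonglongrightarrow> ennreal ((cmod (fourier_integral f \<xi>))\<^sup>2 * 1)"
      by (intro tendsto_ennrealI tendsto_intros gauss_weight_tendsto)
    then show "ennreal ((cmod (fourier_integral f \<xi>))\<^sup>2) = liminf (\<lambda>n. ?w n \<xi>)"
      by (simp add: lim_imp_Liminf)
  qed
  also have "\<dots> \<le> liminf (\<lambda>n. \<integral>\<^sup>+\<xi>. ?w n \<xi> \<partial>lborel)"
    by (rule nn_integral_liminf) measurable
  also have "\<dots> \<le> liminf (\<lambda>n::nat. ennreal ((L2_nrm lborel f)\<^sup>2))"
    by (intro Liminf_mono always_eventually allI fourier_integral_weighted_bound f f2) simp
  also have "\<dots> = ennreal ((L2_nrm lborel f)\<^sup>2)" by (simp add: Liminf_const)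
  finally have le: "(\<integral>\<^sup>+\<xi>. ennreal ((cmod (fourier_integral f \<xi>))\<^sup>2) \<partial>lborel) \<le> ennreal ((L2_nrm lborel f)\<^sup>2)" .
  then show F: "fourier_integral f \<in> L2 lborel"
    by (auto simp: L2_iff_nn_integral intro: le_less_trans)
  show "L2_nrm lborel (fourier_integral f) \<le> L2_nrm lborel f"
    using le by (simp add: L2_nn_integral_sq[OF F] power_mono_iff)
qed


text \<open>
  After the substitution \<open>y = x - u / (n + 1)\<close> the width of the Gaussian moves into the indicator, which
  converges at every point other than an end point of the interval.
\<close>

lemma gaussian_smoothing_interval:
  fixes a b x :: real
  shows "cmod (\<integral>y. indicator {a..b} y * complex_of_real (normal_density 0 (1 / Suc n) (x - y)) \<partial>lborel) \<le> 1"
    and "x \<noteq> a \<Longrightarrow> x \<noteq> b \<Longrightarrow>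
      (\<lambda>n. \<integral>y. indicator {a..b} y * complex_of_real (normal_density 0 (1 / Suc n) (x - y)) \<partial>lborel)
        \<longlonglongrightarrow> indicator {a..b} x"
proof -
  let ?s = "\<lambda>n. \<integral>y. indicator {a..b} y * complex_of_real (normal_density 0 (1 / Suc n) (x - y)) \<partial>lborel"
  let ?j = "\<lambda>n u. indicator {a..b} (x + - (1 / Suc n) * u) * complex_of_real (std_normal_density u)"
  let ?J = "\<lambda>n. \<integral>u. ?j n u \<partial>lborel"
  have eq: "(?s n) = ?J n" for n
  proof -
    have nd: "normal_density 0 (1 / Suc n) (1 / Suc n * u) = Suc n * std_normal_density u" for u
      by (simp add: normal_density_def real_sqrt_divide field_simps power_divide)
    have "(?s n)
      = \<bar>- (1 / Suc n)\<bar> *\<^sub>R (\<integral>u. indicator {a..b} (x + - (1 / Suc n) * u) * complex_of_real (normal_density 0 (1 / Suc n) (x - (x + - (1 / Suc n) * u))) \<partial>lborel)"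
      by (rule lborel_integral_real_affine) simp
    also have "\<dots> = (\<integral>u. \<bar>- (1 / Suc n)\<bar> *\<^sub>R (indicator {a..b} (x + - (1 / Suc n) * u) * complex_of_real (normal_density 0 (1 / Suc n) (x - (x + - (1 / Suc n) * u)))) \<partial>lborel)"
      by (rule integral_scaleR_right[symmetric])
    also have "\<dots> = ?J n"
    proof (intro Bochner_Integration.integral_cong refl)
      fix u
      have "x - (x + - (1 / Suc n) * u) = 1 / Suc n * u" by simp
      then show "\<bar>- (1 / Suc n)\<bar> *\<^sub>R (indicator {a..b} (x + - (1 / Suc n) * u) * complex_of_real (normal_density 0 (1 / Suc n) (x - (x + - (1 / Suc n) * u))))
        = ?j n u"
        by (simp only: nd) (simp add: scaleR_conv_of_real field_simps del: of_nat_Suc)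
    qed
    finally show ?thesis .
  qed
  have "cmod (?J n) \<le> (\<integral>u. std_normal_density u \<partial>lborel)"
    by (rule Bochner_Integration.integral_norm_bound_integral)
      (auto simp: norm_mult normal_density_nonneg split: split_indicator
        intro!: Bochner_Integration.integrable_bound[OF integrable_normal_density[of 1 0]])
  then show "cmod (?s n) \<le> 1"
    unfolding eq by simp
  assume x: "x \<noteq> a" "x \<noteq> b"
  have "?J \<longlonglongrightarrow> (\<integral>u. indicator {a..b} x * complex_of_real (std_normal_density u) \<partial>lborel)"
  proof (rule integral_dominated_convergence)
    show "integrable lborel std_normal_density" by simp
    show "AE u in lborel. cmod (?j n u) \<le> std_normal_density u" for n
      by (auto simp: norm_mult normal_density_nonneg split: split_indicator)
    show "AE u in lborel. (\<lambda>n. ?j n u)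
        \<longlonglongrightarrow> indicator {a..b} x * complex_of_real (std_normal_density u)"
    proof (intro AE_I2 tendsto_mult_right)
      fix u
      have lim: "(\<lambda>n. x + - (1 / Suc n) * u) \<longlonglongrightarrow> x + - 0 * u"
        by (intro tendsto_intros LIMSEQ_Suc[OF lim_1_over_n])
      have "\<forall>\<^sub>F n in sequentially. indicator {a..b} (x + - (1 / Suc n) * u) = (indicator {a..b} x :: complex)"
      proof (cases "a < x \<and> x < b")
        case True
        then have "\<forall>\<^sub>F n in sequentially. x + - (1 / Suc n) * u \<in> {a<..<b}"
          using topological_tendstoD[OF lim, of "{a<..<b}"] by simp
        then show ?thesis by eventually_elim (use True in auto)
      next
        case False
        then have "x \<in> - {a..b}" using x by auto
        then have "\<forall>\<^sub>F n in sequentially. x + - (1 / Suc n) * u \<in> - {a..b}"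
          using topological_tendstoD[OF lim, of "- {a..b}"] by (simp add: open_Compl)
        then show ?thesis by eventually_elim (use \<open>x \<in> - {a..b}\<close> in auto)
      qed
      then show "(\<lambda>n. indicator {a..b} (x + - (1 / Suc n) * u)) \<longlonglongrightarrow> (indicator {a..b} x :: complex)"
        by (rule tendsto_eventually)
    qed
  qed measurable
  also have "(\<integral>u. indicator {a..b} x * complex_of_real (std_normal_density u) \<partial>lborel) = indicator {a..b} x"
    by simp
  finally show "?s
        \<longlonglongrightarrow> indicator {a..b} x"
    unfolding eq .
qed

lemma indicator_interval_L2: "indicator {a..b::real} \<in> L2 lborel" "integrable lborel (indicator {a..b::real} :: real \<Rightarrow> complex)"
proof -
  have *: "integrable lborel (indicator {a..b::real} :: real \<Rightarrow> real)"
    by (simp add: integrable_indicator_iff emeasure_lborel_Icc_eq)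
  have "(cmod (indicator {a..b} x))\<^sup>2 = indicator {a..b} x" "cmod (indicator {a..b} x) = indicator {a..b} x" for x
    by (auto split: split_indicator)
  with * show "indicator {a..b::real} \<in> L2 lborel"
    by (simp add: L2_def del: L2_integrable_sq)
  have "indicator {a..b} = (\<lambda>x. complex_of_real (indicator {a..b} x))"
    by (auto split: split_indicator)
  with integrable_of_real[OF *, where 'a = complex]
  show "integrable lborel (indicator {a..b::real} :: real \<Rightarrow> complex)" by simp
qed

text \<open>
  Both sides of the weighted Parseval identity converge by dominated convergence. On the frequency side
  the dominating function is integrable because both transforms are square integrable.
\<close>

lemma fourier_integral_Parseval_interval:
  assumes f: "integrable lborel f" and f2: "f \<in> L2 lborel"
  shows "L2_inner lborel (fourier_integral f) (fourier_integral (indicator {a..b})) = L2_inner lborel f (indicator {a..b})"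
proof -
  have [measurable]: "f \<in> borel_measurable borel" using f by auto
  let ?g = "indicator {a..b} :: real \<Rightarrow> complex"
  let ?l = "\<lambda>n \<xi>. fourier_integral f \<xi> * (cnj (fourier_integral ?g \<xi>) * complex_of_real (gauss_weight (1 / Suc n) \<xi>))"
  let ?r = "\<lambda>\<xi>. fourier_integral f \<xi> * cnj (fourier_integral ?g \<xi>)"
  let ?L = "\<lambda>n. \<integral>\<xi>. ?l n \<xi> \<partial>lborel"
  let ?s = "\<lambda>n x. \<integral>y. ?g y * complex_of_real (normal_density 0 (1 / Suc n) (x - y)) \<partial>lborel"
  have int: "integrable lborel (\<lambda>\<xi>. ?r \<xi>)"
    by (intro L2_integrable_inner fourier_integral_L2 f f2 indicator_interval_L2)
  have "?L \<longlonglongrightarrow> L2_inner lborel (fourier_integral f) (fourier_integral ?g)"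
    unfolding L2_inner_def
  proof (rule integral_dominated_convergence)
    show "integrable lborel (\<lambda>\<xi>. cmod (?r \<xi>))"
      using int by (rule integrable_norm)
    show "AE \<xi> in lborel. (\<lambda>n. ?l n \<xi>)
        \<longlonglongrightarrow> ?r \<xi>"
    proof (intro AE_I2)
      fix \<xi>
      have "(\<lambda>n. ?l n \<xi>)
        \<longlonglongrightarrow> fourier_integral f \<xi> * (cnj (fourier_integral ?g \<xi>) * complex_of_real 1)"
        by (intro tendsto_intros gauss_weight_tendsto)
      then show "(\<lambda>n. ?l n \<xi>)
        \<longlonglongrightarrow> ?r \<xi>" by simp
    qed
    show "AE \<xi> in lborel. cmod (?l n \<xi>)
        \<le> cmod (?r \<xi>)" for n
    proof (intro AE_I2)
      fix \<xi>
      have "cmod (complex_of_real (gauss_weight (1 / Suc n) \<xi>)) \<le> 1"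
        by (simp add: gauss_weight_def)
      from mult_left_mono[OF this norm_ge_zero[of "?r \<xi>"]]
      show "cmod (?l n \<xi>)
        \<le> cmod (?r \<xi>)"
        by (simp add: norm_mult mult.assoc)
    qed
  qed measurable
  moreover have "?L \<longlonglongrightarrow> L2_inner lborel f ?g"
  proof -
    have "(\<lambda>n. \<integral>x. f x * cnj (?s n x) \<partial>lborel) \<longlonglongrightarrow> L2_inner lborel f ?g"
      unfolding L2_inner_def
    proof (rule integral_dominated_convergence)
      show "integrable lborel (\<lambda>x. cmod (f x))" using f by (rule integrable_norm)
      have "AE x in lborel. x \<noteq> a" "AE x in lborel. x \<noteq> b" by (rule AE_lborel_singleton)+
      then show "AE x in lborel. (\<lambda>n. f x * cnj (?s n x)) \<longlonglongrightarrow> f x * cnj (?g x)"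
        by eventually_elim (intro tendsto_mult tendsto_const tendsto_cnj gaussian_smoothing_interval)
      show "AE x in lborel. cmod (f x * cnj (?s n x)) \<le> cmod (f x)" for n
        using mult_left_mono[OF gaussian_smoothing_interval(1) norm_ge_zero]
        by (intro AE_I2) (simp only: norm_mult complex_mod_cnj mult_1_right)
    qed measurable
    then show ?thesis
      by (subst fourier_integral_weighted_Parseval) (simp_all add: f indicator_interval_L2)
  qed
  ultimately show ?thesis by (rule LIMSEQ_unique)
qed

section \<open>The Fourier transform on \<open>L\<^sup>2\<close>\<close>

lemma cutoff_measurable: "f \<in> borel_measurable borel \<Longrightarrow> cutoff t f \<in> borel_measurable borel"
  unfolding cutoff_def by measurable

lemma cutoff_L2: "f \<in> L2 lborel \<Longrightarrow> cutoff t f \<in> L2 lborel"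
  by (rule L2_bounded_by) (use L2_measurable[of f lborel] in \<open>auto simp: cutoff_measurable, auto simp: cutoff_def split: split_indicator\<close>)

lemma cutoff_integrable:
  assumes f: "f \<in> L2 lborel" shows "integrable lborel (cutoff t f)"
proof -
  have "integrable lborel (\<lambda>x. indicator {-t..t} x * cutoff t f x)"
    by (intro L2_integrable_mult cutoff_L2 f indicator_interval_L2)
  moreover have "indicator {-t..t} x * cutoff t f x = cutoff t f x" for x
    by (auto simp: cutoff_def split: split_indicator)
  ultimately show ?thesis by simp
qed

lemma L2_nrm_cutoff_le: "f \<in> L2 lborel \<Longrightarrow> L2_nrm lborel (cutoff t f) \<le> L2_nrm lborel f"
  by (rule L2_nrm_mono) (use L2_measurable[of f lborel] in \<open>auto simp: cutoff_measurable, auto simp: cutoff_def split: split_indicator\<close>)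

lemma cutoff_cutoff [simp]: "cutoff t (cutoff t f) = cutoff t f"
  by (auto simp: cutoff_def split: split_indicator)

lemma cutoff_lincomb: "cutoff t (\<lambda>x. a * f x + b * g x) x = a * cutoff t f x + b * cutoff t g x"
  by (auto simp: cutoff_def split: split_indicator)

text \<open>
  Dominated convergence; at a fixed point the difference vanishes for all large \<open>N\<close>.
\<close>

lemma cutoff_tendsto:
  assumes f: "f \<in> L2 lborel"
  shows "((\<lambda>N. L2_nrm lborel (\<lambda>x. f x - cutoff N f x)) \<longlongrightarrow> 0) at_top"
proof -
  have [measurable]: "f \<in> borel_measurable borel" using L2_measurable[OF f] by simp
  have "((\<lambda>N. \<integral>x. (cmod (f x - cutoff N f x))\<^sup>2 \<partial>lborel) \<longlongrightarrow> (\<integral>x. 0 \<partial>(lborel :: real measure))) at_top"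
  proof (rule integral_dominated_convergence_at_top)
    show "integrable lborel (\<lambda>x. (cmod (f x))\<^sup>2)" using f by simp
    show "\<forall>\<^sub>F N in at_top. AE x in lborel. norm ((cmod (f x - cutoff N f x))\<^sup>2) \<le> (cmod (f x))\<^sup>2"
      by (auto simp: cutoff_def split: split_indicator)
    show "AE x in lborel. ((\<lambda>N. (cmod (f x - cutoff N f x))\<^sup>2) \<longlongrightarrow> 0) at_top"
    proof (intro AE_I2 tendsto_eventually)
      fix x :: real
      show "\<forall>\<^sub>F N in at_top. (cmod (f x - cutoff N f x))\<^sup>2 = 0"
        using eventually_gt_at_top[of "\<bar>x\<bar>"] by eventually_elim (auto simp: cutoff_def indicator_def abs_less_iff)
    qed
  qed (auto simp: cutoff_def)
  from tendsto_real_sqrt[OF this] show ?thesis by (simp add: L2_nrm_def)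
qed

text \<open>
  The truncation uses a closed interval and the cutoff an open one; the integrals do not see the end
  points.
\<close>

lemma fourier_trunc_eq:
  assumes [measurable]: "f \<in> borel_measurable borel"
  shows "fourier_trunc N f = fourier_integral (cutoff N f)"
proof
  fix \<xi>
  have "(\<integral>x. indicator {-N..N} x *\<^sub>R (exp (- \<i> * complex_of_real (x * \<xi>)) * f x) \<partial>lborel)
      = (\<integral>x. cis (- (x * \<xi>)) * cutoff N f x \<partial>lborel)"
  proof (rule integral_cong_AE)
    have "AE x in lborel. x \<noteq> N" "AE x in lborel. x \<noteq> - N" by (rule AE_lborel_singleton)+
    then show "AE x in lborel. indicator {-N..N} x *\<^sub>R (exp (- \<i> * complex_of_real (x * \<xi>)) * f x) = cis (- (x * \<xi>)) * cutoff N f x"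
      by eventually_elim (auto simp: cutoff_def cis_conv_exp split: split_indicator)
  qed (use cutoff_measurable[of f N] in measurable)
  then show "fourier_trunc N f \<xi> = fourier_integral (cutoff N f) \<xi>"
    unfolding fourier_trunc_def fourier_integral_def set_lebesgue_integral_def by simp
qed

lemma fourier_trunc_L2:
  assumes f: "f \<in> L2 lborel"
  shows "fourier_trunc N f \<in> L2 lborel" "L2_nrm lborel (fourier_trunc N f) \<le> L2_nrm lborel f"
proof -
  have [measurable]: "f \<in> borel_measurable borel" using L2_measurable[OF f] by simp
  show "fourier_trunc N f \<in> L2 lborel"
    by (simp add: fourier_trunc_eq fourier_integral_L2 cutoff_integrable cutoff_L2 f)
  have "L2_nrm lborel (fourier_trunc N f) \<le> L2_nrm lborel (cutoff N f)"
    by (simp add: fourier_trunc_eq fourier_integral_L2 cutoff_integrable cutoff_L2 f)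
  also have "\<dots> \<le> L2_nrm lborel f" by (rule L2_nrm_cutoff_le[OF f])
  finally show "L2_nrm lborel (fourier_trunc N f) \<le> L2_nrm lborel f" .
qed

lemma fourier_trunc_lincomb:
  assumes f: "f \<in> L2 lborel" and g: "g \<in> L2 lborel"
  shows "fourier_trunc N (\<lambda>x. a * f x + b * g x) \<xi> = a * fourier_trunc N f \<xi> + b * fourier_trunc N g \<xi>"
proof -
  have [measurable]: "f \<in> borel_measurable borel" "g \<in> borel_measurable borel"
    using L2_measurable[OF f] L2_measurable[OF g] by simp_all
  have "cutoff N (\<lambda>x. a * f x + b * g x) = (\<lambda>x. a * cutoff N f x + b * cutoff N g x)"
    by (rule ext) (rule cutoff_lincomb)
  then show ?thesis
    by (simp add: fourier_trunc_eq fourier_integral_lincomb cutoff_integrable f g)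
qed

lemma fourier_trunc_diff_bound:
  assumes f: "f \<in> L2 lborel"
  shows "L2_nrm lborel (\<lambda>\<xi>. fourier_trunc M f \<xi> - fourier_trunc N f \<xi>) \<le>
    L2_nrm lborel (\<lambda>x. f x - cutoff M f x) + L2_nrm lborel (\<lambda>x. f x - cutoff N f x)"
proof -
  have [measurable]: "f \<in> borel_measurable borel" using L2_measurable[OF f] by simp
  let ?d = "\<lambda>x. 1 * cutoff M f x + (-1) * cutoff N f x"
  have d: "?d \<in> L2 lborel" by (intro L2_lincomb cutoff_L2 f)
  have di: "integrable lborel ?d" by (intro Bochner_Integration.integrable_add integrable_mult_right cutoff_integrable f)
  have "(\<lambda>\<xi>. fourier_trunc M f \<xi> - fourier_trunc N f \<xi>) = fourier_integral ?d"
  proof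
    fix \<xi> show "fourier_trunc M f \<xi> - fourier_trunc N f \<xi> = fourier_integral ?d \<xi>"
      by (subst fourier_integral_lincomb) (simp_all add: cutoff_integrable f fourier_trunc_eq)
  qed
  then have "L2_nrm lborel (\<lambda>\<xi>. fourier_trunc M f \<xi> - fourier_trunc N f \<xi>) \<le> L2_nrm lborel ?d"
    using fourier_integral_L2(2)[OF di d] by simp
  also have "?d = (\<lambda>x. (f x - cutoff N f x) - (f x - cutoff M f x))" by auto
  also have "L2_nrm lborel \<dots> \<le> L2_nrm lborel (\<lambda>x. f x - cutoff N f x) + L2_nrm lborel (\<lambda>x. f x - cutoff M f x)"
    by (intro L2_nrm_triangle_diff L2_diff cutoff_L2 f)
  finally show ?thesis by simp
qed

lemma L2_nrm_tendsto_0_iff_nn_integral: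
  assumes g: "\<And>n. g n \<in> L2 M"
  shows "((\<lambda>n. \<integral>\<^sup>+x. ennreal ((cmod (g n x))\<^sup>2) \<partial>M) \<longlongrightarrow> 0) F \<longleftrightarrow> ((\<lambda>n. L2_nrm M (g n)) \<longlongrightarrow> 0) F"
proof
  assume "((\<lambda>n. \<integral>\<^sup>+x. ennreal ((cmod (g n x))\<^sup>2) \<partial>M) \<longlongrightarrow> 0) F"
  then have "((\<lambda>n. ennreal ((L2_nrm M (g n))\<^sup>2)) \<longlongrightarrow> ennreal 0) F"
    by (simp add: L2_nn_integral_sq[OF g])
  then have "((\<lambda>n. (L2_nrm M (g n))\<^sup>2) \<longlongrightarrow> 0) F"
    by (subst (asm) tendsto_ennreal_iff) auto
  from tendsto_real_sqrt[OF this] show "((\<lambda>n. L2_nrm M (g n)) \<longlongrightarrow> 0) F" by simp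
next
  assume "((\<lambda>n. L2_nrm M (g n)) \<longlongrightarrow> 0) F"
  then have "((\<lambda>n. ennreal ((L2_nrm M (g n))\<^sup>2)) \<longlongrightarrow> ennreal (0\<^sup>2)) F"
    by (intro tendsto_ennrealI tendsto_power)
  then show "((\<lambda>n. \<integral>\<^sup>+x. ennreal ((cmod (g n x))\<^sup>2) \<partial>M) \<longlongrightarrow> 0) F"
    by (simp add: L2_nn_integral_sq[OF g])
qed

text \<open>
  Contractivity turns the convergence of the cutoffs into a Cauchy property of the truncated
  transforms along the integers. The same estimate then controls the transforms at real truncation
  levels, uniformly in the integer that is sent to infinity.
\<close>

lemma fourier_limit:
  assumes f: "f \<in> L2 lborel"
  shows fourier_L2: "fourier f \<in> L2 lborel"
    and fourier_tendsto: "((\<lambda>N. L2_nrm lborel (\<lambda>\<xi>. fourier f \<xi> - fourier_trunc N f \<xi>)) \<longlongrightarrow> 0) at_top"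
proof -
  let ?T = "\<lambda>N. fourier_trunc N f" and ?r = "\<lambda>N. L2_nrm lborel (\<lambda>x. f x - cutoff N f x)"
  note r = cutoff_tendsto[OF f]
  have rn: "(\<lambda>n. ?r (real n)) \<longlonglongrightarrow> 0"
    using r by (rule filterlim_compose[OF _ filterlim_real_sequentially])
  obtain g where g: "g \<in> L2 lborel" and gl: "(\<lambda>n. L2_nrm lborel (\<lambda>\<xi>. g \<xi> - ?T (real n) \<xi>)) \<longlonglongrightarrow> 0"
  proof (rule L2_complete[of "\<lambda>n. ?T (real n)" lborel])
    fix e :: real assume "e > 0"
    then have "\<forall>\<^sub>F n in sequentially. ?r (real n) < e / 2"
      using order_tendstoD(2)[OF rn, of "e / 2"] by simp
    then obtain N where N: "\<And>n. n \<ge> N \<Longrightarrow> ?r (real n) < e / 2"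
      by (auto simp: eventually_sequentially)
    have "L2_nrm lborel (\<lambda>x. ?T (real m) x - ?T (real n) x) \<le> e" if "m \<ge> N" "n \<ge> N" for m n
      using fourier_trunc_diff_bound[OF f, of "real m" "real n"] N[OF that(1)] N[OF that(2)] by simp
    then show "\<exists>N. \<forall>m\<ge>N. \<forall>n\<ge>N. L2_nrm lborel (\<lambda>x. ?T (real m) x - ?T (real n) x) \<le> e" by blast
  qed (use fourier_trunc_L2[OF f] in auto)
  have bound: "L2_nrm lborel (\<lambda>\<xi>. g \<xi> - ?T N \<xi>) \<le> ?r N" for N
  proof -
    have "(\<lambda>n. L2_nrm lborel (\<lambda>\<xi>. g \<xi> - ?T (real n) \<xi>) + (?r (real n) + ?r N)) \<longlonglongrightarrow> 0 + (0 + ?r N)"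
      by (intro tendsto_add gl rn tendsto_const)
    moreover have "L2_nrm lborel (\<lambda>\<xi>. g \<xi> - ?T N \<xi>) \<le> L2_nrm lborel (\<lambda>\<xi>. g \<xi> - ?T (real n) \<xi>) + (?r (real n) + ?r N)" for n
    proof -
      have "L2_nrm lborel (\<lambda>\<xi>. (g \<xi> - ?T (real n) \<xi>) + (?T (real n) \<xi> - ?T N \<xi>))
         \<le> L2_nrm lborel (\<lambda>\<xi>. g \<xi> - ?T (real n) \<xi>) + L2_nrm lborel (\<lambda>\<xi>. ?T (real n) \<xi> - ?T N \<xi>)"
        by (intro L2_nrm_triangle L2_diff g fourier_trunc_L2 f)
      then show ?thesis using fourier_trunc_diff_bound[OF f, of "real n" N] by simp
    qed
    ultimately show ?thesis
      by (auto intro: LIMSEQ_le_const)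
  qed
  have "((\<lambda>N. L2_nrm lborel (\<lambda>\<xi>. g \<xi> - ?T N \<xi>)) \<longlongrightarrow> 0) at_top"
    by (rule Lim_null_comparison[OF _ r]) (simp add: bound)
  then have "g \<in> L2 lborel \<and> ((\<lambda>N. \<integral>\<^sup>+\<xi>. ennreal ((cmod (g \<xi> - ?T N \<xi>))\<^sup>2) \<partial>lborel) \<longlongrightarrow> 0) at_top"
    using g by (subst L2_nrm_tendsto_0_iff_nn_integral) (auto intro!: L2_diff fourier_trunc_L2 f)
  then have *: "fourier f \<in> L2 lborel \<and> ((\<lambda>N. \<integral>\<^sup>+\<xi>. ennreal ((cmod (fourier f \<xi> - ?T N \<xi>))\<^sup>2) \<partial>lborel) \<longlongrightarrow> 0) at_top"
    unfolding fourier_def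
    by (rule someI[where P="\<lambda>g. g \<in> L2 lborel \<and> ((\<lambda>N. \<integral>\<^sup>+\<xi>. ennreal ((cmod (g \<xi> - ?T N \<xi>))\<^sup>2) \<partial>lborel) \<longlongrightarrow> 0) at_top"])
  then show F: "fourier f \<in> L2 lborel" by blast
  show "((\<lambda>N. L2_nrm lborel (\<lambda>\<xi>. fourier f \<xi> - ?T N \<xi>)) \<longlongrightarrow> 0) at_top"
    using * by (subst (asm) L2_nrm_tendsto_0_iff_nn_integral) (auto intro!: L2_diff fourier_trunc_L2 f F)
qed

lemma fourier_unique:
  assumes f: "f \<in> L2 lborel" and g: "g \<in> L2 lborel"
    and "((\<lambda>N. L2_nrm lborel (\<lambda>\<xi>. g \<xi> - fourier_trunc N f \<xi>)) \<longlongrightarrow> 0) at_top"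
  shows "AE \<xi> in lborel. fourier f \<xi> = g \<xi>"
  by (rule L2_limit_unique[OF fourier_trunc_L2(1)[OF f] fourier_L2[OF f] g _ fourier_tendsto[OF f] assms(3)]) simp

lemma fourier_lincomb:
  assumes f: "f \<in> L2 lborel" and g: "g \<in> L2 lborel"
  shows "AE \<xi> in lborel. fourier (\<lambda>x. a * f x + b * g x) \<xi> = a * fourier f \<xi> + b * fourier g \<xi>"
proof (rule fourier_unique)
  let ?d = "\<lambda>f N \<xi>. fourier f \<xi> - fourier_trunc N f \<xi>"
  let ?e = "\<lambda>N. L2_nrm lborel (\<lambda>\<xi>. a * fourier f \<xi> + b * fourier g \<xi> - fourier_trunc N (\<lambda>x. a * f x + b * g x) \<xi>)"
  show "(?e \<longlongrightarrow> 0) at_top"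
  proof (rule Lim_null_comparison[OF always_eventually, OF allI])
    fix N
    have "?e N
        = L2_nrm lborel (\<lambda>\<xi>. a * ?d f N \<xi> + b * ?d g N \<xi>)"
      by (simp add: fourier_trunc_lincomb[OF f g] algebra_simps)
    also have "\<dots> \<le> L2_nrm lborel (\<lambda>\<xi>. a * ?d f N \<xi>) + L2_nrm lborel (\<lambda>\<xi>. b * ?d g N \<xi>)"
      by (intro L2_nrm_triangle L2_scale L2_diff fourier_L2 fourier_trunc_L2 f g)
    finally show "norm (?e N)
       \<le> cmod a * L2_nrm lborel (?d f N) + cmod b * L2_nrm lborel (?d g N)"
      by (simp add: L2_nrm_scale)
  next
    show "((\<lambda>N. cmod a * L2_nrm lborel (?d f N) + cmod b * L2_nrm lborel (?d g N)) \<longlongrightarrow> 0) at_top"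
      using tendsto_add[OF tendsto_mult_right_zero[OF fourier_tendsto[OF f]] tendsto_mult_right_zero[OF fourier_tendsto[OF g]]]
      by simp
  qed
qed (use f g in \<open>auto intro!: L2_lincomb fourier_L2\<close>)

lemma fourier_contraction:
  assumes f: "f \<in> L2 lborel" shows "L2_nrm lborel (fourier f) \<le> L2_nrm lborel f"
  using L2_nrm_tendsto[OF fourier_trunc_L2(1)[OF f] fourier_L2[OF f] fourier_tendsto[OF f]]
  by (rule tendsto_upperbound) (simp_all add: fourier_trunc_L2(2)[OF f])

text \<open>
  For a function of bounded support the truncated transforms are eventually constant.
\<close>

lemma fourier_cutoff:
  assumes f: "f \<in> L2 lborel"
  shows "AE \<xi> in lborel. fourier (cutoff t f) \<xi> = fourier_integral (cutoff t f) \<xi>"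
proof (rule fourier_unique[OF cutoff_L2[OF f]])
  show "fourier_integral (cutoff t f) \<in> L2 lborel"
    by (intro fourier_integral_L2 cutoff_integrable cutoff_L2 f)
  have "\<forall>\<^sub>F N in at_top. L2_nrm lborel (\<lambda>\<xi>. fourier_integral (cutoff t f) \<xi> - fourier_trunc N (cutoff t f) \<xi>) = 0"
    using eventually_ge_at_top[of t]
  proof eventually_elim
    fix N :: real assume "t \<le> N"
    then have "cutoff N (cutoff t f) = cutoff t f" by (auto simp: cutoff_def split: split_indicator)
    then show "L2_nrm lborel (\<lambda>\<xi>. fourier_integral (cutoff t f) \<xi> - fourier_trunc N (cutoff t f) \<xi>) = 0"
      using L2_measurable[OF f] by (subst fourier_trunc_eq) (simp_all add: cutoff_measurable L2_nrm_def)
  qed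
  then show "((\<lambda>N. L2_nrm lborel (\<lambda>\<xi>. fourier_integral (cutoff t f) \<xi> - fourier_trunc N (cutoff t f) \<xi>)) \<longlongrightarrow> 0) at_top"
    by (rule tendsto_eventually)
qed

text \<open>
  Truncated transforms are integrals, so almost everywhere equal functions have literally the same
  truncated transforms, and the choice operator picks the same representative.
\<close>

lemma fourier_cong_AE:
  assumes f: "f \<in> borel_measurable borel" and g: "g \<in> borel_measurable borel" and eq: "AE x in lborel. f x = g x"
  shows "fourier f = fourier g"
proof -
  have "fourier_trunc N f = fourier_trunc N g" for N
    unfolding fourier_trunc_eq[OF f] fourier_trunc_eq[OF g]
    using eq by (intro fourier_integral_cong_AE cutoff_measurable f g) (auto elim!: eventually_mono simp: cutoff_def)
  then show ?thesis by (simp add: fourier_def)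
qed

section \<open>The adjoint of the Fourier transform and band limiting\<close>

lemma L2_reflect:
  fixes f :: "real \<Rightarrow> complex"
  assumes f: "f \<in> L2 lborel"
  shows "(\<lambda>x. f (- x)) \<in> L2 lborel" "L2_nrm lborel (\<lambda>x. f (- x)) = L2_nrm lborel f"
proof -
  have [measurable]: "f \<in> borel_measurable borel" using L2_measurable[OF f] by simp
  have "integrable lborel (\<lambda>x. (cmod (f (0 + -1 * x)))\<^sup>2)"
    using f by (intro lborel_integrable_real_affine) simp_all
  then show "(\<lambda>x. f (- x)) \<in> L2 lborel" by (simp add: L2_def del: L2_integrable_sq)
  have "(\<integral>x. (cmod (f x))\<^sup>2 \<partial>lborel) = \<bar>-1\<bar> *\<^sub>R (\<integral>x. (cmod (f (0 + -1 * x)))\<^sup>2 \<partial>lborel)"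
    by (rule lborel_integral_real_affine) simp
  then show "L2_nrm lborel (\<lambda>x. f (- x)) = L2_nrm lborel f" by (simp add: L2_nrm_def)
qed

lemma L2_inner_tendsto_right:
  assumes "\<And>n. f n \<in> L2 M" "l \<in> L2 M" "h \<in> L2 M"
    and "((\<lambda>n. L2_nrm M (\<lambda>x. l x - f n x)) \<longlongrightarrow> 0) F"
  shows "((\<lambda>n. L2_inner M h (f n)) \<longlongrightarrow> L2_inner M h l) F"
  unfolding L2_inner_commute[of M h] by (intro tendsto_cnj L2_inner_tendsto assms)

lemma fourier_integral_adjoint:
  assumes f: "integrable lborel f" and g: "integrable lborel g"
  shows "L2_inner lborel (fourier_integral f) g = L2_inner lborel f (\<lambda>x. fourier_integral g (- x))"
proof -
  have "integrable lborel (\<lambda>x. cnj (g x))" using g by simp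
  from fourier_integral_multiplication[OF f this] show ?thesis
    by (simp add: L2_inner_def fourier_integral_cnj)
qed

text \<open>
  For truncated functions on both sides this is the multiplication formula; the two truncations are
  removed one after the other.
\<close>

lemma fourier_adjoint:
  assumes f: "f \<in> L2 lborel" and g: "g \<in> L2 lborel"
  shows "L2_inner lborel (fourier f) g = L2_inner lborel f (\<lambda>x. fourier g (- x))"
proof -
  let ?G = "\<lambda>x. fourier g (- x)"
  have fm: "f \<in> borel_measurable borel" and gm: "g \<in> borel_measurable borel"
    using L2_measurable[OF f] L2_measurable[OF g] by simp_all
  have top: "at_top \<noteq> (bot :: real filter)" by simp
  have refl_lim: "((\<lambda>M. L2_nrm lborel (\<lambda>x. fourier g (- x) - fourier_trunc M g (- x))) \<longlongrightarrow> 0) at_top"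
    using fourier_tendsto[OF g] L2_reflect(2)[OF L2_diff[OF fourier_L2[OF g] fourier_trunc_L2(1)[OF g]]]
    by simp
  have N: "L2_inner lborel (fourier_trunc N f) g = L2_inner lborel (cutoff N f) ?G" for N
  proof (rule tendsto_unique[OF top])
    show "((\<lambda>M. L2_inner lborel (fourier_trunc N f) (cutoff M g)) \<longlongrightarrow> L2_inner lborel (fourier_trunc N f) g) at_top"
      by (intro L2_inner_tendsto_right cutoff_L2 g fourier_trunc_L2 f cutoff_tendsto)
    have "((\<lambda>M. L2_inner lborel (cutoff N f) (\<lambda>x. fourier_trunc M g (- x))) \<longlongrightarrow> L2_inner lborel (cutoff N f) ?G) at_top"
      by (intro L2_inner_tendsto_right L2_reflect(1) fourier_trunc_L2 fourier_L2 cutoff_L2 f g refl_lim)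
    moreover have "L2_inner lborel (fourier_trunc N f) (cutoff M g) = L2_inner lborel (cutoff N f) (\<lambda>x. fourier_trunc M g (- x))" for M
      by (simp add: fourier_trunc_eq[OF fm] fourier_trunc_eq[OF gm] fourier_integral_adjoint cutoff_integrable f g)
    ultimately show "((\<lambda>M. L2_inner lborel (fourier_trunc N f) (cutoff M g)) \<longlongrightarrow> L2_inner lborel (cutoff N f) ?G) at_top"
      by simp
  qed
  show ?thesis
  proof (rule tendsto_unique[OF top])
    show "((\<lambda>N. L2_inner lborel (fourier_trunc N f) g) \<longlongrightarrow> L2_inner lborel (fourier f) g) at_top"
      by (intro L2_inner_tendsto fourier_trunc_L2 fourier_L2 fourier_tendsto f g)
    show "((\<lambda>N. L2_inner lborel (fourier_trunc N f) g) \<longlongrightarrow> L2_inner lborel f ?G) at_top"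
      unfolding N by (intro L2_inner_tendsto cutoff_L2 cutoff_tendsto f L2_reflect(1) fourier_L2 g)
  qed
qed

text \<open>
  The reflected transform is a witness for the choice in the definition of the adjoint, and the defining
  property determines the adjoint up to a null set.
\<close>

lemma L2_adjoint_fourier:
  assumes g: "g \<in> L2 lborel"
  shows L2_adjoint_fourier_L2: "L2_adjoint lborel fourier g \<in> L2 lborel"
    and L2_adjoint_fourier_inner: "f \<in> L2 lborel \<Longrightarrow> L2_inner lborel (fourier f) g = L2_inner lborel f (L2_adjoint lborel fourier g)"
    and L2_adjoint_fourier_AE: "AE x in lborel. L2_adjoint lborel fourier g x = fourier g (- x)"
proof -
  have r: "(\<lambda>x. fourier g (- x)) \<in> L2 lborel" by (intro L2_reflect fourier_L2 g)
  have *: "L2_adjoint lborel fourier g \<in> L2 lborel \<and>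
      (\<forall>f\<in>L2 lborel. L2_inner lborel (fourier f) g = L2_inner lborel f (L2_adjoint lborel fourier g))"
    unfolding L2_adjoint_def
    by (rule someI[where P="\<lambda>h. h \<in> L2 lborel \<and> (\<forall>f\<in>L2 lborel. L2_inner lborel (fourier f) g = L2_inner lborel f h)"
        and x="\<lambda>x. fourier g (- x)"]) (use r fourier_adjoint[OF _ g] in blast)
  then show L: "L2_adjoint lborel fourier g \<in> L2 lborel" by blast
  show "L2_inner lborel (fourier f) g = L2_inner lborel f (L2_adjoint lborel fourier g)" if "f \<in> L2 lborel" for f
    using * that by blast
  show "AE x in lborel. L2_adjoint lborel fourier g x = fourier g (- x)"
    by (rule L2_inner_eq_imp_AE_eq[OF L r]) (use * fourier_adjoint[OF _ g] in simp)
qed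

lemma AE_lborel_reflect:
  assumes "AE x in lborel. P x"
  shows "AE x in lborel. P (- x :: real)"
proof -
  have "AE x in distr lborel borel uminus. P x"
    unfolding lborel_distr_uminus by (rule assms)
  from AE_distrD[OF _ this] show ?thesis by simp
qed

lemma L2_adjoint_fourier_lincomb:
  assumes f: "f \<in> L2 lborel" and g: "g \<in> L2 lborel"
  shows "AE x in lborel. L2_adjoint lborel fourier (\<lambda>x. a * f x + b * g x) x =
    a * L2_adjoint lborel fourier f x + b * L2_adjoint lborel fourier g x"
  using AE_lborel_reflect[OF fourier_lincomb[OF f g, of a b]]
    L2_adjoint_fourier_AE[OF f] L2_adjoint_fourier_AE[OF g] L2_adjoint_fourier_AE[OF L2_lincomb[OF f g, of a b]]
  by eventually_elim simp

lemma L2_adjoint_fourier_contraction: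
  assumes g: "g \<in> L2 lborel"
  shows "L2_nrm lborel (L2_adjoint lborel fourier g) \<le> L2_nrm lborel g"
proof -
  have r: "(\<lambda>x. fourier g (- x)) \<in> L2 lborel" by (intro L2_reflect fourier_L2 g)
  have "L2_nrm lborel (L2_adjoint lborel fourier g) = L2_nrm lborel (\<lambda>x. fourier g (- x))"
    by (intro L2_nrm_cong_AE L2_measurable[OF r] L2_measurable[OF L2_adjoint_fourier_L2[OF g]] L2_adjoint_fourier_AE g)
  also have "\<dots> = L2_nrm lborel (fourier g)" by (intro L2_reflect fourier_L2 g)
  finally show ?thesis using fourier_contraction[OF g] by simp
qed

lemma AE_zero_if_orthogonal_to_intervals:
  assumes h: "h \<in> L2 lborel" and zero: "\<And>a b. L2_inner lborel h (indicator {a..b}) = 0"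
  shows "AE x::real in lborel. h x = 0"
proof -
  have [measurable]: "h \<in> borel_measurable borel" using L2_measurable[OF h] by simp
  have "AE x in lborel. cutoff (real n) h x = 0" for n
  proof (rule AE_zero_if_interval_integrals_zero[OF cutoff_integrable[OF h]])
    fix a b :: real
    have "(\<integral>x. indicator {a..b} x * cutoff (real n) h x \<partial>lborel) = L2_inner lborel h (indicator {max a (- real n)..min b (real n)})"
      unfolding L2_inner_def
    proof (rule integral_cong_AE)
      have "AE x in lborel. x \<noteq> real n" "AE x in lborel. x \<noteq> - real n" by (rule AE_lborel_singleton)+
      then show "AE x in lborel. indicator {a..b} x * cutoff (real n) h x = h x * cnj (indicator {max a (- real n)..min b (real n)} x)"
        by eventually_elim (auto simp: cutoff_def indicator_def)
    qed (auto simp: cutoff_def)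
    then show "(\<integral>x. indicator {a..b} x * cutoff (real n) h x \<partial>lborel) = 0" by (simp add: zero)
  qed
  then have "AE x in lborel. \<forall>n. cutoff (real n) h x = 0" by (simp add: AE_all_countable)
  then show ?thesis
  proof eventually_elim
    fix x assume *: "\<forall>n. cutoff (real n) h x = 0"
    obtain n where "\<bar>x\<bar> < real n" using reals_Archimedean2 by blast
    with *[rule_format, of n] show "h x = 0" by (auto simp: cutoff_def indicator_def abs_less_iff split: if_splits)
  qed
qed

text \<open>
  The identity \<open>F\<^sup>* F = 1\<close>: paired with the indicator \<open>1\<^sub>J\<close> of an interval, \<open>F\<^sup>* F f\<close> gives the inner
  product of \<open>F f\<close> and \<open>F 1\<^sub>J\<close>, which is the inner product of \<open>f\<close> and \<open>1\<^sub>J\<close> by the Parseval identity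
  for intervals. A function in \<open>L\<^sup>2\<close> that is orthogonal to all intervals vanishes almost everywhere.
\<close>

lemma L2_adjoint_fourier_fourier:
  assumes f: "f \<in> L2 lborel"
  shows "AE x in lborel. L2_adjoint lborel fourier (fourier f) x = f x"
proof -
  let ?g = "L2_adjoint lborel fourier (fourier f)"
  have g: "?g \<in> L2 lborel" by (intro L2_adjoint_fourier_L2 fourier_L2 f)
  have fm: "f \<in> borel_measurable borel" using L2_measurable[OF f] by simp
  have "L2_inner lborel ?g (indicator {a..b}) = L2_inner lborel f (indicator {a..b})" for a b
  proof -
    let ?J = "indicator {a..b} :: real \<Rightarrow> complex"
    have J: "?J \<in> L2 lborel" by (rule indicator_interval_L2)
    \<comment> \<open>The cutoff interval is open, so it must be strictly larger than \<open>[a,b]\<close>.\<close>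
    define t where "t = max \<bar>a\<bar> \<bar>b\<bar> + 1"
    have Jt: "cutoff t ?J = ?J" by (auto simp: cutoff_def t_def indicator_def fun_eq_iff)
    have FJ: "AE \<xi> in lborel. fourier ?J \<xi> = fourier_integral ?J \<xi>"
      using fourier_cutoff[OF J, of t] by (simp add: Jt)
    have FJL: "fourier_integral ?J \<in> L2 lborel" by (intro fourier_integral_L2 indicator_interval_L2)
    have "L2_inner lborel ?g ?J = L2_inner lborel (fourier f) (fourier ?J)"
      using L2_adjoint_fourier_inner[OF fourier_L2[OF f] J] by (simp add: L2_inner_commute[of lborel ?g] L2_inner_commute[of lborel "fourier f"])
    also have "\<dots> = L2_inner lborel (fourier f) (fourier_integral ?J)"
      by (intro L2_inner_cong_AE FJ L2_measurable fourier_L2 f J FJL) simp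
    also have "\<dots> = L2_inner lborel f ?J"
    proof (rule tendsto_unique)
      show "((\<lambda>N. L2_inner lborel (fourier_trunc N f) (fourier_integral ?J)) \<longlongrightarrow> L2_inner lborel (fourier f) (fourier_integral ?J)) at_top"
        by (intro L2_inner_tendsto fourier_trunc_L2 fourier_L2 fourier_tendsto f FJL)
      show "((\<lambda>N. L2_inner lborel (fourier_trunc N f) (fourier_integral ?J)) \<longlongrightarrow> L2_inner lborel f ?J) at_top"
        unfolding fourier_trunc_eq[OF fm] fourier_integral_Parseval_interval[OF cutoff_integrable[OF f] cutoff_L2[OF f]]
        by (intro L2_inner_tendsto cutoff_L2 cutoff_tendsto f J)
    qed simp
    finally show ?thesis .
  qed
  then have "AE x in lborel. ?g x - f x = 0"
    by (intro AE_zero_if_orthogonal_to_intervals L2_diff g f) (simp add: L2_inner_diff_left g f indicator_interval_L2)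
  then show ?thesis by simp
qed

lemma band_limit_L2: "f \<in> L2 lborel \<Longrightarrow> band_limit w f \<in> L2 lborel"
  unfolding band_limit_def by (intro fourier_L2 cutoff_L2 L2_adjoint_fourier_L2)

lemma band_limit_contraction:
  assumes f: "f \<in> L2 lborel" shows "L2_nrm lborel (band_limit w f) \<le> L2_nrm lborel f"
proof -
  have a: "L2_adjoint lborel fourier f \<in> L2 lborel" by (rule L2_adjoint_fourier_L2[OF f])
  show ?thesis
    unfolding band_limit_def
    using fourier_contraction[OF cutoff_L2[OF a]] L2_nrm_cutoff_le[OF a] L2_adjoint_fourier_contraction[OF f]
    by (meson order_trans)
qed

lemma band_limit_lincomb:
  assumes f: "f \<in> L2 lborel" and g: "g \<in> L2 lborel"
  shows "AE x in lborel. band_limit w (\<lambda>x. a * f x + b * g x) x = a * band_limit w f x + b * band_limit w g x"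
proof -
  let ?A = "L2_adjoint lborel fourier"
  have L: "?A f \<in> L2 lborel" "?A g \<in> L2 lborel" "?A (\<lambda>x. a * f x + b * g x) \<in> L2 lborel"
    by (intro L2_adjoint_fourier_L2 L2_lincomb f g)+
  have c: "cutoff w (\<lambda>x. a * ?A f x + b * ?A g x) = (\<lambda>x. a * cutoff w (?A f) x + b * cutoff w (?A g) x)"
    by (rule ext) (rule cutoff_lincomb)
  have "band_limit w (\<lambda>x. a * f x + b * g x) = fourier (\<lambda>x. a * cutoff w (?A f) x + b * cutoff w (?A g) x)"
    unfolding band_limit_def c[symmetric]
  proof (rule fourier_cong_AE)
    show "AE x in lborel. cutoff w (?A (\<lambda>x. a * f x + b * g x)) x = cutoff w (\<lambda>x. a * ?A f x + b * ?A g x) x"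
      using L2_adjoint_fourier_lincomb[OF f g, of a b] by eventually_elim (simp add: cutoff_def)
  qed (use L2_measurable[OF L(3)] L2_measurable[OF L2_lincomb[OF L(1,2)]] in \<open>simp_all add: cutoff_measurable\<close>)
  then show ?thesis
    using fourier_lincomb[OF cutoff_L2[OF L(1)] cutoff_L2[OF L(2)]] by (simp add: band_limit_def)
qed

text \<open>
  An exact equality of functions: the two cutoffs agree almost everywhere, and the transform depends
  only on the class of its argument.
\<close>

lemma band_limit_idem:
  assumes f: "f \<in> L2 lborel" shows "band_limit w (band_limit w f) = band_limit w f"
proof -
  let ?c = "cutoff w (L2_adjoint lborel fourier f)"
  have c: "?c \<in> L2 lborel" by (intro cutoff_L2 L2_adjoint_fourier_L2 f)
  have L: "L2_adjoint lborel fourier (fourier ?c) \<in> L2 lborel" by (intro L2_adjoint_fourier_L2 fourier_L2 c)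
  have "fourier (cutoff w (L2_adjoint lborel fourier (fourier ?c))) = fourier ?c"
  proof (rule fourier_cong_AE)
    show "AE x in lborel. cutoff w (L2_adjoint lborel fourier (fourier ?c)) x = ?c x"
      using L2_adjoint_fourier_fourier[OF c] by eventually_elim (simp add: cutoff_def split: split_indicator)
  qed (use L2_measurable[OF c] L2_measurable[OF L] in \<open>simp_all add: cutoff_measurable\<close>)
  then show ?thesis by (simp add: band_limit_def)
qed

text \<open>
  Continuous at \<open>0\<close>, unlike the quotient with the convention \<open>x / 0 = 0\<close>.
\<close>

definition sinc_kernel :: "real \<Rightarrow> real \<Rightarrow> real" where
  "sinc_kernel w s = (if s = 0 then w / pi else sin (w * s) / (pi * s))"

lemma integral_cis_interval:
  assumes "w > 0"
  shows "(\<integral>\<xi>. indicator {-w<..<w} \<xi> * cis (\<xi> * s) \<partial>lborel) = complex_of_real (2 * pi * sinc_kernel w s)"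
proof -
  let ?c = "\<lambda>\<xi>. indicator {-w..w} \<xi> *\<^sub>R cis (\<xi> * s)"
  have "(\<integral>\<xi>. indicator {-w<..<w} \<xi> * cis (\<xi> * s) \<partial>lborel) = (\<integral>\<xi>. ?c \<xi> \<partial>lborel)"
  proof (rule integral_cong_AE)
    have "AE x in lborel. x \<noteq> w" "AE x in lborel. x \<noteq> - w" by (rule AE_lborel_singleton)+
    then show "AE \<xi> in lborel. indicator {-w<..<w} \<xi> * cis (\<xi> * s) = ?c \<xi>"
      by eventually_elim (auto simp: indicator_def)
  qed measurable
  also have "\<dots> = complex_of_real (2 * pi * sinc_kernel w s)"
  proof (cases "s = 0")
    case True
    have "(\<integral>\<xi>. ?c \<xi> \<partial>lborel) = (2 * w) *\<^sub>R 1"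
      using True assms by (simp add: measure_def emeasure_lborel_Icc_eq)
    then show ?thesis using True by (simp add: sinc_kernel_def scaleR_conv_of_real)
  next
    case False
    have "(\<integral>\<xi>. ?c \<xi> \<partial>lborel) = cis (w * s) / (\<i> * s) - cis (- w * s) / (\<i> * s)"
    proof (rule integral_FTC_atLeastAtMost)
      show "((\<lambda>\<xi>. cis (\<xi> * s) / (\<i> * s)) has_vector_derivative cis (x * s)) (at x within {-w..w})" for x
      proof -
        have "((\<lambda>\<xi>. exp (\<i> * (complex_of_real \<xi> * s)) / (\<i> * s)) has_vector_derivative exp (\<i> * (complex_of_real x * s))) (at x within {-w..w})"
          using False by (auto intro!: derivative_eq_intros has_vector_derivative_real_field simp: field_simps)
        then show ?thesis by (simp add: cis_conv_exp)
      qed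
    qed (use assms in \<open>auto intro!: continuous_intros\<close>)
    also have "\<dots> = (cis (w * s) - cis (- (w * s))) / (\<i> * s)" by (simp add: diff_divide_distrib)
    also have "cis (w * s) - cis (- (w * s)) = 2 * \<i> * complex_of_real (sin (w * s))"
      by (simp add: complex_eq_iff)
    also have "2 * \<i> * complex_of_real (sin (w * s)) / (\<i> * s) = complex_of_real (2 * pi * sinc_kernel w s)"
      using False by (simp add: sinc_kernel_def)
    finally show ?thesis .
  qed
  finally show ?thesis .
qed

text \<open>
  Cutting off the transform at frequency \<open>w\<close> multiplies it by an indicator. By the multiplication formula
  this factor can be transformed instead of the function, and its transform is the sinc kernel.
\<close>

lemma fourier_integral_cutoff_reflect:
  assumes w: "w > 0" and Fi: "integrable lborel F"
  shows "fourier_integral (cutoff w (\<lambda>x. fourier_integral F (- x))) x = (\<integral>y. complex_of_real (sinc_kernel w (x - y)) * F y \<partial>lborel)"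
proof -
  let ?c = "complex_of_real (1 / sqrt (2 * pi))" and ?H = "\<lambda>x. fourier_integral F (- x)"
  let ?e = "\<lambda>\<xi>. indicator {-w<..<w} \<xi> * cis (\<xi> * x)"
  have e: "integrable lborel ?e"
  proof (rule Bochner_Integration.integrable_bound)
    show "integrable lborel (indicator {-w..w} :: real \<Rightarrow> complex)" by (rule indicator_interval_L2)
  qed (auto simp: norm_mult split: split_indicator)
  have "(\<integral>\<xi>. cis (- (\<xi> * x)) * cutoff w ?H \<xi> \<partial>lborel) = \<bar>-1\<bar> *\<^sub>R (\<integral>\<xi>. cis (- ((0 + -1 * \<xi>) * x)) * cutoff w ?H (0 + -1 * \<xi>) \<partial>lborel)"
    by (rule lborel_integral_real_affine) simp
  also have "\<dots> = (\<integral>\<xi>. fourier_integral F \<xi> * ?e \<xi> \<partial>lborel)"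
    by (simp, intro Bochner_Integration.integral_cong) (auto simp: cutoff_def split: split_indicator)
  also have "\<dots> = (\<integral>y. F y * fourier_integral ?e y \<partial>lborel)"
    by (rule fourier_integral_multiplication[OF Fi e])
  finally have "fourier_integral (cutoff w ?H) x = ?c * (\<integral>y. F y * fourier_integral ?e y \<partial>lborel)"
    unfolding fourier_integral_def[of "cutoff w ?H"] by (simp only:)
  also have "\<dots> = (\<integral>y. ?c * (F y * fourier_integral ?e y) \<partial>lborel)" by (rule integral_mult_right_zero[symmetric])
  also have "\<dots> = (\<integral>y. complex_of_real (sinc_kernel w (x - y)) * F y \<partial>lborel)"
  proof (intro Bochner_Integration.integral_cong refl)
    fix y
    have "fourier_integral ?e y = ?c * (\<integral>\<xi>. indicator {-w<..<w} \<xi> * cis (\<xi> * (x - y)) \<partial>lborel)"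
    proof -
      have "cis (- (\<xi> * y)) * ?e \<xi> = indicator {-w<..<w} \<xi> * cis (\<xi> * (x - y))" for \<xi>
      proof -
        have "cis (- (\<xi> * y)) * cis (\<xi> * x) = cis (\<xi> * (x - y))"
          by (simp add: cis_mult algebra_simps)
        then show ?thesis
          by (simp only: mult.left_commute[of "cis (- (\<xi> * y))" "indicator {-w<..<w} \<xi>"])
      qed
      then show ?thesis unfolding fourier_integral_def by (simp only:)
    qed
    also have "\<dots> = ?c * complex_of_real (2 * pi * sinc_kernel w (x - y))"
      by (simp only: integral_cis_interval[OF w])
    finally have ce: "?c * fourier_integral ?e y = complex_of_real (1 / sqrt (2 * pi) * (1 / sqrt (2 * pi) * (2 * pi * sinc_kernel w (x - y))))"
      by (simp only: of_real_mult)
    have "1 / sqrt (2 * pi) * (1 / sqrt (2 * pi) * (2 * pi * sinc_kernel w (x - y))) = (2 * pi) / (sqrt (2 * pi) * sqrt (2 * pi)) * sinc_kernel w (x - y)"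
      by (simp only: times_divide_times_eq times_divide_eq_left times_divide_eq_right divide_divide_eq_left mult_1 mult.assoc)
    also have "\<dots> = sinc_kernel w (x - y)" by simp
    finally have "?c * fourier_integral ?e y = complex_of_real (sinc_kernel w (x - y))"
      using ce by (simp only:)
    moreover have "?c * (F y * fourier_integral ?e y) = ?c * fourier_integral ?e y * F y"
      by (simp only: mult_ac)
    ultimately show "?c * (F y * fourier_integral ?e y) = complex_of_real (sinc_kernel w (x - y)) * F y"
      by (simp only:)
  qed
  finally show ?thesis .
qed

lemma band_limit_cutoff:
  assumes w: "w > 0" and f: "f \<in> L2 lborel"
  shows "AE x in lborel. band_limit w (cutoff t f) x = (\<integral>y. complex_of_real (sinc_kernel w (x - y)) * cutoff t f y \<partial>lborel)"
proof -
  let ?F = "cutoff t f"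
  have F: "?F \<in> L2 lborel" and Fi: "integrable lborel ?F" by (intro cutoff_L2 cutoff_integrable f)+
  let ?h = "\<lambda>x. fourier_integral ?F (- x)"
  have h: "?h \<in> L2 lborel" by (intro L2_reflect(1) fourier_integral_L2 F Fi)
  have hA: "AE x in lborel. L2_adjoint lborel fourier ?F x = ?h x"
    using L2_adjoint_fourier_AE[OF F] AE_lborel_reflect[OF fourier_cutoff[OF f, of t]] by eventually_elim simp
  have "band_limit w ?F = fourier (cutoff w ?h)"
    unfolding band_limit_def
    by (rule fourier_cong_AE)
      (use hA L2_measurable[OF h] L2_measurable[OF L2_adjoint_fourier_L2[OF F]] in \<open>auto simp: cutoff_measurable cutoff_def elim!: eventually_mono\<close>)
  then have "AE x in lborel. band_limit w ?F x = fourier_integral (cutoff w ?h) x"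
    using fourier_cutoff[OF h, of w] by simp
  then show ?thesis
    unfolding fourier_integral_cutoff_reflect[OF w Fi] .
qed

section \<open>The Riesz--Schauder theorem\<close>

text \<open>
  Take a point of \<open>X\<close> outside \<open>Y\<close>, subtract an element of \<open>Y\<close> that is closest up to a factor
  \<open>2\<close>, and normalise.
\<close>

lemma Riesz_almost_orthogonal:
  fixes X Y :: "'a::real_normed_vector set"
  assumes X: "subspace X" and Y: "subspace Y" "closed Y" "Y \<subseteq> X" and ne: "Y \<noteq> X"
  obtains x where "x \<in> X" "norm x = 1" "\<And>y. y \<in> Y \<Longrightarrow> 1 / 2 \<le> norm (x - y)"
proof -
  obtain v where v: "v \<in> X" "v \<notin> Y" using Y(3) ne by blast
  have Y0: "Y \<noteq> {}" using Y(1) subspace_0 by blast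
  define d where "d = infdist v Y"
  have "d > 0"
    using in_closed_iff_infdist_zero[OF Y(2) Y0, of v] v(2) infdist_nonneg[of v Y] by (simp add: d_def)
  have "\<exists>y\<in>Y. dist v y < 2 * d"
  proof (rule ccontr)
    assume "\<not> ?thesis"
    then have "2 * d \<le> infdist v Y"
      using Y0 by (auto simp: infdist_def not_less intro: cINF_greatest)
    then show False using \<open>d > 0\<close> by (simp add: d_def)
  qed
  then obtain y0 where y0: "y0 \<in> Y" "norm (v - y0) < 2 * d" by (auto simp: dist_norm)
  define n where "n = norm (v - y0)"
  have "n > 0" using v(2) y0(1) by (auto simp: n_def)
  show ?thesis
  proof
    show "(1 / n) *\<^sub>R (v - y0) \<in> X"
      using X Y(3) v y0 by (intro subspace_scale subspace_diff) auto
    show "norm ((1 / n) *\<^sub>R (v - y0)) = 1"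
      using \<open>n > 0\<close> by (simp add: n_def)
    fix y assume y: "y \<in> Y"
    have "y0 + n *\<^sub>R y \<in> Y" using Y(1) y y0 by (intro subspace_add subspace_scale)
    then have "d \<le> norm (v - (y0 + n *\<^sub>R y))"
      unfolding d_def dist_norm[symmetric] by (rule infdist_le)
    also have "v - (y0 + n *\<^sub>R y) = n *\<^sub>R ((1 / n) *\<^sub>R (v - y0) - y)"
      using \<open>n > 0\<close> by (simp add: algebra_simps)
    finally have "d \<le> n * norm ((1 / n) *\<^sub>R (v - y0) - y)" using \<open>n > 0\<close> by simp
    moreover have "n < 2 * d" using y0 by (simp add: n_def)
    ultimately have "n * (1 / 2) \<le> n * norm ((1 / n) *\<^sub>R (v - y0) - y)" by simp
    then show "1 / 2 \<le> norm ((1 / n) *\<^sub>R (v - y0) - y)" using \<open>n > 0\<close> by (simp only: mult_le_cancel_left_pos)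
  qed
qed

text \<open>
  Put \<open>S = 1 - T\<close>. If \<open>S\<close> were not bounded below, compactness would produce a unit vector in its
  kernel. Hence \<open>S\<close> is injective with closed ranges, and if it were not surjective, the ranges of its
  powers would decrease strictly. Unit vectors \<open>x n\<close> in the \<open>n\<close>-th range that stay away from the next
  range have images under \<open>T\<close> with mutual distance at least \<open>1 / 2\<close>, against compactness.
\<close>

theorem Riesz_Schauder:
  fixes T :: "'a::banach \<Rightarrow> 'a"
  assumes T: "bounded_linear T"
    and compact: "\<And>x. (\<And>n::nat. norm (x n) \<le> 1) \<Longrightarrow> \<exists>r l. strict_mono (r :: nat \<Rightarrow> nat) \<and> (\<lambda>n. T (x (r n))) \<longlonglongrightarrow> l"
    and inj: "\<And>x. T x = x \<Longrightarrow> x = 0"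
  shows "\<exists>c>0. \<forall>x. c * norm x \<le> norm (x - T x)" and "surj (\<lambda>x. x - T x)"
proof -
  interpret T: bounded_linear T by fact
  define S where "S x = x - T x" for x
  have S: "bounded_linear S"
    unfolding S_def[abs_def] by (intro bounded_linear_sub bounded_linear_ident T)
  interpret S: bounded_linear S by fact
  have "\<exists>c>0. \<forall>x. c * norm x \<le> norm (S x)"
  proof (rule ccontr)
    assume contra: "\<not> ?thesis"
    have "\<exists>x. norm x = 1 \<and> norm (S x) < 1 / Suc n" for n
    proof -
      have "1 / Suc n > (0::real)" by simp
      then obtain x where x: "norm (S x) < 1 / Suc n * norm x"
        using contra by (meson not_le)
      then have "x \<noteq> 0" by auto
      then have "norm (S ((1 / norm x) *\<^sub>R x)) < 1 / Suc n"
        using x by (simp add: S.scaleR field_simps)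
      moreover have "norm ((1 / norm x) *\<^sub>R x) = 1" using \<open>x \<noteq> 0\<close> by simp
      ultimately show ?thesis by blast
    qed
    then obtain x where x: "\<And>n. norm (x n) = 1" "\<And>n. norm (S (x n)) < 1 / Suc n" by metis
    obtain r l where r: "strict_mono r" and l: "(\<lambda>n. T (x (r n))) \<longlonglongrightarrow> l"
      using compact[of x] x(1) by auto
    have "(\<lambda>n. S (x n)) \<longlonglongrightarrow> 0"
      by (rule Lim_null_comparison[OF _ LIMSEQ_Suc[OF lim_1_over_n]]) (intro always_eventually allI less_imp_le x(2))
    from LIMSEQ_subseq_LIMSEQ[OF this r] have S0: "(\<lambda>n. S (x (r n))) \<longlonglongrightarrow> 0" by (simp add: o_def)
    from tendsto_add[OF this l] have xl: "(\<lambda>n. x (r n)) \<longlonglongrightarrow> l" by (simp add: S_def)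
    from tendsto_norm[OF this] have "norm l = 1" by (simp add: x LIMSEQ_const_iff)
    moreover have "S l = 0"
      using LIMSEQ_unique[OF S.tendsto[OF xl] S0] .
    ultimately show False using inj[of l] by (auto simp: S_def)
  qed
  then obtain c where c: "c > 0" "\<And>x. c * norm x \<le> norm (S x)" by blast
  then show "\<exists>c>0. \<forall>x. c * norm x \<le> norm (x - T x)" by (auto simp: S_def)
  have S_inj: "x = y" if "S x = S y" for x y
    using c(2)[of "x - y"] c(1) that by (simp add: S.diff mult_le_0_iff)
  define Y where "Y n = (S ^^ n) ` UNIV" for n
  have Y_Suc: "Y (Suc n) = S ` Y n" for n by (simp add: Y_def image_image[symmetric])
  have Y_sub: "subspace (Y n)" for n
  proof (induction n)
    case (Suc n)
    show ?case unfolding Y_Suc by (rule linear_subspace_image[OF bounded_linear.linear[OF S] Suc])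
  qed (simp add: Y_def)
  have Y_complete: "complete (Y n)" for n
  proof (induction n)
    case 0 show ?case by (simp add: Y_def complete_UNIV)
  next
    case (Suc n)
    show ?case unfolding Y_Suc
      by (rule complete_isometric_image[OF c(1) Y_sub S _ Suc]) (use c(2) in auto)
  qed
  have Y_dec: "Y (Suc n) \<subseteq> Y n" for n
  proof (induction n)
    case (Suc n)
    show ?case using image_mono[OF Suc, of S] by (simp only: Y_Suc[symmetric])
  qed (simp add: Y_def)
  have Y_anti: "Y m \<subseteq> Y n" if "n \<le> m" for n m
    using that Y_dec by (rule lift_Suc_antimono_le[rotated])
  show "surj (\<lambda>x. x - T x)"
  proof (rule ccontr)
    assume "\<not> surj (\<lambda>x. x - T x)"
    then have ne0: "Y (Suc 0) \<noteq> Y 0" by (simp add: Y_def S_def[abs_def])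
    have ne: "Y (Suc n) \<noteq> Y n" for n
    proof (induction n)
      case (Suc n)
      show ?case
      proof
        assume eq: "Y (Suc (Suc n)) = Y (Suc n)"
        have "Y n \<subseteq> Y (Suc n)"
        proof
          fix y assume "y \<in> Y n"
          then have "S y \<in> S ` Y (Suc n)" using eq unfolding Y_Suc[of "Suc n"] Y_Suc[of n] by blast
          then show "y \<in> Y (Suc n)" using S_inj by blast
        qed
        then show False using Suc Y_dec by blast
      qed
    qed (rule ne0)
    have "\<exists>x. x \<in> Y n \<and> norm x = 1 \<and> (\<forall>y\<in>Y (Suc n). 1 / 2 \<le> norm (x - y))" for n
      by (rule Riesz_almost_orthogonal[OF Y_sub Y_sub complete_imp_closed[OF Y_complete] Y_dec ne]) blast
    then obtain x where x: "\<And>n. x n \<in> Y n" "\<And>n. norm (x n) = 1" "\<And>n y. y \<in> Y (Suc n) \<Longrightarrow> 1 / 2 \<le> norm (x n - y)"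
      by metis
    have sep: "1 / 2 \<le> norm (T (x n) - T (x m))" if "n < m" for n m
    proof -
      have SY: "S (x i) \<in> Y (Suc i)" for i unfolding Y_Suc by (rule imageI[OF x(1)])
      have "Y m \<subseteq> Y (Suc n)" "Y (Suc m) \<subseteq> Y (Suc n)" using that by (intro Y_anti, simp)+
      then have "x m \<in> Y (Suc n)" "S (x m) \<in> Y (Suc n)" "S (x n) \<in> Y (Suc n)"
        using x(1)[of m] SY by blast+
      \<comment> \<open>\<open>T (x n) - T (x m) = x n - (S (x n) + x m - S (x m))\<close>\<close>
      then have "S (x n) + x m - S (x m) \<in> Y (Suc n)" using Y_sub by (intro subspace_add subspace_diff)
      from x(3)[OF this] show ?thesis by (simp add: S_def algebra_simps)
    qed
    obtain r l where r: "strict_mono r" and l: "(\<lambda>n. T (x (r n))) \<longlonglongrightarrow> l"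
      using compact[of x] x(2) by auto
    obtain N where N: "\<And>n. n \<ge> N \<Longrightarrow> norm (T (x (r n)) - l) < 1 / 4"
      using LIMSEQ_D[OF l, of "1/4"] by auto
    have "norm (T (x (r N)) - T (x (r (Suc N)))) < 1 / 4 + 1 / 4"
      by (rule norm_diff_triangle_less[OF N[of N]]) (use N[of "Suc N"] norm_minus_commute[of l] in simp_all)
    moreover have "1 / 2 \<le> norm (T (x (r N)) - T (x (r (Suc N))))"
      by (rule sep) (use r in \<open>simp add: strict_mono_def\<close>)
    ultimately show False by simp
  qed
qed

section \<open>Convolution with a Lipschitz kernel on a bounded interval\<close>

text \<open>
  Continuous functions with the supremum norm form the Banach space to which the Riesz--Schauder theorem
  is applied.
\<close>

instance bcontfun :: (metric_space, banach) banach ..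

text \<open>
  Precomposition with this retraction onto \<open>[-t,t]\<close> represents continuous functions on the interval
  as bounded continuous functions on the line, without a separate type for the interval.
\<close>

definition clamp_to :: "real \<Rightarrow> real \<Rightarrow> real" where
  "clamp_to t x = max (- t) (min t x)"

lemma clamp_to_id: "- t \<le> x \<Longrightarrow> x \<le> t \<Longrightarrow> clamp_to t x = x"
  by (auto simp: clamp_to_def)

lemma clamp_to_mem: "t \<ge> 0 \<Longrightarrow> clamp_to t x \<in> {-t..t}"
  by (auto simp: clamp_to_def)

lemma integral_cutoff_le:
  assumes h: "h \<in> L2 lborel"
  shows "(\<integral>y. cmod (cutoff t h y) \<partial>lborel) \<le> L2_nrm lborel (indicator {-t..t}) * L2_nrm lborel h"
proof -
  have "(\<integral>y. cmod (cutoff t h y) \<partial>lborel) = (\<integral>y. cmod (indicator {-t..t} y) * cmod (cutoff t h y) \<partial>lborel)"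
    by (intro Bochner_Integration.integral_cong refl) (auto simp: cutoff_def split: split_indicator)
  also have "\<dots> \<le> L2_nrm lborel (indicator {-t..t}) * L2_nrm lborel (cutoff t h)"
    by (intro L2_Cauchy_Schwarz_integral indicator_interval_L2 cutoff_L2 h)
  also have "\<dots> \<le> L2_nrm lborel (indicator {-t..t}) * L2_nrm lborel h"
    by (intro mult_left_mono L2_nrm_cutoff_le h) simp
  finally show ?thesis .
qed

lemma cutoff_bounded_L2:
  assumes "w \<in> borel_measurable borel" and b: "\<And>x. cmod (w x) \<le> C" and C: "0 \<le> C"
  shows "cutoff t w \<in> L2 lborel" "L2_nrm lborel (cutoff t w) \<le> C * L2_nrm lborel (indicator {-t..t})"
proof -
  let ?g = "\<lambda>x. complex_of_real C * indicator {-t..t} x"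
  have g: "?g \<in> L2 lborel" by (intro L2_scale indicator_interval_L2)
  have m: "cutoff t w \<in> borel_measurable lborel" using cutoff_measurable[OF assms(1)] by simp
  have le: "AE x in lborel. cmod (cutoff t w x) \<le> cmod (?g x)"
    using b C by (intro AE_I2) (auto simp: cutoff_def norm_mult split: split_indicator)
  show "cutoff t w \<in> L2 lborel" by (rule L2_bounded_by[OF g m le])
  show "L2_nrm lborel (cutoff t w) \<le> C * L2_nrm lborel (indicator {-t..t})"
    using L2_nrm_mono[OF g m le] C by (simp add: L2_nrm_scale)
qed

text \<open>
  The only properties of the sinc kernel that enter the Fredholm theory. Boundedness and the Lipschitz
  condition hold with global constants, which makes all estimates depend on the \<open>L\<^sup>1\<close> norm alone.
\<close>

locale lipschitz_kernel =
  fixes k :: "real \<Rightarrow> real" and B L :: real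
  assumes k_bound: "\<bar>k s\<bar> \<le> B" and k_lipschitz: "\<bar>k s - k s'\<bar> \<le> L * \<bar>s - s'\<bar>"
begin

definition conv_integral :: "(real \<Rightarrow> complex) \<Rightarrow> real \<Rightarrow> complex" where
  "conv_integral g x = (\<integral>y. complex_of_real (k (x - y)) * g y \<partial>lborel)"

lemma B_nonneg: "0 \<le> B" using k_bound[of 0] by linarith

lemma L_nonneg: "0 \<le> L" using k_lipschitz[of 1 0] by simp

lemma k_continuous: "continuous_on UNIV k"
proof (rule lipschitz_on_continuous_on)
  show "L-lipschitz_on UNIV k"
    by (rule lipschitz_onI) (use k_lipschitz L_nonneg in \<open>auto simp: dist_real_def\<close>)
qed

lemma k_measurable [measurable]: "k \<in> borel_measurable borel"
  by (rule borel_measurable_continuous_onI[OF k_continuous])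

lemma conv_integrable:
  assumes g: "integrable lborel g"
  shows "integrable lborel (\<lambda>y. complex_of_real (k (x - y)) * g y)"
proof (rule Bochner_Integration.integrable_bound)
  have [measurable]: "g \<in> borel_measurable borel" using g by auto
  show "(\<lambda>y. complex_of_real (k (x - y)) * g y) \<in> borel_measurable lborel" by measurable
  show "integrable lborel (\<lambda>y. B * cmod (g y))" using g by simp
  show "AE y in lborel. norm (complex_of_real (k (x - y)) * g y) \<le> norm (B * cmod (g y))"
    by (intro AE_I2) (simp add: norm_mult abs_mult B_nonneg mult_right_mono k_bound)
qed

lemma conv_integral_lincomb:
  assumes "integrable lborel f" "integrable lborel g"
  shows "conv_integral (\<lambda>y. a * f y + b * g y) x = a * conv_integral f x + b * conv_integral g x"
proof -
  have "conv_integral (\<lambda>y. a * f y + b * g y) x =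
     (\<integral>y. a * (complex_of_real (k (x - y)) * f y) + b * (complex_of_real (k (x - y)) * g y) \<partial>lborel)"
    by (simp add: conv_integral_def algebra_simps)
  then show ?thesis
    using conv_integrable[OF assms(1)] conv_integrable[OF assms(2)] by (simp add: conv_integral_def)
qed

lemma conv_integral_bound:
  assumes g: "integrable lborel g"
  shows "cmod (conv_integral g x) \<le> B * (\<integral>y. cmod (g y) \<partial>lborel)"
proof -
  have "cmod (conv_integral g x) \<le> (\<integral>y. B * cmod (g y) \<partial>lborel)"
    unfolding conv_integral_def
    by (rule Bochner_Integration.integral_norm_bound_integral)
      (use g conv_integrable[OF g] in \<open>simp_all add: norm_mult mult_right_mono k_bound\<close>)
  then show ?thesis by simp
qed

lemma conv_integral_lipschitz:
  assumes g: "integrable lborel g"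
  shows "cmod (conv_integral g x - conv_integral g x') \<le> L * (\<integral>y. cmod (g y) \<partial>lborel) * \<bar>x - x'\<bar>"
proof -
  let ?d = "\<lambda>y. complex_of_real (k (x - y)) * g y - complex_of_real (k (x' - y)) * g y"
  have "conv_integral g x - conv_integral g x' = (\<integral>y. ?d y \<partial>lborel)"
    unfolding conv_integral_def using conv_integrable[OF g] by simp
  also have "cmod \<dots> \<le> (\<integral>y. L * \<bar>x - x'\<bar> * cmod (g y) \<partial>lborel)"
  proof (rule Bochner_Integration.integral_norm_bound_integral)
    fix y
    have "cmod (?d y) = \<bar>k (x - y) - k (x' - y)\<bar> * cmod (g y)"
      by (simp flip: left_diff_distrib of_real_diff add: norm_mult)
    also have "\<dots> \<le> L * \<bar>x - x'\<bar> * cmod (g y)"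
      using k_lipschitz[of "x - y" "x' - y"] by (intro mult_right_mono) simp_all
    finally show "cmod (?d y) \<le> L * \<bar>x - x'\<bar> * cmod (g y)" .
  qed (use g conv_integrable[OF g] in simp_all)
  finally show ?thesis by (simp add: mult_ac)
qed

lemma conv_integral_continuous:
  assumes g: "integrable lborel g" shows "continuous_on UNIV (conv_integral g)"
proof (rule lipschitz_on_continuous_on)
  show "(L * (\<integral>y. cmod (g y) \<partial>lborel))-lipschitz_on UNIV (conv_integral g)"
    by (rule lipschitz_onI) (use conv_integral_lipschitz[OF g] L_nonneg in \<open>auto simp: dist_real_def dist_norm\<close>)
qed

lemma conv_integral_cong_AE:
  assumes "f \<in> borel_measurable borel" "g \<in> borel_measurable borel" "AE x in lborel. f x = g x"
  shows "conv_integral f = conv_integral g"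
proof
  have [measurable]: "f \<in> borel_measurable borel" "g \<in> borel_measurable borel" by fact+
  show "conv_integral f x = conv_integral g x" for x
    unfolding conv_integral_def using assms(3) by (intro integral_cong_AE) auto
qed

definition clamped_conv :: "real \<Rightarrow> (real \<Rightarrow> complex) \<Rightarrow> real \<Rightarrow>\<^sub>C complex" where
  "clamped_conv t g = Bcontfun (\<lambda>x. conv_integral g (clamp_to t x))"

lemma continuous_clamp_to: "continuous_on A (clamp_to t)"
  unfolding clamp_to_def[abs_def] by (intro continuous_intros)

lemma apply_clamped_conv:
  assumes g: "integrable lborel g"
  shows "apply_bcontfun (clamped_conv t g) x = conv_integral g (clamp_to t x)"
proof -
  have "continuous_on UNIV (\<lambda>x. conv_integral g (clamp_to t x))"
    by (rule continuous_on_compose2[OF conv_integral_continuous[OF g] continuous_clamp_to]) simp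
  then have "(\<lambda>x. conv_integral g (clamp_to t x)) \<in> bcontfun"
    by (rule bcontfun_normI) (rule conv_integral_bound[OF g])
  then show ?thesis by (simp add: clamped_conv_def Bcontfun_inverse)
qed

lemma norm_clamped_conv:
  assumes g: "integrable lborel g"
  shows "norm (clamped_conv t g) \<le> B * (\<integral>y. cmod (g y) \<partial>lborel)"
  by (rule norm_bound) (simp add: apply_clamped_conv[OF g] conv_integral_bound[OF g])

lemma clamped_conv_lincomb:
  assumes "integrable lborel f" "integrable lborel g"
  shows "clamped_conv t (\<lambda>y. complex_of_real a * f y + complex_of_real b * g y) = a *\<^sub>R clamped_conv t f + b *\<^sub>R clamped_conv t g"
proof (rule bcontfun_eqI)
  have i: "integrable lborel (\<lambda>y. complex_of_real a * f y + complex_of_real b * g y)" using assms by simp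
  show "apply_bcontfun (clamped_conv t (\<lambda>y. complex_of_real a * f y + complex_of_real b * g y)) x = apply_bcontfun (a *\<^sub>R clamped_conv t f + b *\<^sub>R clamped_conv t g) x" for x
    by (simp add: apply_clamped_conv[OF i] apply_clamped_conv assms conv_integral_lincomb scaleR_conv_of_real)
qed

lemma cutoff_bcontfun:
  fixes W :: "real \<Rightarrow>\<^sub>C complex"
  shows "cutoff t W \<in> L2 lborel" "integrable lborel (cutoff t W)"
    "L2_nrm lborel (cutoff t W) \<le> norm W * L2_nrm lborel (indicator {-t..t})"
    "(\<integral>y. cmod (cutoff t W y) \<partial>lborel) \<le> (L2_nrm lborel (indicator {-t..t}))\<^sup>2 * norm W"
proof -
  let ?I = "L2_nrm lborel (indicator {-t..t})"
  have m: "apply_bcontfun W \<in> borel_measurable borel"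
    by (intro borel_measurable_continuous_onI) simp
  show W: "cutoff t W \<in> L2 lborel" and n: "L2_nrm lborel (cutoff t W) \<le> norm W * ?I"
    by (rule cutoff_bounded_L2[OF m norm_bounded norm_ge_zero])+
  show "integrable lborel (cutoff t W)"
    using cutoff_integrable[OF W, of t] by simp
  have "(\<integral>y. cmod (cutoff t W y) \<partial>lborel) \<le> ?I * L2_nrm lborel (cutoff t W)"
    using integral_cutoff_le[OF W, of t] by simp
  also have "\<dots> \<le> ?I * (norm W * ?I)" by (intro mult_left_mono n) simp
  finally show "(\<integral>y. cmod (cutoff t W y) \<partial>lborel) \<le> ?I\<^sup>2 * norm W"
    by (simp add: power2_eq_square mult_ac)
qed

text \<open>
  The convolutions are bounded and equicontinuous with constants that depend only on \<open>C\<close>, so the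
  Arzela--Ascoli theorem applies on \<open>[-t,t]\<close>. Clamping makes uniform convergence on that interval
  the same as convergence in the norm.
\<close>

lemma clamped_conv_compact:
  assumes t: "t \<ge> 0" and g: "\<And>n. integrable lborel (g n)" and C: "\<And>n. (\<integral>y. cmod (g n y) \<partial>lborel) \<le> C"
  shows "\<exists>r l. strict_mono (r :: nat \<Rightarrow> nat) \<and> (\<lambda>n. clamped_conv t (g (r n))) \<longlonglongrightarrow> l"
proof -
  have C0: "0 \<le> C" using C[of 0] by (rule order_trans[rotated]) simp
  obtain G r where G: "continuous_on {-t..t} G" and r: "strict_mono (r :: nat \<Rightarrow> nat)"
    and lim: "\<And>e. 0 < e \<Longrightarrow> \<exists>N. \<forall>n x. n \<ge> N \<and> x \<in> {-t..t} \<longrightarrow> norm (conv_integral (g (r n)) x - G x) < e"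
  proof (rule Arzela_Ascoli[of "{-t..t}" "\<lambda>n. conv_integral (g n)" "B * C"])
    show "norm (conv_integral (g n) x) \<le> B * C" for n x
      using conv_integral_bound[OF g, of n x] mult_left_mono[OF C B_nonneg, of n] by linarith
    show "\<exists>d>0. \<forall>n y. y \<in> {-t..t} \<and> norm (x - y) < d \<longrightarrow> norm (conv_integral (g n) x - conv_integral (g n) y) < e"
      if "0 < e" for x e
    proof (intro exI[of _ "e / (L * C + 1)"] conjI allI impI)
      have pos: "0 < L * C + 1" using L_nonneg C0 by (simp add: add_nonneg_pos)
      then show "0 < e / (L * C + 1)" using that by simp
      fix n y assume "y \<in> {-t..t} \<and> norm (x - y) < e / (L * C + 1)"
      then have y: "\<bar>x - y\<bar> * (L * C + 1) < e" using pos by (simp add: field_simps)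
      have "norm (conv_integral (g n) x - conv_integral (g n) y) \<le> L * (\<integral>y. cmod (g n y) \<partial>lborel) * \<bar>x - y\<bar>"
        by (rule conv_integral_lipschitz[OF g])
      also have "\<dots> \<le> (L * C) * \<bar>x - y\<bar>"
        by (intro mult_right_mono mult_left_mono C L_nonneg) simp
      also have "\<dots> \<le> \<bar>x - y\<bar> * (L * C + 1)" by (simp add: algebra_simps)
      finally show "norm (conv_integral (g n) x - conv_integral (g n) y) < e" using y by simp
    qed
  qed auto
  define l where "l = Bcontfun (\<lambda>x. G (clamp_to t x))"
  have contG: "continuous_on UNIV (\<lambda>x. G (clamp_to t x))"
    by (rule continuous_on_compose2[OF G continuous_clamp_to]) (use clamp_to_mem[OF t] in auto)
  have "compact (G ` {-t..t})" by (rule compact_continuous_image[OF G]) simp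
  then obtain b where "\<And>x. x \<in> {-t..t} \<Longrightarrow> norm (G x) \<le> b"
    by (meson bounded_iff compact_imp_bounded imageI)
  then have "(\<lambda>x. G (clamp_to t x)) \<in> bcontfun"
    using clamp_to_mem[OF t] by (intro bcontfun_normI[OF contG]) blast
  then have l: "apply_bcontfun l x = G (clamp_to t x)" for x
    by (simp add: l_def Bcontfun_inverse)
  have "(\<lambda>n. clamped_conv t (g (r n))) \<longlonglongrightarrow> l"
  proof (rule LIMSEQ_I)
    fix e :: real assume "e > 0"
    then obtain N where N: "\<And>n x. n \<ge> N \<Longrightarrow> x \<in> {-t..t} \<Longrightarrow> norm (conv_integral (g (r n)) x - G x) < e / 2"
      using lim[of "e / 2"] by auto
    have "norm (clamped_conv t (g (r n)) - l) \<le> e / 2" if "n \<ge> N" for n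
      by (rule norm_bound) (use N[OF that clamp_to_mem[OF t]] in \<open>simp add: apply_clamped_conv[OF g] l less_imp_le\<close>)
    then show "\<exists>N. \<forall>n\<ge>N. norm (clamped_conv t (g (r n)) - l) < e"
      using \<open>e > 0\<close> by (intro exI[of _ N]) force
  qed
  with r show ?thesis by blast
qed



text \<open>
  Let \<open>A u\<close> be the convolution of \<open>cutoff t u\<close> with the kernel. An equation \<open>A u - m u = h\<close> on the
  interval is equivalent to \<open>W - A W / m = - A h / m\<^sup>2\<close> for the continuous function
  \<open>W = A u / m\<close>, together with \<open>u = W - h / m\<close>. The operator \<open>A / m\<close> is compact on bounded
  continuous functions, and a fixed point of it is an eigenfunction of \<open>A\<close> for \<open>m\<close>. So \<open>1 - A / m\<close> is
  bounded below and surjective, and both properties carry over to \<open>A - m\<close> on square-integrable functions.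
\<close>

lemma Fredholm_alternative:
  assumes t: "t \<ge> 0" and m: "m \<noteq> 0"
    and noev: "\<And>\<phi>. \<phi> \<in> L2 lborel \<Longrightarrow> (\<And>x. x \<in> {-t<..<t} \<Longrightarrow> conv_integral (cutoff t \<phi>) x = m * \<phi> x) \<Longrightarrow>
        (AE x in lborel. cutoff t \<phi> x = 0)"
  shows "\<exists>C\<ge>0. \<forall>u\<in>L2 lborel. L2_nrm lborel (cutoff t u) \<le> C * L2_nrm lborel (cutoff t (\<lambda>x. conv_integral (cutoff t u) x - m * u x))"
    and "\<And>h. h \<in> L2 lborel \<Longrightarrow> \<exists>u\<in>L2 lborel. \<forall>x. cutoff t (\<lambda>x. conv_integral (cutoff t u) x - m * u x) x = cutoff t h x"
proof -
  let ?I = "L2_nrm lborel (indicator {-t..t})"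
  let ?D = "\<lambda>u. \<lambda>x. conv_integral (cutoff t u) x - m * u x"
  let ?b = "B / (cmod m)\<^sup>2 * ?I"
  define T where "T W = clamped_conv t (\<lambda>y. cutoff t (apply_bcontfun W) y / m)" for W
  have ci: "integrable lborel (\<lambda>y. cutoff t (apply_bcontfun W) y / m)" for W
    using cutoff_bcontfun(2) by simp
  have T: "bounded_linear T"
  proof (rule bounded_linear_intro)
    show "T (V + W) = T V + T W" for V W
    proof -
      have "(\<lambda>y. cutoff t (apply_bcontfun (V + W)) y / m) = (\<lambda>y. complex_of_real 1 * (cutoff t V y / m) + complex_of_real 1 * (cutoff t W y / m))"
        by (auto simp: cutoff_def algebra_simps add_divide_distrib)
      then show ?thesis unfolding T_def by (simp only: clamped_conv_lincomb[OF ci ci]) simp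
    qed
    show "T (a *\<^sub>R W) = a *\<^sub>R T W" for a W
    proof -
      have "(\<lambda>y. cutoff t (apply_bcontfun (a *\<^sub>R W)) y / m) = (\<lambda>y. complex_of_real a * (cutoff t W y / m) + complex_of_real 0 * (cutoff t W y / m))"
        by (auto simp: cutoff_def scaleR_conv_of_real)
      then show ?thesis unfolding T_def by (simp only: clamped_conv_lincomb[OF ci ci]) simp
    qed
    show "norm (T W) \<le> norm W * (B * ?I\<^sup>2 / cmod m)" for W
    proof -
      have "norm (T W) \<le> B * (\<integral>y. cmod (cutoff t W y / m) \<partial>lborel)" unfolding T_def by (rule norm_clamped_conv[OF ci])
      also have "\<dots> = B / cmod m * (\<integral>y. cmod (cutoff t W y) \<partial>lborel)" by (simp add: norm_divide)
      also have "\<dots> \<le> B / cmod m * (?I\<^sup>2 * norm W)"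
        by (intro mult_left_mono cutoff_bcontfun) (simp add: B_nonneg)
      finally show ?thesis by (simp add: mult_ac)
    qed
  qed
  have compact: "\<exists>r l. strict_mono (r :: nat \<Rightarrow> nat) \<and> (\<lambda>n. T (W (r n))) \<longlonglongrightarrow> l" if "\<And>n. norm (W n) \<le> 1" for W
    unfolding T_def
  proof (rule clamped_conv_compact[OF t ci])
    fix n
    have "(\<integral>y. cmod (cutoff t (W n) y / m) \<partial>lborel) = (\<integral>y. cmod (cutoff t (W n) y) \<partial>lborel) / cmod m" by (simp add: norm_divide)
    also have "\<dots> \<le> ?I\<^sup>2 * norm (W n) / cmod m" by (intro divide_right_mono cutoff_bcontfun) simp
    also have "\<dots> \<le> ?I\<^sup>2 * 1 / cmod m" by (intro divide_right_mono mult_left_mono that) simp_all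
    finally show "(\<integral>y. cmod (cutoff t (W n) y / m) \<partial>lborel) \<le> ?I\<^sup>2 / cmod m" by simp
  qed
  have conv_div: "conv_integral (\<lambda>y. g y / m) x = conv_integral g x / m" if "integrable lborel g" for g x
    using conv_integral_lincomb[OF that that, of "1/m" 0] by simp
  have inj: "W = 0" if W: "T W = W" for W
  proof -
    have Wx: "W x = conv_integral (cutoff t W) (clamp_to t x) / m" for x
      using arg_cong[OF W, of "\<lambda>V. apply_bcontfun V x"]
      by (simp add: T_def apply_clamped_conv[OF ci] conv_div cutoff_bcontfun)
    have "AE x in lborel. cutoff t (cutoff t W) x = 0"
    proof (rule noev[OF cutoff_bcontfun(1)])
      fix x assume x: "x \<in> {-t<..<t}"
      then have "cutoff t W x = W x" by (simp add: cutoff_def)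
      also have "\<dots> = conv_integral (cutoff t W) x / m"
        using x by (subst Wx) (simp add: clamp_to_id)
      finally show "conv_integral (cutoff t (cutoff t W)) x = m * cutoff t W x"
        using m by simp
    qed
    then have *: "conv_integral (cutoff t W) = conv_integral (\<lambda>x. 0)"
      using L2_measurable[OF cutoff_bcontfun(1)[of t W]] by (intro conv_integral_cong_AE) auto
    have "W x = 0" for x by (subst Wx, subst *) (simp add: conv_integral_def)
    then show ?thesis by (intro bcontfun_eqI) simp
  qed
  have "\<exists>c>0. \<forall>W. c * norm W \<le> norm (W - T W)"
    by (rule Riesz_Schauder(1)[OF T]) (use compact inj in blast)+
  then obtain c where c: "c > 0" "\<And>W. c * norm W \<le> norm (W - T W)" by blast
  have surj: "surj (\<lambda>W. W - T W)"
    by (rule Riesz_Schauder(2)[OF T]) (use compact inj in blast)+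
  define K where "K h = clamped_conv t (\<lambda>y. cutoff t h y / m\<^sup>2)" for h
  have Ki: "integrable lborel (\<lambda>y. cutoff t h y / m\<^sup>2)" if "h \<in> L2 lborel" for h
    using cutoff_integrable[OF that] by simp
  have normK: "norm (K h) \<le> ?b * L2_nrm lborel h" if h: "h \<in> L2 lborel" for h
  proof -
    have "norm (K h) \<le> B * (\<integral>y. cmod (cutoff t h y / m\<^sup>2) \<partial>lborel)" unfolding K_def by (rule norm_clamped_conv[OF Ki[OF h]])
    also have "\<dots> = B / (cmod m)\<^sup>2 * (\<integral>y. cmod (cutoff t h y) \<partial>lborel)" by (simp add: norm_divide norm_power)
    also have "\<dots> \<le> B / (cmod m)\<^sup>2 * (?I * L2_nrm lborel h)"
      by (intro mult_left_mono integral_cutoff_le h) (simp add: B_nonneg)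
    finally show ?thesis by (simp add: mult_ac)
  qed
  show "\<exists>C\<ge>0. \<forall>u\<in>L2 lborel. L2_nrm lborel (cutoff t u) \<le> C * L2_nrm lborel (cutoff t (?D u))"
  proof (intro exI[of _ "?b / c * ?I + 1 / cmod m"] conjI ballI)
    show "0 \<le> ?b / c * ?I + 1 / cmod m" using c B_nonneg by simp
    fix u :: "real \<Rightarrow> complex" assume u: "u \<in> L2 lborel"
    \<comment> \<open>The convolution of \<open>u\<close>, divided by \<open>m\<close>; on the interval \<open>u = W - h / m\<close>.\<close>
    define W where "W = clamped_conv t (\<lambda>y. cutoff t u y / m)"
    define h where "h = cutoff t (?D u)"
    have ui: "integrable lborel (cutoff t u)" by (rule cutoff_integrable[OF u])
    have Wx: "W x = conv_integral (cutoff t u) (clamp_to t x) / m" for x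
      using ui by (simp add: W_def apply_clamped_conv conv_div)
    have hx: "h x = m * m * (cutoff t W x / m) - m * cutoff t u x" for x
      using m by (auto simp: h_def Wx cutoff_def clamp_to_id split: split_indicator)
    have h: "h \<in> L2 lborel"
      unfolding hx[abs_def] using L2_lincomb[OF cutoff_bcontfun(1)[of t W] cutoff_L2[OF u, of t], of m "-m"] m by simp
    have ch: "cutoff t h = h" by (simp add: h_def)
    have alg: "(m * a + (- m) * b) / m\<^sup>2 = (a - b) / m" for a b
    proof -
      have "m * a + (- m) * b = m * (a - b)" by (simp add: algebra_simps)
      then show ?thesis by (simp add: power2_eq_square)
    qed
    have "W - T W = - K h"
    proof (rule bcontfun_eqI)
      fix x
      have "h = (\<lambda>y. m * cutoff t W y + (- m) * cutoff t u y)" using m by (auto simp: hx)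
      then have ch_conv: "conv_integral h x = m * conv_integral (cutoff t W) x + (- m) * conv_integral (cutoff t u) x" for x
        by (simp only: conv_integral_lincomb[OF cutoff_bcontfun(2) ui])
      have "T W x = conv_integral (cutoff t W) (clamp_to t x) / m"
        by (simp add: T_def apply_clamped_conv[OF ci] conv_div cutoff_bcontfun)
      moreover have "K h x = conv_integral h (clamp_to t x) / m\<^sup>2"
        using conv_integral_lincomb[of h h "1 / m\<^sup>2" 0 "clamp_to t x"] cutoff_integrable[OF h, of t] Ki[OF h]
        by (simp add: K_def ch apply_clamped_conv)
      then have "K h x = (conv_integral (cutoff t W) (clamp_to t x) - conv_integral (cutoff t u) (clamp_to t x)) / m"
        unfolding ch_conv alg .
      ultimately show "apply_bcontfun (W - T W) x = apply_bcontfun (- K h) x"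
        by (simp add: Wx diff_divide_distrib)
    qed
    then have "c * norm W \<le> ?b * L2_nrm lborel h"
      using c(2)[of W] normK[OF h] by simp
    then have nW: "norm W \<le> ?b * L2_nrm lborel h / c"
      by (simp only: pos_le_divide_eq[OF c(1)] mult.commute[of "norm W" c])
    have u_eq: "cutoff t u = (\<lambda>x. cutoff t W x - 1 / m * h x)"
      using m by (auto simp: hx field_simps)
    have "L2_nrm lborel (cutoff t u) \<le> L2_nrm lborel (cutoff t W) + L2_nrm lborel (\<lambda>x. 1 / m * h x)"
      unfolding u_eq by (intro L2_nrm_triangle_diff cutoff_bcontfun L2_scale h)
    also have "L2_nrm lborel (\<lambda>x. 1 / m * h x) = 1 / cmod m * L2_nrm lborel h"
      by (subst L2_nrm_scale) (simp add: norm_divide)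
    also have "L2_nrm lborel (cutoff t W) \<le> ?b * L2_nrm lborel h / c * ?I"
      by (intro order_trans[OF cutoff_bcontfun(3)] mult_right_mono nW) simp
    finally show "L2_nrm lborel (cutoff t u) \<le> (?b / c * ?I + 1 / cmod m) * L2_nrm lborel (cutoff t (?D u))"
      by (simp add: h_def algebra_simps)
  qed
  show "\<exists>u\<in>L2 lborel. \<forall>x. cutoff t (?D u) x = cutoff t h x"
    if h: "h \<in> L2 lborel" for h
  proof -
    obtain W where W: "W - T W = - K h" using surj by (metis surjD)
    \<comment> \<open>The form as a linear combination fits the linearity lemmas.\<close>
    define u where "u = (\<lambda>x. 1 * cutoff t W x + (- 1 / m) * cutoff t h x)"
    have u: "u \<in> L2 lborel" unfolding u_def by (intro L2_lincomb cutoff_bcontfun cutoff_L2 h)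
    have cu: "cutoff t u = u" by (auto simp: u_def cutoff_def split: split_indicator)
    have hi: "integrable lborel (cutoff t h)" by (rule cutoff_integrable[OF h])
    have Cu: "conv_integral u x = conv_integral (cutoff t W) x - conv_integral (cutoff t h) x / m" for x
      unfolding u_def by (subst conv_integral_lincomb) (simp_all add: cutoff_bcontfun hi)
    have Wx: "W x = conv_integral u (clamp_to t x) / m" for x
    proof -
      have "W x = T W x - K h x"
        using arg_cong[OF W, of "\<lambda>V. apply_bcontfun V x"] by (simp add: algebra_simps)
      also have "T W x = conv_integral (cutoff t W) (clamp_to t x) / m"
        by (simp add: T_def apply_clamped_conv[OF ci] conv_div cutoff_bcontfun)
      also have "K h x = conv_integral (cutoff t h) (clamp_to t x) / m\<^sup>2"
        using conv_integral_lincomb[of "cutoff t h" "cutoff t h" "1 / m\<^sup>2" 0 "clamp_to t x"] hi Ki[OF h]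
        by (simp add: K_def apply_clamped_conv)
      finally show ?thesis
        using m by (simp add: Cu power2_eq_square field_simps)
    qed
    have "cutoff t (?D u) x = cutoff t h x" for x
    proof (cases "x \<in> {-t<..<t}")
      case True
      then have "u x = W x - h x / m" by (simp add: u_def cutoff_def)
      then have "conv_integral u x - m * u x = h x"
        using True m by (simp add: Wx clamp_to_id field_simps)
      with True show ?thesis unfolding cu by (simp add: cutoff_def)
    qed (simp add: cutoff_def)
    with u show ?thesis by blast
  qed
qed

end

section \<open>Eigenvalues of the sinc operator\<close>

lemma cmod_cis_diff_le: "cmod (cis a - cis b) \<le> \<bar>a - b\<bar>"
proof -
  have "cis a - cis b = cis b * (cis (a - b) - 1)"
    by (simp add: right_diff_distrib cis_mult)
  then have "cmod (cis a - cis b) = cmod (cis (a - b) - 1)"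
    by (simp add: norm_mult)
  also have "\<dots> \<le> \<bar>a - b\<bar>"
    using iexp_approx1[of "a - b" 0] by (simp add: cis_conv_exp)
  finally show ?thesis .
qed

lemma integrable_indicator_cis: "integrable lborel (\<lambda>\<xi>. indicator {-w<..<w} \<xi> * cis (\<xi> * s))"
proof (rule Bochner_Integration.integrable_bound)
  show "integrable lborel (indicator {-w..w} :: real \<Rightarrow> complex)" by (rule indicator_interval_L2)
  show "(\<lambda>\<xi>. indicator {-w<..<w} \<xi> * cis (\<xi> * s)) \<in> borel_measurable lborel" by measurable
  show "AE \<xi> in lborel. cmod (indicator {-w<..<w} \<xi> * cis (\<xi> * s)) \<le> cmod (indicator {-w..w} \<xi>)"
    by (intro AE_I2) (simp add: norm_mult indicator_def)
qed

lemma integral_indicator_symmetric_interval: "w > 0 \<Longrightarrow> (\<integral>\<xi>. indicator {-w<..<w::real} \<xi> \<partial>lborel) = 2 * w"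
  by (subst Bochner_Integration.integral_indicator) (simp_all del: measure_lborel_Ioo, subst measure_lborel_Ioo, simp_all)

lemma integral_indicator_unit: "(\<integral>x. indicator {-1..1::real} x \<partial>lborel) = (2::real)"
proof -
  have "(\<integral>x. indicator {-1..1::real} x \<partial>lborel) = measure lborel {-1..1::real}"
    by (simp only: Bochner_Integration.integral_indicator space_lborel space_borel Int_UNIV_right)
  then show ?thesis by simp
qed

text \<open>
  The kernel is the integral of \<open>cis (\<xi> * s) / (2 * pi)\<close> over \<open>(-w,w)\<close>; the integrand has
  constant modulus, and it is Lipschitz continuous in \<open>s\<close> with constant \<open>w / (2 * pi)\<close>.
\<close>

lemma lipschitz_sinc_kernel:
  assumes w: "w > 0"
  shows "lipschitz_kernel (sinc_kernel w) (w / pi) (w\<^sup>2 / pi)"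
proof
  fix s s' :: real
  let ?i = "\<lambda>s \<xi>. indicator {-w<..<w} \<xi> * cis (\<xi> * s)"
  let ?I = "\<lambda>s. \<integral>\<xi>. ?i s \<xi> \<partial>lborel"
  have ind: "integrable lborel (indicator {-w<..<w} :: real \<Rightarrow> real)"
    using w by (simp add: integrable_indicator_iff)
  have "2 * pi * \<bar>sinc_kernel w s\<bar> = cmod (?I s)"
    unfolding integral_cis_interval[OF w] norm_of_real by (simp add: abs_mult)
  also have "\<dots> \<le> (\<integral>\<xi>. indicator {-w<..<w} \<xi> \<partial>lborel)"
    by (rule Bochner_Integration.integral_norm_bound_integral[OF integrable_indicator_cis ind])
      (auto simp: norm_mult split: split_indicator)
  also have "\<dots> = 2 * w" by (rule integral_indicator_symmetric_interval[OF w])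
  finally show "\<bar>sinc_kernel w s\<bar> \<le> w / pi"
    using pi_gt_zero by (simp add: field_simps)
  have "2 * pi * \<bar>sinc_kernel w s - sinc_kernel w s'\<bar> = cmod (?I s - ?I s')"
    unfolding integral_cis_interval[OF w] of_real_diff[symmetric] norm_of_real right_diff_distrib[symmetric]
    by (simp add: abs_mult)
  also have "?I s - ?I s' = (\<integral>\<xi>. ?i s \<xi> - ?i s' \<xi> \<partial>lborel)"
    by (rule Bochner_Integration.integral_diff[symmetric]) (rule integrable_indicator_cis)+
  also have "cmod \<dots> \<le> (\<integral>\<xi>. w * \<bar>s - s'\<bar> * indicator {-w<..<w} \<xi> \<partial>lborel)"
  proof (rule Bochner_Integration.integral_norm_bound_integral)
    fix \<xi> :: real
    have "cmod (cis (\<xi> * s) - cis (\<xi> * s')) \<le> w * \<bar>s - s'\<bar>" if "\<bar>\<xi>\<bar> < w"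
    proof -
      have "cmod (cis (\<xi> * s) - cis (\<xi> * s')) \<le> \<bar>\<xi> * s - \<xi> * s'\<bar>" by (rule cmod_cis_diff_le)
      also have "\<dots> = \<bar>\<xi>\<bar> * \<bar>s - s'\<bar>" by (simp only: right_diff_distrib[symmetric] abs_mult)
      also have "\<dots> \<le> w * \<bar>s - s'\<bar>" using that by (intro mult_right_mono) auto
      finally show ?thesis .
    qed
    then show "cmod (?i s \<xi> - ?i s' \<xi>) \<le> w * \<bar>s - s'\<bar> * indicator {-w<..<w} \<xi>"
      by (auto split: split_indicator)
    show "integrable lborel (\<lambda>\<xi>. ?i s \<xi> - ?i s' \<xi>)"
      by (intro Bochner_Integration.integrable_diff integrable_indicator_cis)
    show "integrable lborel (\<lambda>\<xi>. w * \<bar>s - s'\<bar> * indicator {-w<..<w} \<xi>)"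
      by (rule integrable_mult_right[OF ind])
  qed
  also have "\<dots> = w * \<bar>s - s'\<bar> * (2 * w)"
    using integral_indicator_symmetric_interval[OF w] by simp
  finally show "\<bar>sinc_kernel w s - sinc_kernel w s'\<bar> \<le> w\<^sup>2 / pi * \<bar>s - s'\<bar>"
    using pi_gt_zero by (simp add: field_simps power2_eq_square)
qed

text \<open>
  The locale assumptions hold for the sinc kernel only if \<open>w > 0\<close>, so the convolution is named outside
  of any interpretation.
\<close>

definition sinc_conv :: "real \<Rightarrow> (real \<Rightarrow> complex) \<Rightarrow> real \<Rightarrow> complex" where
  "sinc_conv w = lipschitz_kernel.conv_integral (sinc_kernel w)"

lemma sinc_conv_eq:
  assumes "w > 0"
  shows "sinc_conv w g x = (\<integral>y. complex_of_real (sinc_kernel w (x - y)) * g y \<partial>lborel)"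
  unfolding sinc_conv_def by (rule lipschitz_kernel.conv_integral_def[OF lipschitz_sinc_kernel[OF assms]])

lemma sinc_conv_measurable:
  assumes "w > 0" "integrable lborel g" shows "sinc_conv w g \<in> borel_measurable borel"
  unfolding sinc_conv_def
  by (intro borel_measurable_continuous_onI lipschitz_kernel.conv_integral_continuous[OF lipschitz_sinc_kernel] assms)

text \<open>
  On the frequency side the operator is multiplication by an indicator. Symmetry and positivity can be
  read off from this form.
\<close>

lemma sinc_conv_inner:
  assumes w: "w > 0" and f: "integrable lborel f" and f2: "f \<in> L2 lborel" and g: "integrable lborel g"
  shows "L2_inner lborel (sinc_conv w f) g = L2_inner lborel (cutoff w (\<lambda>\<xi>. fourier_integral f (- \<xi>))) (\<lambda>\<xi>. fourier_integral g (- \<xi>))"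
proof -
  let ?h = "cutoff w (\<lambda>\<xi>. fourier_integral f (- \<xi>))"
  have h: "integrable lborel ?h"
    by (intro cutoff_integrable L2_reflect(1) fourier_integral_L2 f f2)
  have "sinc_conv w f = fourier_integral ?h"
    by (rule ext) (simp add: sinc_conv_eq[OF w] fourier_integral_cutoff_reflect[OF w f])
  then show ?thesis by (simp add: fourier_integral_adjoint[OF h g])
qed

lemma sinc_conv_selfadjoint:
  assumes w: "w > 0" and f: "integrable lborel f" "f \<in> L2 lborel" and g: "integrable lborel g" "g \<in> L2 lborel"
  shows "L2_inner lborel (sinc_conv w f) g = cnj (L2_inner lborel (sinc_conv w g) f)"
proof -
  have "L2_inner lborel (cutoff w F) G = cnj (L2_inner lborel (cutoff w G) F)" for F G
    unfolding L2_inner_def Bochner_Integration.integral_cnj[symmetric]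
    by (intro Bochner_Integration.integral_cong refl) (auto simp: cutoff_def split: split_indicator)
  then show ?thesis
    unfolding sinc_conv_inner[OF w f g(1)] sinc_conv_inner[OF w g f(1)] .
qed

lemma sinc_conv_nonneg:
  assumes w: "w > 0" and f: "integrable lborel f" "f \<in> L2 lborel"
  obtains R where "R \<ge> 0" "L2_inner lborel (sinc_conv w f) f = complex_of_real R"
proof
  let ?F = "\<lambda>\<xi>. fourier_integral f (- \<xi>)"
  let ?R = "\<integral>\<xi>. (cmod (cutoff w ?F \<xi>))\<^sup>2 \<partial>lborel"
  show "?R \<ge> 0" by simp
  have "cutoff w ?F \<xi> * cnj (?F \<xi>) = complex_of_real ((cmod (cutoff w ?F \<xi>))\<^sup>2)" for \<xi>
    by (auto simp: cutoff_def complex_norm_square split: split_indicator simp del: of_real_power)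
  then show "L2_inner lborel (sinc_conv w f) f = complex_of_real ?R"
    by (subst sinc_conv_inner[OF w f f(1)]) (simp add: L2_inner_def del: of_real_power)
qed

lemma AE_unit_interval: "(AE x in unit_interval_measure. P x) \<longleftrightarrow> (AE x in lborel. x \<in> {-1<..<1} \<longrightarrow> P x)"
  unfolding unit_interval_measure_def by (rule AE_restrict_space_iff) simp

lemma L2_unit_interval: "f \<in> L2 unit_interval_measure \<longleftrightarrow> cutoff 1 f \<in> L2 lborel"
proof -
  have "(\<lambda>x. indicator {-1<..<1} x *\<^sub>R f x) = cutoff 1 f"
     "(\<lambda>x. indicator {-1<..<1} x *\<^sub>R (cmod (f x))\<^sup>2) = (\<lambda>x. (cmod (cutoff 1 f x))\<^sup>2)"
    by (auto simp: cutoff_def split: split_indicator)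
  then show ?thesis
    unfolding L2_def unit_interval_measure_def
    by (simp add: borel_measurable_restrict_space_iff integrable_restrict_space)
qed

lemma sinc_operator_eq:
  assumes c: "c > 0" and f: "f \<in> L2 unit_interval_measure"
  shows "sinc_operator c f x = sinc_conv c (cutoff 1 f) x"
proof -
  let ?i = "\<lambda>y. complex_of_real (sin (c * (x - y)) / (pi * (x - y))) * cutoff 1 f y"
  have [measurable]: "cutoff 1 f \<in> borel_measurable borel"
    using L2_measurable[OF f[unfolded L2_unit_interval]] by simp
  interpret lipschitz_kernel "sinc_kernel c" "c / pi" "c\<^sup>2 / pi" by (rule lipschitz_sinc_kernel[OF c])
  have "sinc_operator c f x = (\<integral>y. ?i y \<partial>lborel)"
    unfolding sinc_operator_def unit_interval_measure_def
    by (subst integral_restrict_space) (auto simp: cutoff_def scaleR_conv_of_real intro!: Bochner_Integration.integral_cong split: split_indicator)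
  also have "\<dots> = (\<integral>y. complex_of_real (sinc_kernel c (x - y)) * cutoff 1 f y \<partial>lborel)"
  proof (rule integral_cong_AE)
    have "AE y in lborel. y \<noteq> x" by (rule AE_lborel_singleton)
    then show "AE y in lborel. ?i y = complex_of_real (sinc_kernel c (x - y)) * cutoff 1 f y"
      by eventually_elim (simp add: sinc_kernel_def)
  qed measurable
  finally show ?thesis by (simp add: sinc_conv_eq[OF c])
qed

text \<open>
  Eigenfunctions on the unit interval are extended by \<open>0\<close> and normalised, so that all further
  arguments take place in \<open>L\<^sup>2\<close> of the line.
\<close>

lemma sinc_eigenvector:
  assumes c: "c > 0" and z: "z \<in> L2_eigenvalues unit_interval_measure (sinc_operator c)"
  obtains \<phi> where "\<phi> \<in> L2 lborel" "cutoff 1 \<phi> = \<phi>" "L2_nrm lborel \<phi> = 1"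
    "AE x in lborel. cutoff 1 (sinc_conv c \<phi>) x = z * \<phi> x"
proof -
  obtain f where f: "f \<in> L2 unit_interval_measure" and ne: "\<not> (AE x in unit_interval_measure. f x = 0)"
    and ev: "AE x in unit_interval_measure. sinc_operator c f x = z * f x"
    using z unfolding L2_eigenvalues_def by blast
  let ?g = "cutoff 1 f"
  have g: "?g \<in> L2 lborel" using f by (simp add: L2_unit_interval)
  have "\<not> (AE x in lborel. ?g x = 0)"
  proof
    assume "AE x in lborel. ?g x = 0"
    then have "AE x in lborel. x \<in> {-1<..<1} \<longrightarrow> f x = 0"
      by eventually_elim (auto simp: cutoff_def indicator_def)
    then have "AE x in unit_interval_measure. f x = 0" by (subst AE_unit_interval)
    with ne show False by contradiction
  qed
  then have n0: "L2_nrm lborel ?g \<noteq> 0" by (simp add: L2_nrm_eq_0_iff[OF g])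
  define a where "a = complex_of_real (1 / L2_nrm lborel ?g)"
  define \<phi> where "\<phi> x = a * ?g x" for x
  show ?thesis
  proof
    show "\<phi> \<in> L2 lborel" unfolding \<phi>_def[abs_def] by (rule L2_scale[OF g])
    show "cutoff 1 \<phi> = \<phi>" by (auto simp: \<phi>_def cutoff_def split: split_indicator)
    show "L2_nrm lborel \<phi> = 1"
      unfolding \<phi>_def[abs_def] L2_nrm_scale using n0 by (simp add: a_def norm_divide)
    interpret lipschitz_kernel "sinc_kernel c" "c / pi" "c\<^sup>2 / pi" by (rule lipschitz_sinc_kernel[OF c])
    have "integrable lborel ?g" using cutoff_integrable[OF g, of 1] by simp
    from conv_integral_lincomb[OF this this, of a 0]
    have sc: "sinc_conv c \<phi> x = a * sinc_conv c ?g x" for x by (simp add: \<phi>_def[abs_def] sinc_conv_def)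
    show "AE x in lborel. cutoff 1 (sinc_conv c \<phi>) x = z * \<phi> x"
      using ev[unfolded AE_unit_interval]
    proof eventually_elim
      fix x assume x: "x \<in> {-1<..<1} \<longrightarrow> sinc_operator c f x = z * f x"
      show "cutoff 1 (sinc_conv c \<phi>) x = z * \<phi> x"
      proof (cases "x \<in> {-1<..<1}")
        case True
        then have "sinc_conv c \<phi> x = a * (z * f x)"
          using x by (simp add: sc sinc_operator_eq[OF c f])
        with True show ?thesis by (simp add: cutoff_def \<phi>_def)
      qed (simp add: cutoff_def \<phi>_def)
    qed
  qed
qed

lemma eigenvector_inner:
  assumes c: "c > 0" and \<phi>: "\<phi> \<in> L2 lborel" "cutoff 1 \<phi> = \<phi>" "AE x in lborel. cutoff 1 (sinc_conv c \<phi>) x = z * \<phi> x"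
    and g: "g \<in> L2 lborel" "cutoff 1 g = g"
  shows "L2_inner lborel (sinc_conv c \<phi>) g = z * L2_inner lborel \<phi> g"
proof -
  have [measurable]: "\<phi> \<in> borel_measurable borel" "g \<in> borel_measurable borel"
    using L2_measurable[OF \<phi>(1)] L2_measurable[OF g(1)] by simp_all
  have [measurable]: "sinc_conv c \<phi> \<in> borel_measurable borel"
    using cutoff_integrable[OF \<phi>(1), of 1] by (intro sinc_conv_measurable c) (simp add: \<phi>)
  have "L2_inner lborel (sinc_conv c \<phi>) g = (\<integral>x. z * (\<phi> x * cnj (g x)) \<partial>lborel)"
    unfolding L2_inner_def
  proof (rule integral_cong_AE)
    have "g x = 0" if "x \<notin> {-1<..<1}" for x using fun_cong[OF g(2), of x] that by (simp add: cutoff_def)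
    then have key: "sinc_conv c \<phi> x * cnj (g x) = cutoff 1 (sinc_conv c \<phi>) x * cnj (g x)" for x
      by (cases "x \<in> {-1<..<1}") (auto simp: cutoff_def)
    show "AE x in lborel. sinc_conv c \<phi> x * cnj (g x) = z * (\<phi> x * cnj (g x))"
      using \<phi>(3) by eventually_elim (simp add: key)
  qed measurable
  then show ?thesis by (simp add: L2_inner_def)
qed

lemma sinc_eigenvalues_real_nonneg:
  assumes c: "c > 0" and z: "z \<in> L2_eigenvalues unit_interval_measure (sinc_operator c)"
  obtains r where "r \<ge> 0" "z = complex_of_real r"
proof -
  obtain \<phi> where \<phi>: "\<phi> \<in> L2 lborel" "cutoff 1 \<phi> = \<phi>" "L2_nrm lborel \<phi> = 1"
    "AE x in lborel. cutoff 1 (sinc_conv c \<phi>) x = z * \<phi> x"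
    by (rule sinc_eigenvector[OF c z])
  have i: "integrable lborel \<phi>" using cutoff_integrable[OF \<phi>(1), of 1] by (simp add: \<phi>)
  obtain R where "R \<ge> 0" "L2_inner lborel (sinc_conv c \<phi>) \<phi> = complex_of_real R"
    by (rule sinc_conv_nonneg[OF c i \<phi>(1)])
  moreover have "L2_inner lborel (sinc_conv c \<phi>) \<phi> = z"
    using eigenvector_inner[OF c \<phi>(1,2,4,1,2)] \<phi>(3) by (simp add: L2_inner_self)
  ultimately show ?thesis using that by auto
qed

text \<open>
  Induction on \<open>F\<close>: removing the component along \<open>e i\<close> from \<open>g\<close> lowers the squared norm by the
  corresponding term of the sum and leaves all other coefficients unchanged.
\<close>

lemma Bessel_inequality:
  assumes "finite F" and e: "\<And>i. i \<in> F \<Longrightarrow> e i \<in> L2 M" "\<And>i. i \<in> F \<Longrightarrow> L2_nrm M (e i) = 1"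
    and orth: "\<And>i j. i \<in> F \<Longrightarrow> j \<in> F \<Longrightarrow> i \<noteq> j \<Longrightarrow> L2_inner M (e i) (e j) = 0"
    and g: "g \<in> L2 M"
  shows "(\<Sum>i\<in>F. (cmod (L2_inner M g (e i)))\<^sup>2) \<le> (L2_nrm M g)\<^sup>2"
  using assms
proof (induction F arbitrary: g rule: finite_induct)
  case empty
  show ?case by simp
next
  case (insert i F)
  let ?a = "L2_inner M g (e i)"
  define g' where "g' = (\<lambda>x. 1 * g x + (- ?a) * e i x)"
  have ei: "e i \<in> L2 M" and g: "g \<in> L2 M" using insert.prems by auto
  have g': "g' \<in> L2 M" unfolding g'_def by (intro L2_lincomb ei g)
  have ip: "L2_inner M g' h = L2_inner M g h - ?a * L2_inner M (e i) h" if "h \<in> L2 M" for h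
    unfolding g'_def by (subst L2_inner_lincomb_left[OF g ei that]) simp
  have g'e: "L2_inner M g' (e i) = 0"
    using insert.prems(2)[of i] by (simp add: ip[OF ei] L2_inner_self)
  have A: "L2_inner M g' g' = L2_inner M g g' - ?a * L2_inner M (e i) g'" by (rule ip[OF g'])
  have B: "L2_inner M (e i) g' = 0" using g'e by (subst L2_inner_commute) simp
  have C: "L2_inner M g g' = cnj (L2_inner M g' g)" by (rule L2_inner_commute)
  have D: "L2_inner M g' g = L2_inner M g g - ?a * L2_inner M (e i) g" by (rule ip[OF g])
  have E: "L2_inner M (e i) g = cnj ?a" by (rule L2_inner_commute)
  have "L2_inner M g' g' = cnj (L2_inner M g g - ?a * cnj ?a)"
    unfolding A B C D E by simp
  then have "complex_of_real ((L2_nrm M g')\<^sup>2) = cnj (complex_of_real ((L2_nrm M g)\<^sup>2) - complex_of_real ((cmod ?a)\<^sup>2))"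
    by (simp only: L2_inner_self complex_norm_square[of ?a])
  then have n: "(L2_nrm M g')\<^sup>2 = (L2_nrm M g)\<^sup>2 - (cmod ?a)\<^sup>2"
    by (simp only: of_real_diff[symmetric] complex_cnj_complex_of_real of_real_eq_iff)
  have "(\<Sum>j\<in>F. (cmod (L2_inner M g (e j)))\<^sup>2) = (\<Sum>j\<in>F. (cmod (L2_inner M g' (e j)))\<^sup>2)"
  proof (rule sum.cong[OF refl])
    fix j assume "j \<in> F"
    then have "i \<noteq> j" using insert.hyps by blast
    then have "e j \<in> L2 M" "L2_inner M (e i) (e j) = 0"
      using insert.prems(1)[of j] insert.prems(3)[of i j] \<open>j \<in> F\<close> by simp_all
    then show "(cmod (L2_inner M g (e j)))\<^sup>2 = (cmod (L2_inner M g' (e j)))\<^sup>2" by (simp add: ip)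
  qed
  also have "\<dots> \<le> (L2_nrm M g')\<^sup>2" by (rule insert.IH) (use insert.prems g' in auto)
  finally show ?case using n insert.hyps by simp
qed

text \<open>
  The Hilbert--Schmidt bound. Eigenfunctions \<open>e i\<close> for different eigenvalues are orthogonal, and the
  coefficients of \<open>y \<mapsto> k(x - y)\<close> with respect to them are, up to conjugation, the values \<open>i * e i x\<close>.
  Bessel's inequality at a fixed \<open>x\<close>, integrated over the unit interval, bounds the sum of the squares
  of the eigenvalues.
\<close>

lemma card_large_sinc_eigenvalues:
  assumes c: "c > 0" and \<nu>: "\<nu> > 0" and F: "finite F" "F \<subseteq> {\<mu> \<in> sinc_eigenvalues c. \<mu> > \<nu>}"
  shows "real (card F) * \<nu>\<^sup>2 \<le> 4 * (c / pi)\<^sup>2"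
proof -
  let ?ev = "\<lambda>i \<phi>. \<phi> \<in> L2 lborel \<and> cutoff 1 \<phi> = \<phi> \<and> L2_nrm lborel \<phi> = 1 \<and>
      (AE x in lborel. cutoff 1 (sinc_conv c \<phi>) x = complex_of_real i * \<phi> x)"
  interpret lipschitz_kernel "sinc_kernel c" "c / pi" "c\<^sup>2 / pi" by (rule lipschitz_sinc_kernel[OF c])
  have "\<forall>i\<in>F. \<exists>\<phi>. ?ev i \<phi>"
  proof
    fix i assume "i \<in> F"
    then have "complex_of_real i \<in> L2_eigenvalues unit_interval_measure (sinc_operator c)"
      using F(2) by (auto simp: sinc_eigenvalues_def)
    from sinc_eigenvector[OF c this] show "\<exists>\<phi>. ?ev i \<phi>" by blast
  qed
  then obtain e where e: "\<And>i. i \<in> F \<Longrightarrow> e i \<in> L2 lborel" "\<And>i. i \<in> F \<Longrightarrow> cutoff 1 (e i) = e i" "\<And>i. i \<in> F \<Longrightarrow> L2_nrm lborel (e i) = 1"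
      "\<And>i. i \<in> F \<Longrightarrow> AE x in lborel. cutoff 1 (sinc_conv c (e i)) x = complex_of_real i * e i x"
    by metis
  have ei: "integrable lborel (e i)" if "i \<in> F" for i
    using cutoff_integrable[OF e(1)[OF that], of 1] e(2)[OF that] by simp
  have orth: "L2_inner lborel (e i) (e j) = 0" if ij: "i \<in> F" "j \<in> F" "i \<noteq> j" for i j
  proof -
    have "complex_of_real i * L2_inner lborel (e i) (e j) = L2_inner lborel (sinc_conv c (e i)) (e j)"
      using ij by (intro eigenvector_inner[symmetric] c e)
    also have "\<dots> = cnj (L2_inner lborel (sinc_conv c (e j)) (e i))"
      using ij by (intro sinc_conv_selfadjoint c ei e)
    also have "L2_inner lborel (sinc_conv c (e j)) (e i) = complex_of_real j * L2_inner lborel (e j) (e i)"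
      using ij by (intro eigenvector_inner c e)
    also have "cnj \<dots> = complex_of_real j * L2_inner lborel (e i) (e j)"
      by (simp add: L2_inner_commute[of lborel "e i"])
    finally show ?thesis using ij(3) by simp
  qed
  have n2: "(L2_nrm lborel (indicator {-1..1::real}))\<^sup>2 = 2"
  proof -
    have "(cmod (indicator {-1..1::real} x))\<^sup>2 = indicator {-1..1} x" for x
      by (auto split: split_indicator)
    then show ?thesis unfolding L2_nrm_sq by (simp only: integral_indicator_unit)
  qed
  have pointwise: "(\<Sum>i\<in>F. (cmod (sinc_conv c (e i) x))\<^sup>2) \<le> 2 * (c / pi)\<^sup>2" for x
  proof -
    let ?k = "\<lambda>y. complex_of_real (sinc_kernel c (x - y))"
    have kb: "cmod (?k y) \<le> c / pi" for y using k_bound by simp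
    have km: "?k \<in> borel_measurable borel" by measurable
    note k = cutoff_bounded_L2[OF km kb B_nonneg, of 1]
    have "cmod (sinc_conv c (e i) x) = cmod (L2_inner lborel (cutoff 1 ?k) (e i))" if "i \<in> F" for i
    proof -
      have "e i y = 0" if "y \<notin> {-1<..<1}" for y
        using fun_cong[OF e(2)[OF \<open>i \<in> F\<close>], of y] that by (simp add: cutoff_def)
      then have "cutoff 1 ?k y * cnj (e i y) = cnj (?k y * e i y)" for y
        by (cases "y \<in> {-1<..<1}") (auto simp: cutoff_def)
      then have "L2_inner lborel (cutoff 1 ?k) (e i) = cnj (sinc_conv c (e i) x)"
        unfolding L2_inner_def sinc_conv_eq[OF c] by (simp only: Bochner_Integration.integral_cnj)
      then show ?thesis by simp
    qed
    then have "(\<Sum>i\<in>F. (cmod (sinc_conv c (e i) x))\<^sup>2) = (\<Sum>i\<in>F. (cmod (L2_inner lborel (cutoff 1 ?k) (e i)))\<^sup>2)"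
      by simp
    also have "\<dots> \<le> (L2_nrm lborel (cutoff 1 ?k))\<^sup>2"
      by (rule Bessel_inequality[OF F(1) e(1) e(3) orth k(1)])
    also have "\<dots> \<le> (c / pi * L2_nrm lborel (indicator {-1..1::real}))\<^sup>2"
      by (rule power_mono[OF k(2)]) simp
    also have "\<dots> = 2 * (c / pi)\<^sup>2" unfolding power_mult_distrib n2 by simp
    finally show ?thesis .
  qed
  have "real (card F) * \<nu>\<^sup>2 = (\<Sum>i\<in>F. \<nu>\<^sup>2)" by simp
  also have "\<dots> \<le> (\<Sum>i\<in>F. i\<^sup>2 * (L2_nrm lborel (e i))\<^sup>2)"
  proof (rule sum_mono)
    fix i assume i: "i \<in> F"
    then have "\<nu> \<le> i" using F(2) by auto
    then show "\<nu>\<^sup>2 \<le> i\<^sup>2 * (L2_nrm lborel (e i))\<^sup>2"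
      using \<nu> by (simp add: e(3)[OF i] power_mono)
  qed
  also have "\<dots> = (\<Sum>i\<in>F. \<integral>x. i\<^sup>2 * (cmod (e i x))\<^sup>2 \<partial>lborel)"
    unfolding L2_nrm_sq by (simp only: integral_mult_right_zero)
  also have "\<dots> = (\<integral>x. (\<Sum>i\<in>F. i\<^sup>2 * (cmod (e i x))\<^sup>2) \<partial>lborel)"
    by (intro Bochner_Integration.integral_sum[symmetric] integrable_mult_right L2_integrable_sq e(1))
  also have "\<dots> \<le> (\<integral>x. 2 * (c / pi)\<^sup>2 * indicator {-1..1::real} x \<partial>lborel)"
  proof (rule integral_mono_AE)
    show "integrable lborel (\<lambda>x. \<Sum>i\<in>F. i\<^sup>2 * (cmod (e i x))\<^sup>2)"
      by (intro Bochner_Integration.integrable_sum integrable_mult_right L2_integrable_sq e(1))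
    show "integrable lborel (\<lambda>x. 2 * (c / pi)\<^sup>2 * indicator {-1..1::real} x)"
      by (intro integrable_mult_right integrable_real_indicator) (simp_all add: emeasure_lborel_Icc_eq)
    have "AE x in lborel. \<forall>i\<in>F. cutoff 1 (sinc_conv c (e i)) x = complex_of_real i * e i x"
      using F(1) e(4) by (rule AE_finite_allI)
    then show "AE x in lborel. (\<Sum>i\<in>F. i\<^sup>2 * (cmod (e i x))\<^sup>2) \<le> 2 * (c / pi)\<^sup>2 * indicator {-1..1} x"
    proof eventually_elim
      fix x assume x: "\<forall>i\<in>F. cutoff 1 (sinc_conv c (e i)) x = complex_of_real i * e i x"
      have "(\<Sum>i\<in>F. i\<^sup>2 * (cmod (e i x))\<^sup>2) = (\<Sum>i\<in>F. (cmod (cutoff 1 (sinc_conv c (e i)) x))\<^sup>2)"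
        using x by (intro sum.cong refl) (simp add: norm_mult power_mult_distrib)
      also have "\<dots> \<le> 2 * (c / pi)\<^sup>2 * indicator {-1..1} x"
        using pointwise[of x] by (cases "x \<in> {-1<..<1}") (auto simp: cutoff_def indicator_def)
      finally show "(\<Sum>i\<in>F. i\<^sup>2 * (cmod (e i x))\<^sup>2) \<le> 2 * (c / pi)\<^sup>2 * indicator {-1..1} x" .
    qed
  qed
  also have "\<dots> = 2 * (c / pi)\<^sup>2 * (\<integral>x. indicator {-1..1::real} x \<partial>lborel)"
    by (rule integral_mult_right_zero)
  also have "\<dots> = 4 * (c / pi)\<^sup>2" unfolding integral_indicator_unit by simp
  finally show ?thesis .
qed

lemma finite_large_sinc_eigenvalues:
  assumes c: "c > 0" and \<nu>: "\<nu> > 0"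
  shows "finite {\<mu> \<in> sinc_eigenvalues c. \<mu> > \<nu>}"
proof -
  have "card F \<le> nat \<lfloor>4 * (c / pi)\<^sup>2 / \<nu>\<^sup>2\<rfloor>" if "F \<subseteq> {\<mu> \<in> sinc_eigenvalues c. \<mu> > \<nu>}" "finite F" for F
  proof -
    have "real (card F) \<le> 4 * (c / pi)\<^sup>2 / \<nu>\<^sup>2"
      unfolding pos_le_divide_eq[OF zero_less_power[OF \<nu>]] by (rule card_large_sinc_eigenvalues[OF c \<nu> that(2,1)])
    then show ?thesis by (rule le_nat_floor)
  qed
  from finite_if_finite_subsets_card_bdd[OF this] show ?thesis by (rule conjunct1)
qed

text \<open>
  Uniqueness: for two eigenvalues \<open>a < b\<close> the set of eigenvalues above \<open>b\<close> is properly contained in the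
  set of those above \<open>a\<close>, which contains \<open>b\<close>.
\<close>

lemma sinc_eigenvalue_card:
  assumes c: "c > 0" and \<mu>: "\<mu> > 0" "\<mu> \<in> sinc_eigenvalues c"
  shows "sinc_eigenvalue c (card {\<nu> \<in> sinc_eigenvalues c. \<nu> > \<mu>}) = \<mu>"
  unfolding sinc_eigenvalue_def
proof (rule the_equality)
  let ?S = "\<lambda>\<mu>. {\<nu> \<in> sinc_eigenvalues c. \<nu> > \<mu>}"
  show "\<mu> \<in> sinc_eigenvalues c \<and> finite (?S \<mu>) \<and> card (?S \<mu>) = card (?S \<mu>)"
    by (intro conjI refl \<mu>(2) finite_large_sinc_eigenvalues[OF c \<mu>(1)])
  have cardlt: "card (?S b) < card (?S a)" if "a < b" "b \<in> sinc_eigenvalues c" "finite (?S a)" for a b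
  proof (rule psubset_card_mono[OF that(3)])
    have "b \<in> ?S a" "b \<notin> ?S b" using that(1,2) by simp_all
    moreover have "?S b \<subseteq> ?S a" using that(1) by (intro Collect_mono) simp
    ultimately show "?S b \<subset> ?S a" by blast
  qed
  fix \<mu>' assume *: "\<mu>' \<in> sinc_eigenvalues c \<and> finite (?S \<mu>') \<and> card (?S \<mu>') = card (?S \<mu>)"
  then have ev: "\<mu>' \<in> sinc_eigenvalues c" and fin: "finite (?S \<mu>')" and card: "card (?S \<mu>') = card (?S \<mu>)"
    by blast+
  show "\<mu>' = \<mu>"
  proof (cases \<mu>' \<mu> rule: linorder_cases)
    case less
    from cardlt[OF this \<mu>(2) fin] show ?thesis by (simp only: card less_irrefl)
  next
    case greater
    from cardlt[OF this ev finite_large_sinc_eigenvalues[OF c \<mu>(1)]] show ?thesis by (simp only: card less_irrefl)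
  qed
qed

section \<open>From eigenvalues to the resolvent of the compression\<close>

text \<open>
  The resolvent is a choice of preimages. The lower bound makes preimages unique up to null sets, and
  this gives linearity, boundedness and both inverse identities.
\<close>

lemma not_in_L2_spectrum_if_bounded_below_and_surjective:
  assumes A: "\<And>f. f \<in> L2 M \<Longrightarrow> A f \<in> L2 M"
    and lin: "\<And>f g a b. f \<in> L2 M \<Longrightarrow> g \<in> L2 M \<Longrightarrow> AE x in M. A (\<lambda>y. a * f y + b * g y) x = a * A f x + b * A g x"
    and below: "\<And>f. f \<in> L2 M \<Longrightarrow> L2_nrm M f \<le> C * L2_nrm M (\<lambda>x. A f x - z * f x)"
    and surj: "\<And>g. g \<in> L2 M \<Longrightarrow> \<exists>f\<in>L2 M. AE x in M. A f x - z * f x = g x"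
  shows "z \<notin> L2_spectrum M A"
proof -
  define D where "D f = (\<lambda>x. A f x - z * f x)" for f
  have D: "D f \<in> L2 M" if "f \<in> L2 M" for f
    unfolding D_def by (intro L2_diff A L2_scale that)
  have Dlin: "AE x in M. D (\<lambda>y. a * f y + b * g y) x = a * D f x + b * D g x"
    if "f \<in> L2 M" "g \<in> L2 M" for f g a b
    using lin[OF that, of a b] by eventually_elim (simp add: D_def algebra_simps)
  have inj: "AE x in M. f x = g x" if f: "f \<in> L2 M" and g: "g \<in> L2 M" and eq: "AE x in M. D f x = D g x" for f g
  proof -
    let ?d = "\<lambda>y. 1 * f y + (-1) * g y"
    have d: "?d \<in> L2 M" by (intro L2_lincomb f g)
    have "AE x in M. D ?d x = 0"
      using Dlin[OF f g, of 1 "-1"] eq by eventually_elim simp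
    then have "L2_nrm M (D ?d) = 0" by (simp only: L2_nrm_eq_0_iff[OF D[OF d]])
    then have "L2_nrm M ?d \<le> 0" using below[OF d] by (simp add: D_def)
    then have "L2_nrm M ?d = 0" using L2_nrm_nonneg[of M ?d] by linarith
    then have "AE x in M. ?d x = 0" by (simp only: L2_nrm_eq_0_iff[OF d])
    then show ?thesis by eventually_elim simp
  qed
  define R where "R g = (SOME f. f \<in> L2 M \<and> (AE x in M. D f x = g x))" for g
  have R: "R g \<in> L2 M" "AE x in M. D (R g) x = g x" if "g \<in> L2 M" for g
  proof -
    have "\<exists>f. f \<in> L2 M \<and> (AE x in M. D f x = g x)"
      using surj[OF that] by (auto simp: D_def)
    from someI_ex[OF this] have "R g \<in> L2 M \<and> (AE x in M. D (R g) x = g x)"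
      unfolding R_def .
    then show "R g \<in> L2 M" "AE x in M. D (R g) x = g x" by blast+
  qed
  have "L2_bounded_operator M R"
    unfolding L2_bounded_operator_def
  proof (intro conjI ballI allI exI[of _ C])
    fix f g a b assume f: "f \<in> L2 M" and g: "g \<in> L2 M"
    show "AE x in M. R (\<lambda>y. a * f y + b * g y) x = a * R f x + b * R g x"
    proof (rule inj)
      show "AE x in M. D (R (\<lambda>y. a * f y + b * g y)) x = D (\<lambda>x. a * R f x + b * R g x) x"
        using R(2)[OF L2_lincomb[OF f g, of a b]] R(2)[OF f] R(2)[OF g] Dlin[OF R(1)[OF f] R(1)[OF g], of a b]
        by eventually_elim simp
    qed (intro R L2_lincomb f g)+
  next
    fix f assume f: "f \<in> L2 M"
    have "L2_nrm M (D (R f)) = L2_nrm M f"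
      by (intro L2_nrm_cong_AE L2_measurable D R f)
    then show "L2_nrm M (R f) \<le> C * L2_nrm M f"
      using below[OF R(1)[OF f]] by (simp add: D_def)
  qed (rule R)
  moreover have "AE x in M. R (\<lambda>y. A f y - z * f y) x = f x" if f: "f \<in> L2 M" for f
    using inj[OF R(1)[OF D[OF f]] f R(2)[OF D[OF f]]] by (simp add: D_def)
  moreover have "AE x in M. A (R f) x - z * R f x = f x" if f: "f \<in> L2 M" for f
    using R(2)[OF f] by (simp add: D_def)
  ultimately show ?thesis unfolding L2_spectrum_def by blast
qed

text \<open>
  Dilation by \<open>t\<close>, using \<open>t * sinc_kernel w (t * s) = sinc_kernel (w * t) s\<close>.
\<close>

lemma sinc_eigenvalue_of_scaled_eigenfunction:
  assumes t: "t > 0" and w: "w > 0" and \<phi>: "\<phi> \<in> L2 lborel"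
    and ev: "\<And>x. x \<in> {-t<..<t} \<Longrightarrow> sinc_conv w (cutoff t \<phi>) x = m * \<phi> x"
    and ne: "\<not> (AE x in lborel. cutoff t \<phi> x = 0)"
  shows "m \<in> L2_eigenvalues unit_interval_measure (sinc_operator (w * t))"
proof -
  let ?i = "\<lambda>x y. complex_of_real (sinc_kernel w (t * x - (0 + t * y))) * cutoff t \<phi> (0 + t * y)"
  have wt: "w * t > 0" using t w by simp
  define \<psi> where "\<psi> x = \<phi> (t * x)" for x
  have [measurable]: "\<phi> \<in> borel_measurable borel" using L2_measurable[OF \<phi>] by simp
  have cut: "cutoff t \<phi> (t * x) = cutoff 1 \<psi> x" for x
  proof -
    have "t * x \<in> {-t<..<t} \<longleftrightarrow> x \<in> {-1<..<1}"
      using t mult_less_cancel_left_pos[of t x 1] mult_less_cancel_left_pos[of t "-1" x] by simp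
    then show ?thesis by (simp add: cutoff_def \<psi>_def indicator_def)
  qed
  have kernel: "t * sinc_kernel w (t * s) = sinc_kernel (w * t) s" for s
    using t by (simp add: sinc_kernel_def mult_ac)
  have "integrable lborel (\<lambda>x. (cmod (\<phi> (0 + t * x)))\<^sup>2)"
    using t by (intro lborel_integrable_real_affine L2_integrable_sq \<phi>) simp
  then have \<psi>: "\<psi> \<in> L2 lborel" by (simp add: L2_def \<psi>_def[abs_def] del: L2_integrable_sq)
  then have \<psi>u: "\<psi> \<in> L2 unit_interval_measure" by (simp add: L2_unit_interval cutoff_L2)
  have conv: "sinc_conv w (cutoff t \<phi>) (t * x) = sinc_conv (w * t) (cutoff 1 \<psi>) x" for x
  proof -
    have "sinc_conv w (cutoff t \<phi>) (t * x) = \<bar>t\<bar> *\<^sub>R (\<integral>y. ?i x y \<partial>lborel)"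
      unfolding sinc_conv_eq[OF w] by (rule lborel_integral_real_affine) (use t in simp)
    also have "\<dots> = (\<integral>y. t *\<^sub>R (?i x y) \<partial>lborel)"
      using t by simp
    also have "\<dots> = (\<integral>y. complex_of_real (sinc_kernel (w * t) (x - y)) * cutoff 1 \<psi> y \<partial>lborel)"
    proof (intro Bochner_Integration.integral_cong refl)
      fix y
      have "t * x - (0 + t * y) = t * (x - y)" by (simp add: algebra_simps)
      then show "t *\<^sub>R (?i x y) = complex_of_real (sinc_kernel (w * t) (x - y)) * cutoff 1 \<psi> y"
        by (simp add: kernel[symmetric] scaleR_conv_of_real cut)
    qed
    finally show ?thesis by (simp only: sinc_conv_eq[OF wt])
  qed
  have "sinc_operator (w * t) \<psi> x = m * \<psi> x" if "x \<in> {-1<..<1}" for x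
  proof -
    have "t * x \<in> {-t<..<t}"
      using that t mult_less_cancel_left_pos[of t x 1] mult_less_cancel_left_pos[of t "-1" x] by simp
    from ev[OF this] show ?thesis by (simp add: sinc_operator_eq[OF wt \<psi>u] conv[symmetric] \<psi>_def)
  qed
  then have e: "AE x in unit_interval_measure. sinc_operator (w * t) \<psi> x = m * \<psi> x"
    by (simp add: AE_unit_interval)
  have "\<not> (AE x in unit_interval_measure. \<psi> x = 0)"
  proof
    assume "AE x in unit_interval_measure. \<psi> x = 0"
    then have "AE x in lborel. (cmod (cutoff t \<phi> (0 + t * x)))\<^sup>2 = 0"
      unfolding AE_unit_interval add_0_left cut by eventually_elim (auto simp: cutoff_def split: split_indicator)
    then have "(\<integral>x. (cmod (cutoff t \<phi> (0 + t * x)))\<^sup>2 \<partial>lborel) = 0"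
      by (rule integral_eq_zero_AE)
    moreover have "(\<integral>x. (cmod (cutoff t \<phi> x))\<^sup>2 \<partial>lborel) = \<bar>t\<bar> *\<^sub>R (\<integral>x. (cmod (cutoff t \<phi> (0 + t * x)))\<^sup>2 \<partial>lborel)"
      using t by (intro lborel_integral_real_affine) simp
    ultimately have "L2_nrm lborel (cutoff t \<phi>) = 0" by (simp add: L2_nrm_def)
    with ne show False by (simp add: L2_nrm_eq_0_iff cutoff_L2 \<phi>)
  qed
  with e \<psi>u show ?thesis unfolding L2_eigenvalues_def by blast
qed

lemma compressed_band_limit_resolvent:
  assumes t: "t > 0" and w: "w > 0" and m: "m \<noteq> 0"
    and noev: "m \<notin> L2_eigenvalues unit_interval_measure (sinc_operator (w * t))"
  shows "\<exists>C\<ge>0. \<forall>u\<in>L2 lborel. L2_nrm lborel (cutoff t u) \<le> C * L2_nrm lborel (cutoff t (\<lambda>x. band_limit w (cutoff t u) x - m * u x))"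
    and "h \<in> L2 lborel \<Longrightarrow> \<exists>u\<in>L2 lborel. AE x in lborel. cutoff t (\<lambda>x. band_limit w (cutoff t u) x - m * u x) x = cutoff t h x"
proof -
  interpret lipschitz_kernel "sinc_kernel w" "w / pi" "w\<^sup>2 / pi" by (rule lipschitz_sinc_kernel[OF w])
  let ?E = "\<lambda>u x. conv_integral (cutoff t u) x - m * u x"
  let ?D = "\<lambda>u x. band_limit w (cutoff t u) x - m * u x"
  have t0: "t \<ge> 0" using t by simp
  have no: "AE x in lborel. cutoff t \<phi> x = 0"
    if "\<phi> \<in> L2 lborel" "\<And>x. x \<in> {-t<..<t} \<Longrightarrow> conv_integral (cutoff t \<phi>) x = m * \<phi> x" for \<phi>
    using sinc_eigenvalue_of_scaled_eigenfunction[OF t w that(1), of m] that(2) noev by (auto simp: sinc_conv_def)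
  have eq: "AE x in lborel. cutoff t (?D u) x = cutoff t (?E u) x"
    if "u \<in> L2 lborel" for u
    using band_limit_cutoff[OF w that, of t] by eventually_elim (simp add: cutoff_def conv_integral_def)
  have nrm: "L2_nrm lborel (cutoff t (?D u)) = L2_nrm lborel (cutoff t (?E u))"
    if u: "u \<in> L2 lborel" for u
  proof (rule L2_nrm_cong_AE[OF _ _ eq[OF u]])
    have [measurable]: "u \<in> borel_measurable borel" using L2_measurable[OF u] by simp
    have [measurable]: "conv_integral (cutoff t u) \<in> borel_measurable borel"
      by (intro borel_measurable_continuous_onI conv_integral_continuous cutoff_integrable u)
    have "cutoff t (?E u) \<in> borel_measurable borel"
      by (intro cutoff_measurable) measurable
    then show "cutoff t (?E u) \<in> borel_measurable lborel" by simp
    show "cutoff t (?D u) \<in> borel_measurable lborel"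
      by (intro L2_measurable cutoff_L2 L2_diff band_limit_L2 L2_scale u)
  qed
  show "\<exists>C\<ge>0. \<forall>u\<in>L2 lborel. L2_nrm lborel (cutoff t u) \<le> C * L2_nrm lborel (cutoff t (?D u))"
    using Fredholm_alternative(1)[OF t0 m no] by (simp add: nrm)
  assume "h \<in> L2 lborel"
  from Fredholm_alternative(2)[OF t0 m no this]
  obtain u where u: "u \<in> L2 lborel" and "\<And>x. cutoff t (?E u) x = cutoff t h x"
    by blast
  with eq[OF u] show "\<exists>u\<in>L2 lborel. AE x in lborel. cutoff t (?D u) x = cutoff t h x"
    by (intro bexI[OF _ u]) simp
qed

section \<open>The spectrum of the sum of the two projections\<close>

text \<open>
  The elimination of \<open>v = Q f\<close> described at the beginning: it is used once as an estimate, for the lower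
  bound, and once in the reverse direction, to construct a solution.
\<close>

lemma not_in_spectrum_cutoff_plus_band_limit:
  assumes t: "t > 0" and w: "w > 0" and z: "z \<noteq> 0" "z \<noteq> 1"
    and noev: "(z - 1)\<^sup>2 \<notin> L2_eigenvalues unit_interval_measure (sinc_operator (w * t))"
  shows "z \<notin> L2_spectrum lborel (\<lambda>f x. cutoff t f x + band_limit w f x)"
proof -
  define \<mu> where "\<mu> = z - 1"
  have \<mu>: "\<mu> \<noteq> 0" and z1: "z = 1 + \<mu>" using z by (simp_all add: \<mu>_def)
  have m: "\<mu>\<^sup>2 \<noteq> 0" using \<mu> by simp
  let ?P = "cutoff t" and ?Q = "band_limit w"
  let ?n = "L2_nrm lborel"
  note res = compressed_band_limit_resolvent[OF t w m noev[folded \<mu>_def]]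
  obtain C where C: "C \<ge> 0" "\<And>u. u \<in> L2 lborel \<Longrightarrow> ?n (?P u) \<le> C * ?n (?P (\<lambda>x. ?Q (?P u) x - \<mu>\<^sup>2 * u x))"
    using res(1) by blast
  let ?K = "C * (1 + cmod \<mu>) + (C * (1 + cmod \<mu>) + 1) / cmod \<mu> + 1"
  have P: "?P f \<in> L2 lborel" and Q: "?Q f \<in> L2 lborel" if "f \<in> L2 lborel" for f
    using that by (auto intro: cutoff_L2 band_limit_L2)
  have Plin: "?P (\<lambda>x. a * f x + b * g x) x = a * ?P f x + b * ?P g x" for a b f g x
    by (rule cutoff_lincomb)
  have PAE: "AE x in lborel. ?P f x = ?P g x" if "AE x in lborel. f x = g x" for f g
    using that by eventually_elim (simp add: cutoff_def)
  have Q3: "AE x in lborel. ?Q (\<lambda>y. a * f y + b * g y + d * h y) x = a * ?Q f x + b * ?Q g x + d * ?Q h x"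
    if f: "f \<in> L2 lborel" and g: "g \<in> L2 lborel" and h: "h \<in> L2 lborel" for a b d f g h
    using band_limit_lincomb[OF L2_lincomb[OF f g, of a b] h, of w 1 d] band_limit_lincomb[OF f g, of w a b]
    by eventually_elim simp
  show ?thesis
  proof (rule not_in_L2_spectrum_if_bounded_below_and_surjective)
    show "(\<lambda>x. ?P f x + ?Q f x) \<in> L2 lborel" if "f \<in> L2 lborel" for f
      by (intro L2_add P Q that)
    show "AE x in lborel. ?P (\<lambda>y. a * f y + b * g y) x + ?Q (\<lambda>y. a * f y + b * g y) x = a * (?P f x + ?Q f x) + b * (?P g x + ?Q g x)"
      if "f \<in> L2 lborel" "g \<in> L2 lborel" for f g a b
      using band_limit_lincomb[OF that, of w a b] by eventually_elim (simp add: Plin algebra_simps)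
  next
    fix f :: "real \<Rightarrow> complex" assume f: "f \<in> L2 lborel"
    define g where "g = (\<lambda>x. ?P f x + ?Q f x - z * f x)"
    have g: "g \<in> L2 lborel" unfolding g_def by (intro L2_diff L2_add L2_scale P Q f)
    have g3: "g = (\<lambda>y. 1 * ?P f y + 1 * ?Q f y + (- z) * f y)" by (auto simp: g_def)
    have Qg: "AE x in lborel. ?Q g x = ?Q (?P f) x - \<mu> * ?Q f x"
      using Q3[OF P[OF f] Q[OF f] f, of 1 1 "-z"] unfolding g3 band_limit_idem[OF f]
      by eventually_elim (simp add: z1 algebra_simps)
    have Pg: "?P g x = ?P (?Q f) x - \<mu> * ?P f x" for x
      by (auto simp: g_def cutoff_def z1 algebra_simps split: split_indicator)
    \<comment> \<open>The eliminated equation \<open>(P Q P - \<mu>\<^sup>2) u = P Q g + \<mu> P g\<close> for \<open>u = P f\<close>.\<close>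
    have "AE x in lborel. ?P (\<lambda>x. ?Q (?P f) x - \<mu>\<^sup>2 * f x) x = 1 * ?P (?Q g) x + \<mu> * ?P g x"
      using PAE[OF Qg]
    proof eventually_elim
      fix x assume x: "?P (?Q g) x = ?P (\<lambda>x. ?Q (?P f) x - \<mu> * ?Q f x) x"
      show "?P (\<lambda>x. ?Q (?P f) x - \<mu>\<^sup>2 * f x) x = 1 * ?P (?Q g) x + \<mu> * ?P g x"
        unfolding x Pg by (auto simp: cutoff_def power2_eq_square algebra_simps split: split_indicator)
    qed
    then have "?n (?P (\<lambda>x. ?Q (?P f) x - \<mu>\<^sup>2 * f x)) = ?n (\<lambda>x. 1 * ?P (?Q g) x + \<mu> * ?P g x)"
      by (intro L2_nrm_cong_AE L2_measurable L2_lincomb L2_diff L2_scale P Q f g)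
    also have "\<dots> \<le> ?n (\<lambda>x. 1 * ?P (?Q g) x) + ?n (\<lambda>x. \<mu> * ?P g x)"
      by (intro L2_nrm_triangle L2_scale P Q g)
    also have "\<dots> \<le> ?n g + cmod \<mu> * ?n g"
      unfolding L2_nrm_scale
      using order_trans[OF L2_nrm_cutoff_le[OF Q[OF g], of t] band_limit_contraction[OF g]]
        mult_left_mono[OF L2_nrm_cutoff_le[OF g, of t] norm_ge_zero[of \<mu>]] by simp
    finally have "C * ?n (?P (\<lambda>x. ?Q (?P f) x - \<mu>\<^sup>2 * f x)) \<le> C * (?n g + cmod \<mu> * ?n g)"
      by (rule mult_left_mono[OF _ C(1)])
    then have nP: "?n (?P f) \<le> C * (1 + cmod \<mu>) * ?n g"
      using C(2)[OF f] by (simp add: algebra_simps)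
    have "AE x in lborel. \<mu> * ?Q f x = ?Q (?P f) x - ?Q g x"
      using Qg by eventually_elim simp
    then have "?n (\<lambda>x. \<mu> * ?Q f x) = ?n (\<lambda>x. ?Q (?P f) x - ?Q g x)"
      by (intro L2_nrm_cong_AE L2_measurable L2_diff L2_scale P Q f g)
    also have "\<dots> \<le> ?n (?Q (?P f)) + ?n (?Q g)"
      by (intro L2_nrm_triangle_diff P Q f g)
    also have "\<dots> \<le> C * (1 + cmod \<mu>) * ?n g + ?n g"
      using band_limit_contraction[OF P[OF f], of w] band_limit_contraction[OF g, of w] nP by simp
    finally have nQ: "?n (?Q f) \<le> (C * (1 + cmod \<mu>) * ?n g + ?n g) / cmod \<mu>"
      using \<mu> by (simp add: L2_nrm_scale pos_le_divide_eq mult.commute)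
    have zp: "cmod z > 0" using z by simp
    have "cmod z * ?n f = ?n (\<lambda>x. z * f x)" by (simp add: L2_nrm_scale)
    also have "(\<lambda>x. z * f x) = (\<lambda>x. (?P f x + ?Q f x) - g x)" by (auto simp: g_def)
    also have "?n \<dots> \<le> ?n (\<lambda>x. ?P f x + ?Q f x) + ?n g"
      by (intro L2_nrm_triangle_diff L2_add P Q f g)
    also have "\<dots> \<le> ?n (?P f) + ?n (?Q f) + ?n g"
      by (intro add_right_mono L2_nrm_triangle P Q f)
    also have "\<dots> \<le> C * (1 + cmod \<mu>) * ?n g + (C * (1 + cmod \<mu>) * ?n g + ?n g) / cmod \<mu> + ?n g"
      by (intro add_right_mono add_mono nP nQ)
    also have "\<dots> = ?K * ?n g"
      by (simp add: algebra_simps add_divide_distrib)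
    finally have "?n f \<le> ?K * ?n g / cmod z"
      unfolding pos_le_divide_eq[OF zp] by (simp only: mult.commute)
    then show "?n f \<le> (?K / cmod z) * ?n (\<lambda>x. ?P f x + ?Q f x - z * f x)"
      unfolding g_def by simp
  next
    fix g :: "real \<Rightarrow> complex" assume g: "g \<in> L2 lborel"
    define h where "h = (\<lambda>x. 1 * ?P (?Q g) x + \<mu> * ?P g x)"
    have h: "h \<in> L2 lborel" unfolding h_def by (intro L2_lincomb P Q g)
    obtain u' where u': "u' \<in> L2 lborel" and "AE x in lborel. ?P (\<lambda>x. ?Q (?P u') x - \<mu>\<^sup>2 * u' x) x = ?P h x"
      using res(2)[OF h] by blast
    define u where "u = ?P u'"
    have u: "u \<in> L2 lborel" unfolding u_def by (rule P[OF u'])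
    have Pu: "?P u = u" by (simp add: u_def)
    have eq: "AE x in lborel. ?P (?Q u) x = \<mu>\<^sup>2 * u x + ?P (?Q g) x + \<mu> * ?P g x"
      using \<open>AE x in lborel. ?P (\<lambda>x. ?Q (?P u') x - \<mu>\<^sup>2 * u' x) x = ?P h x\<close>
      by eventually_elim (auto simp: h_def u_def cutoff_def algebra_simps split: split_indicator)
    \<comment> \<open>Forced by \<open>Q u = \<mu> v + Q g\<close>; \<open>P v = \<mu> u + P g\<close> then follows from the equation for \<open>u\<close>.\<close>
    define v where "v = (\<lambda>x. (1 / \<mu>) * ?Q u x + (- 1 / \<mu>) * ?Q g x)"
    have v: "v \<in> L2 lborel" unfolding v_def by (intro L2_lincomb Q u g)
    have Qv: "AE x in lborel. ?Q v x = v x"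
      using band_limit_lincomb[OF Q[OF u] Q[OF g], of w "1 / \<mu>" "- 1 / \<mu>"]
      unfolding band_limit_idem[OF u] band_limit_idem[OF g] v_def[symmetric]
      by eventually_elim (simp add: v_def)
    have Pv: "AE x in lborel. ?P v x = \<mu> * u x + ?P g x"
      using eq
    proof eventually_elim
      fix x assume "?P (?Q u) x = \<mu>\<^sup>2 * u x + ?P (?Q g) x + \<mu> * ?P g x"
      then show "?P v x = \<mu> * u x + ?P g x"
        unfolding v_def Plin using \<mu> by (simp add: field_simps power2_eq_square)
    qed
    define f where "f = (\<lambda>x. (1 / z) * u x + (1 / z) * v x + (- 1 / z) * g x)"
    have f: "f \<in> L2 lborel" unfolding f_def by (intro L2_add L2_scale u v g)
    have "AE x in lborel. ?P f x + ?Q f x - z * f x = g x"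
      using Q3[OF u v g, of "1 / z" "1 / z" "- 1 / z"] Qv Pv
    proof eventually_elim
      fix x
      assume Qf: "?Q (\<lambda>y. 1 / z * u y + 1 / z * v y + - 1 / z * g y) x = 1 / z * ?Q u x + 1 / z * ?Q v x + - 1 / z * ?Q g x"
        and qv: "?Q v x = v x" and pv: "?P v x = \<mu> * u x + ?P g x"
      have "?P f x = (1 / z) * ?P u x + (1 / z) * ?P v x + (- 1 / z) * ?P g x"
        by (auto simp: f_def cutoff_def split: split_indicator)
      also have "\<dots> = (1 / z) * ((1 + \<mu>) * u x)"
        unfolding Pu pv by (simp add: algebra_simps)
      also have "\<dots> = u x" using z(1) by (simp add: z1)
      finally have pf: "?P f x = u x" .
      have "?Q u x - ?Q g x = \<mu> * v x" using \<mu> by (simp add: v_def field_simps)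
      then have "1 / z * ?Q u x + 1 / z * v x + - 1 / z * ?Q g x = (1 / z) * ((1 + \<mu>) * v x)"
        by (simp add: algebra_simps diff_divide_distrib[symmetric] add_divide_distrib[symmetric])
      also have "\<dots> = v x" using z(1) by (simp add: z1)
      finally have qf: "?Q f x = v x"
        using Qf unfolding f_def[symmetric] qv by simp
      have "z * f x = u x + v x - g x" using z(1) by (simp add: f_def field_simps)
      then show "?P f x + ?Q f x - z * f x = g x" by (simp add: pf qf)
    qed
    with f show "\<exists>f\<in>L2 lborel. AE x in lborel. ?P f x + ?Q f x - z * f x = g x" by blast
  qed
qed

theorem theorem3p1:
  fixes \<tau> \<omega> :: real and z :: complex
  assumes "\<tau> > 0" and "\<omega> > 0"
    and "z \<in> L2_spectrum lborel (\<lambda>f x. cutoff \<tau> f x + band_limit \<omega> f x)"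
    and "z \<noteq> 0" and "z \<noteq> 1"
  shows "\<exists>n::nat. (z - 1)\<^sup>2 = complex_of_real (sinc_eigenvalue (\<omega> * \<tau>) n)"
proof -
  have c: "\<omega> * \<tau> > 0" using assms by simp
  have ev: "(z - 1)\<^sup>2 \<in> L2_eigenvalues unit_interval_measure (sinc_operator (\<omega> * \<tau>))"
    using not_in_spectrum_cutoff_plus_band_limit[OF assms(1,2,4,5)] assms(3) by blast
  obtain r where r: "r \<ge> 0" "(z - 1)\<^sup>2 = complex_of_real r"
    by (rule sinc_eigenvalues_real_nonneg[OF c ev])
  have "r \<noteq> 0" using r(2) assms(5) by auto
  then have "r > 0" using r(1) by simp
  moreover have "r \<in> sinc_eigenvalues (\<omega> * \<tau>)"
    using ev r(2) by (simp add: sinc_eigenvalues_def)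
  ultimately have "sinc_eigenvalue (\<omega> * \<tau>) (card {\<nu> \<in> sinc_eigenvalues (\<omega> * \<tau>). \<nu> > r}) = r"
    by (rule sinc_eigenvalue_card[OF c])
  with r(2) show ?thesis by metis
qed

end
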